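(* Let $w>0$ and let $n\ge 3$ be an odd integer. On the hyperbolic plane $H^2$, among all ordinary reduced $n$-gons of minimal width $w$, the regular $n$-gons of minimal width $w$ have the greatest area; that is, $\operatorname{area}(R)\le \operatorname{area}(\widetilde R)$ for every ordinary reduced $n$-gon $R\subset H^2$ of minimal width $w$ and every regular $n$-gon $\widetilde R\subset H^2$ of minimal width $w$.
   Context: $H^2$ is the hyperbolic plane (constant curvature $-1$) with geodesic distance $d$. A set is convex if it contains the geodesic segment joining any two of its points; a convex body is a compact convex set with non-empty interior. A polygon is a convex body that is the convex hull of a finite set; an $n$-gon is a polygon with exactly $n$ vertices (extreme points). Width: a line $\ell$ is a supporting line of a convex body $K$ if $K\cap \ell\ne\emptyset$ and $K$ lies in one of the closed half-planes bounded by $\ell$. The width of $K$ with respect to the supporting line $\ell$ is the distance between $\ell$ and $\ell'$, where $\ell'$ is a (not necessarily unique) supporting line of $K$ most distant from $\ell$. The minimal width (also called thickness) $w(K)$ is the minimum of the width over all supporting lines of $K$. Ordinary reduced polygon: an $n$-gon with $n$ odd and vertices $v_1,\dots,v_n$ in cyclic order (indices mod $n$), of minimal width $w$, such that for every $i$ the distance from $v_i$ to the opposite side $[v_{i+\frac{n-1}{2}},v_{i+\frac{n+1}{2}}]$ equals $w$, and the orthogonal projection of $v_i$ onto the line through $v_{i+\frac{n-1}{2}}$ and $v_{i+\frac{n+1}{2}}$ lies in the relative interior of that side. A regular polygon is one with all sides of equal length and all angles equal. *)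

theory Defs
  imports "HOL-Analysis.Analysis"
begin

text \<open>
  We use the Beltrami--Klein model: the points of the hyperbolic plane are the points of the open
  Euclidean unit disc, the geodesic lines are its non-empty chords, and the topology is the
  Euclidean one. The metric tensor of curvature \<open>-1\<close> at \<open>p\<close> is
  \[ g_p(u,v) = \frac{u\cdot v}{1-|p|^2} + \frac{(p\cdot u)(p\cdot v)}{(1-|p|^2)^2}. \]
\<close>

definition H2 :: "(real ^ 2) set" where
  "H2 = ball 0 1"

definition hdist :: "real ^ 2 \<Rightarrow> real ^ 2 \<Rightarrow> real" where
  "hdist x y = arcosh ((1 - x \<bullet> y) / sqrt ((1 - x \<bullet> x) * (1 - y \<bullet> y)))"

definition klein_metric :: "real ^ 2 \<Rightarrow> real ^ 2 \<Rightarrow> real ^ 2 \<Rightarrow> real" where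
  "klein_metric p u v = (u \<bullet> v) / (1 - p \<bullet> p) + (p \<bullet> u) * (p \<bullet> v) / (1 - p \<bullet> p)\<^sup>2"

text \<open>
  The Riemannian area: the integral of the square root of the Gram determinant of the metric
  tensor in the coordinates of the disc.
\<close>

definition harea_density :: "real ^ 2 \<Rightarrow> real" where
  "harea_density p =
     sqrt (klein_metric p (axis 1 1) (axis 1 1) * klein_metric p (axis 2 1) (axis 2 1)
           - (klein_metric p (axis 1 1) (axis 2 1))\<^sup>2)"

definition harea :: "(real ^ 2) set \<Rightarrow> real" where
  "harea K = set_lebesgue_integral lborel K harea_density"

text \<open>
  The angle at \<open>p\<close> between the geodesic rays from \<open>p\<close> through \<open>x\<close> and through \<open>y\<close>. As geodesics
  are straight in this model, \<open>x - p\<close> and \<open>y - p\<close> are tangent vectors at \<open>p\<close> of these rays.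
\<close>

definition hangle :: "real ^ 2 \<Rightarrow> real ^ 2 \<Rightarrow> real ^ 2 \<Rightarrow> real" where
  "hangle p x y =
     arccos (klein_metric p (x - p) (y - p)
             / sqrt (klein_metric p (x - p) (x - p) * klein_metric p (y - p) (y - p)))"

definition geodesic_segment :: "real ^ 2 \<Rightarrow> real ^ 2 \<Rightarrow> (real ^ 2) set" where
  "geodesic_segment x y = {z \<in> H2. hdist x z + hdist z y = hdist x y}"

definition hconvex :: "(real ^ 2) set \<Rightarrow> bool" where
  "hconvex K \<longleftrightarrow> K \<subseteq> H2 \<and> (\<forall>x\<in>K. \<forall>y\<in>K. geodesic_segment x y \<subseteq> K)"

definition hconvex_body :: "(real ^ 2) set \<Rightarrow> bool" where
  "hconvex_body K \<longleftrightarrow> hconvex K \<and> compact K \<and> interior K \<noteq> {}"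

definition hpolygon :: "(real ^ 2) set \<Rightarrow> bool" where
  "hpolygon K \<longleftrightarrow> hconvex_body K \<and> (\<exists>F. finite F \<and> F \<subseteq> H2 \<and> K = hconvex hull F)"

definition hvertices :: "(real ^ 2) set \<Rightarrow> (real ^ 2) set" where
  "hvertices K = {v \<in> K. \<forall>x\<in>K. \<forall>y\<in>K. v \<in> geodesic_segment x y \<longrightarrow> v = x \<or> v = y}"

definition hngon :: "nat \<Rightarrow> (real ^ 2) set \<Rightarrow> bool" where
  "hngon n K \<longleftrightarrow> hpolygon K \<and> finite (hvertices K) \<and> card (hvertices K) = n"

definition hline :: "real ^ 2 \<Rightarrow> real ^ 2 \<Rightarrow> (real ^ 2) set" where
  "hline x y = H2 \<inter> affine hull {x, y}"

text \<open>
  A chord \<open>l\<close> determines \<open>(a, b)\<close> up to a non-zero factor, whose sign selects the half-plane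
  bounded by \<open>l\<close>.
\<close>

definition supporting_line :: "(real ^ 2) set \<Rightarrow> (real ^ 2) set \<Rightarrow> bool" where
  "supporting_line K l \<longleftrightarrow> K \<inter> l \<noteq> {} \<and>
     (\<exists>a b. a \<noteq> 0 \<and> l = {x \<in> H2. a \<bullet> x = b} \<and> K \<subseteq> {x \<in> H2. a \<bullet> x \<le> b})"

definition hsetdist :: "(real ^ 2) set \<Rightarrow> (real ^ 2) set \<Rightarrow> real" where
  "hsetdist S T = (INF (x, y) \<in> S \<times> T. hdist x y)"

text \<open>For a convex body the supremum and the infimum below are attained, by compactness.\<close>

definition hwidth :: "(real ^ 2) set \<Rightarrow> (real ^ 2) set \<Rightarrow> real" where
  "hwidth K l = (SUP l' \<in> {l'. supporting_line K l'}. hsetdist l l')"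

definition minimal_width :: "(real ^ 2) set \<Rightarrow> real" where
  "minimal_width K = (INF l \<in> {l. supporting_line K l}. hwidth K l)"

text \<open>
  The vertices are \<open>v 0, \<dots>, v (n - 1)\<close>. That they are listed in cyclic order is expressed by
  saying that consecutive ones span a side, that is, the line through them supports \<open>K\<close>.
\<close>

definition cyclic_vertices :: "nat \<Rightarrow> (nat \<Rightarrow> real ^ 2) \<Rightarrow> (real ^ 2) set \<Rightarrow> bool" where
  "cyclic_vertices n v K \<longleftrightarrow> bij_betw v {..<n} (hvertices K) \<and>
     (\<forall>i<n. supporting_line K (hline (v i) (v ((i + 1) mod n))))"

text \<open>
  The foot \<open>q\<close> of the perpendicular from \<open>p\<close> to the line \<open>l\<close>; if \<open>p\<close> lies on \<open>l\<close>, this forces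
  \<open>q = p\<close>.
\<close>

definition orthogonal_projection :: "(real ^ 2) set \<Rightarrow> real ^ 2 \<Rightarrow> real ^ 2 \<Rightarrow> bool" where
  "orthogonal_projection l p q \<longleftrightarrow> q \<in> l \<and> (\<forall>z\<in>l. klein_metric q (p - q) (z - q) = 0)"

definition ordinary_reduced :: "nat \<Rightarrow> real \<Rightarrow> (real ^ 2) set \<Rightarrow> bool" where
  "ordinary_reduced n w K \<longleftrightarrow> odd n \<and> hngon n K \<and> minimal_width K = w \<and>
     (\<exists>v. cyclic_vertices n v K \<and>
       (\<forall>i<n. let a = v ((i + (n - 1) div 2) mod n); b = v ((i + (n + 1) div 2) mod n) in
          hsetdist {v i} (geodesic_segment a b) = w \<and>
          (\<exists>q \<in> geodesic_segment a b - {a, b}. orthogonal_projection (hline a b) (v i) q)))"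

definition regular_hngon :: "nat \<Rightarrow> (real ^ 2) set \<Rightarrow> bool" where
  "regular_hngon n K \<longleftrightarrow> hngon n K \<and>
     (\<exists>v. cyclic_vertices n v K \<and>
       (\<exists>s. \<forall>i<n. hdist (v i) (v ((i + 1) mod n)) = s) \<and>
       (\<exists>\<alpha>. \<forall>i<n. hangle (v i) (v ((i + n - 1) mod n)) (v ((i + 1) mod n)) = \<alpha>))"


subsection \<open>Consistency of the model\<close>

lemma mem_H2: "x \<in> H2 \<longleftrightarrow> x \<bullet> x < 1"
  by (simp add: H2_def norm_lt_square)

lemma harea_density_eq:
  assumes "p \<in> H2"
  shows "harea_density p = (1 - p \<bullet> p) powr (- 3 / 2)"
proof -
  define r where "r = 1 - p \<bullet> p"
  have r: "r > 0" using assms by (simp add: r_def mem_H2)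
  have pp: "p \<bullet> p = (p $ 1)\<^sup>2 + (p $ 2)\<^sup>2"
    by (simp add: inner_vec_def sum_2 power2_eq_square)
  have e: "klein_metric p (axis 1 1) (axis 1 1) = 1 / r + (p $ 1)\<^sup>2 / r\<^sup>2"
    "klein_metric p (axis 2 1) (axis 2 1) = 1 / r + (p $ 2)\<^sup>2 / r\<^sup>2"
    "klein_metric p (axis 1 1) (axis 2 1) = p $ 1 * p $ 2 / r\<^sup>2"
    by (auto simp: klein_metric_def r_def inner_axis inner_axis_axis power2_eq_square)
       (simp add: axis_def)
  have "(1 / r + (p $ 1)\<^sup>2 / r\<^sup>2) * (1 / r + (p $ 2)\<^sup>2 / r\<^sup>2) - (p $ 1 * p $ 2 / r\<^sup>2)\<^sup>2
      = (r + p \<bullet> p) / r ^ 3"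
    using r unfolding pp by (simp add: field_simps power2_eq_square power3_eq_cube)
  also have "\<dots> = 1 / r ^ 3" by (simp add: r_def)
  finally have "harea_density p = sqrt (1 / r ^ 3)"
    unfolding harea_density_def e by simp
  also have "\<dots> = r powr (- 3 / 2)"
    using r by (simp add: powr_half_sqrt [symmetric] powr_minus_divide powr_powr real_sqrt_divide
        flip: powr_numeral)
  finally show ?thesis by (simp add: r_def)
qed

lemma cosh_hdist_ge:
  assumes "x \<in> H2" "y \<in> H2"
  shows "(1 - x \<bullet> y)\<^sup>2 \<ge> (1 - x \<bullet> x) * (1 - y \<bullet> y)" "1 - x \<bullet> y > 0"
    and "x \<noteq> y \<Longrightarrow> (1 - x \<bullet> y)\<^sup>2 > (1 - x \<bullet> x) * (1 - y \<bullet> y)"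
proof -
  have eq: "(1 - x \<bullet> y)\<^sup>2 - (1 - x \<bullet> x) * (1 - y \<bullet> y)
      = (1 - x \<bullet> x) * ((y - x) \<bullet> (y - x)) + (x \<bullet> (y - x))\<^sup>2"
    by (simp add: inner_diff inner_commute power2_eq_square algebra_simps)
  show "(1 - x \<bullet> y)\<^sup>2 \<ge> (1 - x \<bullet> x) * (1 - y \<bullet> y)"
    using assms eq mem_H2 by (smt (verit) inner_ge_zero mult_nonneg_nonneg zero_le_power2)
  have "x \<bullet> y \<le> norm x * norm y" by (rule norm_cauchy_schwarz)
  also have "\<dots> < 1" using assms
    by (metis H2_def mem_ball_0 mult_less_le_imp_less norm_ge_zero mult.right_neutral
        less_imp_le mult_left_le order_le_less_trans)
  finally show "1 - x \<bullet> y > 0" by simp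
  assume "x \<noteq> y"
  then have "(1 - x \<bullet> x) * ((y - x) \<bullet> (y - x)) > 0"
    using assms by (simp add: mem_H2)
  then show "(1 - x \<bullet> y)\<^sup>2 > (1 - x \<bullet> x) * (1 - y \<bullet> y)"
    using eq by (smt (verit) zero_le_power2)
qed

lemma
  assumes "x \<in> H2" "y \<in> H2"
  shows cosh_hdist: "cosh (hdist x y) = (1 - x \<bullet> y) / sqrt ((1 - x \<bullet> x) * (1 - y \<bullet> y))"
    and hdist_nonneg: "hdist x y \<ge> 0"
    and sinh_hdist: "sinh (hdist x y) =
      sqrt ((1 - x \<bullet> y)\<^sup>2 - (1 - x \<bullet> x) * (1 - y \<bullet> y)) / sqrt ((1 - x \<bullet> x) * (1 - y \<bullet> y))"
proof -
  define D where "D = (1 - x \<bullet> x) * (1 - y \<bullet> y)"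
  have D: "D > 0" using assms by (simp add: D_def mem_H2)
  have "sqrt D \<le> 1 - x \<bullet> y"
    using cosh_hdist_ge[OF assms] by (simp add: D_def real_le_lsqrt)
  then have *: "(1 - x \<bullet> y) / sqrt D \<ge> 1" using D by simp
  have hd: "hdist x y = arcosh ((1 - x \<bullet> y) / sqrt D)" by (simp add: hdist_def D_def)
  show "cosh (hdist x y) = (1 - x \<bullet> y) / sqrt ((1 - x \<bullet> x) * (1 - y \<bullet> y))"
    using * hd by (simp add: D_def)
  show "hdist x y \<ge> 0" using * hd by simp
  have "sinh (hdist x y) = sqrt (((1 - x \<bullet> y) / sqrt D)\<^sup>2 - 1)"
    using * hd by (simp add: sinh_arcosh_real)
  also have "((1 - x \<bullet> y) / sqrt D)\<^sup>2 - 1 = ((1 - x \<bullet> y)\<^sup>2 - D) / D"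
    unfolding power_divide using D by (simp add: field_simps)
  finally show "sinh (hdist x y) =
      sqrt ((1 - x \<bullet> y)\<^sup>2 - (1 - x \<bullet> x) * (1 - y \<bullet> y)) / sqrt ((1 - x \<bullet> x) * (1 - y \<bullet> y))"
    by (simp add: D_def real_sqrt_divide)
qed

lemma hdist_triangle_eq_iff:
  assumes x: "x \<in> H2" and y: "y \<in> H2" and z: "z \<in> H2"
  shows "hdist x z + hdist z y = hdist x y \<longleftrightarrow>
    (y $ 1 - x $ 1) * (z $ 2 - x $ 2) = (y $ 2 - x $ 2) * (z $ 1 - x $ 1) \<and>
    (1 - x \<bullet> z) * (1 - z \<bullet> y) \<le> (1 - x \<bullet> y) * (1 - z \<bullet> z)"
proof -
  define P Q R a b c where "P = 1 - x \<bullet> x" and "Q = 1 - y \<bullet> y" and "R = 1 - z \<bullet> z"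
    and "a = 1 - x \<bullet> y" and "b = 1 - x \<bullet> z" and "c = 1 - z \<bullet> y"
  note defs = P_def Q_def R_def a_def b_def c_def
  define D where "D = (y $ 1 - x $ 1) * (z $ 2 - x $ 2) - (y $ 2 - x $ 2) * (z $ 1 - x $ 1)"
  have pos: "P > 0" "Q > 0" "R > 0" using x y z by (simp_all add: defs mem_H2)
  have nn: "b\<^sup>2 - P * R \<ge> 0" "c\<^sup>2 - R * Q \<ge> 0"
    using cosh_hdist_ge(1)[OF x z] cosh_hdist_ge(1)[OF z y] by (simp_all add: defs)
  have key: "(a * R - b * c)\<^sup>2 = (b\<^sup>2 - P * R) * (c\<^sup>2 - R * Q) - R * D\<^sup>2"
    unfolding defs D_def inner_vec_def sum_2 inner_real_def by algebra
  have "hdist x z + hdist z y = hdist x y \<longleftrightarrow> cosh (hdist x z + hdist z y) = cosh (hdist x y)"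
    using hdist_nonneg x y z
    by (metis add_nonneg_nonneg arcosh_cosh_real)
  also have "\<dots> \<longleftrightarrow> b / sqrt (P * R) * (c / sqrt (R * Q))
      + sqrt (b\<^sup>2 - P * R) / sqrt (P * R) * (sqrt (c\<^sup>2 - R * Q) / sqrt (R * Q)) = a / sqrt (P * Q)"
    by (simp only: cosh_add cosh_hdist[OF x z] cosh_hdist[OF z y] cosh_hdist[OF x y]
        sinh_hdist[OF x z] sinh_hdist[OF z y] defs)
  also have "\<dots> \<longleftrightarrow> b * c + sqrt ((b\<^sup>2 - P * R) * (c\<^sup>2 - R * Q)) = a * R"
  proof -
    have "sqrt (P * R) * sqrt (R * Q) = R * sqrt (P * Q)"
      using pos by (simp add: real_sqrt_mult)
    then have "b / sqrt (P * R) * (c / sqrt (R * Q))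
      + sqrt (b\<^sup>2 - P * R) / sqrt (P * R) * (sqrt (c\<^sup>2 - R * Q) / sqrt (R * Q))
      = (b * c + sqrt ((b\<^sup>2 - P * R) * (c\<^sup>2 - R * Q))) / (R * sqrt (P * Q))"
      by (simp only: add_divide_distrib real_sqrt_mult times_divide_times_eq)
    moreover have "a / sqrt (P * Q) = a * R / (R * sqrt (P * Q))" using pos by simp
    moreover have "R * sqrt (P * Q) \<noteq> 0" using pos by simp
    ultimately show ?thesis by (metis divide_cancel_right)
  qed
  also have "\<dots> \<longleftrightarrow> D = 0 \<and> b * c \<le> a * R"
  proof
    assume *: "b * c + sqrt ((b\<^sup>2 - P * R) * (c\<^sup>2 - R * Q)) = a * R"
    then have "(a * R - b * c)\<^sup>2 = (b\<^sup>2 - P * R) * (c\<^sup>2 - R * Q)"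
      using nn by (smt (verit) mult_nonneg_nonneg real_sqrt_pow2)
    then have "D = 0" using key pos by simp
    moreover have "b * c \<le> a * R"
      using * nn by (smt (verit) mult_nonneg_nonneg real_sqrt_ge_zero)
    ultimately show "D = 0 \<and> b * c \<le> a * R" by blast
  next
    assume *: "D = 0 \<and> b * c \<le> a * R"
    then have "sqrt ((b\<^sup>2 - P * R) * (c\<^sup>2 - R * Q)) = a * R - b * c"
      using key by (intro real_sqrt_unique) auto
    then show "b * c + sqrt ((b\<^sup>2 - P * R) * (c\<^sup>2 - R * Q)) = a * R" by simp
  qed
  finally show ?thesis by (simp add: D_def defs)
qed

lemma geodesic_segment_eq_closed_segment:
  assumes x: "x \<in> H2" and y: "y \<in> H2"
  shows "geodesic_segment x y = closed_segment x y"
proof -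
  have sub: "closed_segment x y \<subseteq> H2"
    using x y unfolding H2_def by (simp add: closed_segment_subset)
  define E where "E = (1 - x \<bullet> x) * ((y - x) \<bullet> (y - x)) + (x \<bullet> (y - x))\<^sup>2"
  have diff: "(1 - x \<bullet> y) * (1 - z \<bullet> z) - (1 - x \<bullet> z) * (1 - z \<bullet> y) = t * (1 - t) * E"
    if "z = x + t *\<^sub>R (y - x)" for z t
    unfolding that E_def inner_vec_def sum_2 inner_real_def
    by (simp add: power2_eq_square algebra_simps)
  have E: "E > 0" if "x \<noteq> y"
    using that x unfolding E_def
    by (intro add_pos_nonneg mult_pos_pos) (auto simp: mem_H2)
  show ?thesis
  proof (intro equalityI subsetI)
    fix z assume "z \<in> closed_segment x y"
    then have "z \<in> H2" using sub by blast
    from \<open>z \<in> closed_segment x y\<close> obtain t where t: "0 \<le> t" "t \<le> 1" "z = (1 - t) *\<^sub>R x + t *\<^sub>R y"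
      by (auto simp: in_segment)
    then have t3: "z = x + t *\<^sub>R (y - x)" by (simp add: algebra_simps)
    have "(1 - x \<bullet> z) * (1 - z \<bullet> y) \<le> (1 - x \<bullet> y) * (1 - z \<bullet> z)"
    proof (cases "x = y")
      case False
      then have "t * (1 - t) * E \<ge> 0" using t E by (simp add: less_imp_le)
      then show ?thesis using diff[OF t3] by linarith
    qed (use t in simp)
    then show "z \<in> geodesic_segment x y"
      using \<open>z \<in> H2\<close> t3 by (simp add: geodesic_segment_def hdist_triangle_eq_iff[OF x y])
  next
    fix z assume "z \<in> geodesic_segment x y"
    then have z: "z \<in> H2"
      and D: "(y $ 1 - x $ 1) * (z $ 2 - x $ 2) = (y $ 2 - x $ 2) * (z $ 1 - x $ 1)"
      and le: "(1 - x \<bullet> z) * (1 - z \<bullet> y) \<le> (1 - x \<bullet> y) * (1 - z \<bullet> z)"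
      using hdist_triangle_eq_iff[OF x y] by (auto simp: geodesic_segment_def)
    show "z \<in> closed_segment x y"
    proof (cases "x = y")
      case True
      then have "z = x" using le cosh_hdist_ge(3)[OF x z]
        by (force simp: power2_eq_square inner_commute)
      then show ?thesis by simp
    next
      case False
      obtain t where t: "z = x + t *\<^sub>R (y - x)"
      proof (cases "y $ 1 = x $ 1")
        case True
        then have "y $ 2 \<noteq> x $ 2" using False by (auto simp: vec_eq_iff forall_2)
        then show ?thesis using D True
          by (intro that[of "(z $ 2 - x $ 2) / (y $ 2 - x $ 2)"]) (auto simp: vec_eq_iff forall_2)
      next
        case False
        then have "(z $ 1 - x $ 1) * (y $ 2 - x $ 2) / (y $ 1 - x $ 1) = z $ 2 - x $ 2"
          using D by (simp add: divide_eq_eq mult.commute)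
        then show ?thesis using False
          by (intro that[of "(z $ 1 - x $ 1) / (y $ 1 - x $ 1)"]) (auto simp: vec_eq_iff forall_2)
      qed
      have "t * (1 - t) * E \<ge> 0" using diff[OF t] le by linarith
      then have "t * (1 - t) \<ge> 0" using E[OF False] by (simp add: zero_le_mult_iff)
      then have "0 \<le> t" "t \<le> 1" by (auto simp: zero_le_mult_iff)
      then show ?thesis using t
        by (auto simp: in_segment algebra_simps intro!: exI[of _ t])
    qed
  qed
qed

lemma hconvex_iff: "hconvex K \<longleftrightarrow> K \<subseteq> H2 \<and> convex K"
  unfolding hconvex_def convex_contains_segment
  using geodesic_segment_eq_closed_segment by (metis subsetD)

end

theory Submission
  imports Defs
begin

text \<open>
  Let \<open>n = 2 m + 1\<close> and \<open>j = i + m + 1\<close>. In an ordinary reduced polygon the altitudes from \<open>v i\<close> and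
  \<open>v j\<close> cross at a point \<open>z\<close> and cut off a butterfly: two right triangles with vertex \<open>z\<close>, the same
  angle \<open>\<psi>\<close> at \<open>z\<close>, and hypotenuses and adjacent legs of total length \<open>w\<close> crosswise. Hence these
  triangles are congruent; let \<open>\<phi>\<close> be their angle at \<open>v i\<close> and \<open>v j\<close>. Each interior angle is a sum of two
  angles \<open>\<phi>\<close>, so by Gauss--Bonnet the area is \<open>(n - 2) \<pi> - 2 \<Sum> \<phi>\<close>. The butterflies cover the polygon: along
  the sequence \<open>i, i + m + 1, i + 2 (m + 1), \<dots>\<close> of odd period, the sides of the altitudes on which a
  given point lies cannot alternate. Comparing the area with the total area
  \<open>\<Sum> (\<pi> - 2 \<phi> - 2 \<psi>)\<close> of the butterflies gives \<open>\<Sum> \<psi> \<le> \<pi>\<close>.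

  For fixed \<open>w\<close> the angle \<open>\<psi>\<close> is a convex function of \<open>\<eta> = \<pi>/4 - \<phi>/2\<close>, because
  \<open>tan\<^sup>2 (\<psi>/2) = (1 - s\<^sup>2) tan\<^sup>2 \<eta> / (1 - s\<^sup>2 tan\<^sup>4 \<eta>)\<close> with \<open>s = tanh (w/2)\<close>. The area is
  \<open>4 \<Sum> \<eta> - 2 \<pi>\<close>, and the tangent at the value of \<open>\<eta>\<close> of the regular polygon, for which
  \<open>\<Sum> \<psi> \<ge> \<pi>\<close>, yields the claim. In the regular polygon \<open>w\<close> is at most the sum of inradius and
  circumradius, by the triangle inequality through the centre.
\<close>


section \<open>Angles in the Klein model\<close>

text \<open>Straight geodesics make convexity and incidence Euclidean, so signs of
  \<open>orient\<close> settle questions of position. Metric data live on the lifts (1, x):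
  \<open>pairing\<close> is their Lorentz product, and dividing it by the square roots of the
  self-products gives the cosh of the distance.

  The butterflies only have to cover the polygon: overlaps do no harm, since \<Sum> \<psi> is to be
  bounded from above.

  For the regular polygon one-sided estimates suffice, so its width is never computed. Let h be the
  sum of inradius and circumradius. The right triangle formed by the centre, a vertex and the
  midpoint of a side has hypotenuse and leg of total length h, and its angle at the centre is half a
  central angle. Winding around the centre bounds that angle below by \<pi>/n. Since w \<le> h and
  the apex angle for fixed \<eta> decreases in the width parameter, the bound survives at w.

  Equal sides and angles do not come with a symmetry group or a centre. They yield a linear
  recurrence for the vertices on the hyperboloid, and the centre is the normalised sum of
  these.\<close>

definition pairing :: "real ^ 2 \<Rightarrow> real ^ 2 \<Rightarrow> real" where
  "pairing x y = 1 - x \<bullet> y"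

text \<open>Twice the signed Euclidean area of the triangle, positive for counterclockwise order;
  the sign tells on which side of the geodesic through the first two points the third one
  lies.\<close>

definition orient :: "real ^ 2 \<Rightarrow> real ^ 2 \<Rightarrow> real ^ 2 \<Rightarrow> real" where
  "orient a b c = (b $ 1 - a $ 1) * (c $ 2 - a $ 2) - (b $ 2 - a $ 2) * (c $ 1 - a $ 1)"

text \<open>
  Up to a positive factor the real and imaginary parts of \<open>turn p x y\<close> are
  \<open>cosh d(p,x) cosh d(p,y) - cosh d(x,y)\<close> and the determinant of the three points on the
  hyperboloid, that is, the cosine and the sine of the signed angle at \<open>p\<close> from \<open>x\<close> to \<open>y\<close>.
\<close>

definition turn :: "real ^ 2 \<Rightarrow> real ^ 2 \<Rightarrow> real ^ 2 \<Rightarrow> complex" where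
  "turn p x y = Complex (pairing p x * pairing p y - pairing p p * pairing x y)
     (sqrt (pairing p p) * orient p x y)"

definition ang :: "real ^ 2 \<Rightarrow> real ^ 2 \<Rightarrow> real ^ 2 \<Rightarrow> real" where
  "ang p x y = Arg (turn p x y)"

lemma pairing_coord: "pairing x y = 1 - x $ 1 * y $ 1 - x $ 2 * y $ 2"
  by (simp add: pairing_def inner_vec_def sum_2)

lemma pairing_commute: "pairing x y = pairing y x"
  by (simp add: pairing_def inner_commute)

lemma pairing_pos: "x \<in> H2 \<Longrightarrow> y \<in> H2 \<Longrightarrow> pairing x y > 0"
  using cosh_hdist_ge(2) by (simp add: pairing_def)

lemma pairing_affine: "pairing p ((1 - t) *\<^sub>R x + t *\<^sub>R y) = (1 - t) * pairing p x + t * pairing p y"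
  by (simp add: pairing_coord algebra_simps)

lemma orient_cycle: "orient b c a = orient a b c"
  by (simp add: orient_def algebra_simps)

lemma orient_swap: "orient a c b = - orient a b c"
  by (simp add: orient_def algebra_simps)

lemma orient_reverse: "orient b a c = - orient a b c"
  by (simp add: orient_def algebra_simps)

lemma orient_self [simp]: "orient a a b = 0" "orient a b b = 0" "orient a b a = 0"
  by (simp_all add: orient_def algebra_simps)

lemma orient_affine:
  "orient a b ((1 - t) *\<^sub>R x + t *\<^sub>R y) = (1 - t) * orient a b x + t * orient a b y"
  by (simp add: orient_def algebra_simps)

text \<open>Three-term Pluecker relation of the vectors from \<open>p\<close>. It propagates
  positivity from the sides of a polygon to all triples of vertices.\<close>

lemma orient_pluecker:
  "orient p e b * orient p a c = orient p e a * orient p b c + orient p e c * orient p a b"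
  by (simp add: orient_def algebra_simps)

text \<open>This is cos^2 + sin^2 = 1 before normalisation: each factor is sinh^2 of the distance
  from \<open>p\<close>, times the two self-pairings.\<close>

lemma norm_turn:
  assumes "p \<in> H2"
  shows "(cmod (turn p x y))\<^sup>2 = ((pairing p x)\<^sup>2 - pairing p p * pairing x x)
     * ((pairing p y)\<^sup>2 - pairing p p * pairing y y)"
proof -
  have "(sqrt (pairing p p))\<^sup>2 = pairing p p" using pairing_pos[OF assms assms] by simp
  then show ?thesis
    unfolding turn_def cmod_power2 complex.sel power_mult_distrib
    unfolding pairing_coord orient_def by algebra
qed

lemma pairing_sq_ge: "x \<in> H2 \<Longrightarrow> y \<in> H2 \<Longrightarrow> (pairing x y)\<^sup>2 \<ge> pairing x x * pairing y y"
  using cosh_hdist_ge(1) by (simp add: pairing_def)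

lemma pairing_sq_gt: "x \<in> H2 \<Longrightarrow> y \<in> H2 \<Longrightarrow> x \<noteq> y \<Longrightarrow> (pairing x y)\<^sup>2 > pairing x x * pairing y y"
  using cosh_hdist_ge(3) by (simp add: pairing_def)

lemma turn_nonzero:
  assumes "p \<in> H2" "x \<in> H2" "y \<in> H2" "x \<noteq> p" "y \<noteq> p"
  shows "turn p x y \<noteq> 0"
proof
  assume "turn p x y = 0"
  then have "((pairing p x)\<^sup>2 - pairing p p * pairing x x)
     * ((pairing p y)\<^sup>2 - pairing p p * pairing y y) = 0" using norm_turn[OF assms(1), of x y] by simp
  then show False using pairing_sq_gt[of p x] pairing_sq_gt[of p y] assms by simp
qed

text \<open>If X, Y, Z are suitably scaled complex coordinates of the directions at \<open>p\<close>
  in an orthonormal frame, then \<open>turn p x y\<close> is the conjugate of X times Y. In the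
  product the middle direction contributes only |Y|^2.\<close>

lemma turn_mult:
  assumes "p \<in> H2"
  shows "turn p x y * turn p y z
    = of_real ((pairing p y)\<^sup>2 - pairing p p * pairing y y) * turn p x z"
proof -
  have r: "sqrt (pairing p p) * sqrt (pairing p p) = pairing p p"
    using pairing_pos[OF assms assms] by simp
  define s where "s = sqrt (pairing p p)"
  have s: "s * s = pairing p p" using r by (simp add: s_def)
  have "turn p x y * turn p y z =
     Complex ((pairing p x * pairing p y - pairing p p * pairing x y) * (pairing p y * pairing p z - pairing p p * pairing y z)
       - pairing p p * (orient p x y * orient p y z))
     (s * ((pairing p x * pairing p y - pairing p p * pairing x y) * orient p y z +
        (pairing p y * pairing p z - pairing p p * pairing y z) * orient p x y))"
    unfolding turn_def s_def[symmetric] complex_mult by (simp add: algebra_simps flip: s)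
  also have "(pairing p x * pairing p y - pairing p p * pairing x y) * (pairing p y * pairing p z - pairing p p * pairing y z)
       - pairing p p * (orient p x y * orient p y z)
      = ((pairing p y)\<^sup>2 - pairing p p * pairing y y) * (pairing p x * pairing p z - pairing p p * pairing x z)"
    unfolding pairing_coord orient_def by algebra
  also have "(pairing p x * pairing p y - pairing p p * pairing x y) * orient p y z +
        (pairing p y * pairing p z - pairing p p * pairing y z) * orient p x y
     = ((pairing p y)\<^sup>2 - pairing p p * pairing y y) * orient p x z"
    unfolding pairing_coord orient_def by algebra
  finally show ?thesis
    by (simp add: turn_def s_def complex_eq_iff algebra_simps)
qed

lemma turn_self: "turn p x x = of_real ((pairing p x)\<^sup>2 - pairing p p * pairing x x)"
  by (simp add: turn_def complex_eq_iff power2_eq_square)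

text \<open>For fixed \<open>p\<close> both components of \<open>turn\<close> are bilinear in the
  displacements from \<open>p\<close>, so sliding a point along its ray leaves the angle
  unchanged.\<close>

lemma turn_scale:
  assumes "x' - p = k *\<^sub>R (x - p)" "y' - p = l *\<^sub>R (y - p)"
  shows "turn p x' y' = of_real (k * l) * turn p x y"
proof -
  have c: "x' $ i = p $ i + k * (x $ i - p $ i)" "y' $ i = p $ i + l * (y $ i - p $ i)" for i
    using assms[THEN arg_cong[where f="\<lambda>v. v $ i"]] by simp_all
  have 1: "pairing p x' * pairing p y' - pairing p p * pairing x' y'
     = k * l * (pairing p x * pairing p y - pairing p p * pairing x y)"
    unfolding pairing_coord c by algebra
  have 2: "orient p x' y' = k * l * orient p x y"
    unfolding orient_def c by algebra
  show ?thesis unfolding turn_def 1 2 by (simp add: complex_eq_iff)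
qed

lemma ang_scale:
  assumes "x' - p = k *\<^sub>R (x - p)" "y' - p = l *\<^sub>R (y - p)" "k * l > 0"
  shows "ang p x' y' = ang p x y"
  unfolding ang_def turn_scale[OF assms(1,2)] by (rule Arg_times_of_real[OF assms(3)])

lemma ang_bounds:
  assumes "p \<in> H2" "orient p x y \<ge> 0"
  shows "0 \<le> ang p x y" "ang p x y \<le> pi"
proof -
  have "sqrt (pairing p p) > 0" using pairing_pos assms by simp
  then have "Im (turn p x y) \<ge> 0" using assms by (simp add: turn_def)
  then show "0 \<le> ang p x y" by (simp add: ang_def Arg_less_0)
  show "ang p x y \<le> pi" by (simp add: ang_def Arg_le_pi)
qed

lemma ang_bounds_strict:
  assumes "p \<in> H2" "orient p x y > 0"
  shows "0 < ang p x y" "ang p x y < pi"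
proof -
  have "sqrt (pairing p p) > 0" using pairing_pos assms by simp
  then have "Im (turn p x y) > 0" using assms by (simp add: turn_def)
  then have "0 < ang p x y \<and> ang p x y < pi" unfolding ang_def by (subst Arg_lt_pi)
  then show "0 < ang p x y" "ang p x y < pi" by auto
qed

lemma ang_add:
  assumes H: "p \<in> H2" "x \<in> H2" "y \<in> H2" "z \<in> H2" and ne: "x \<noteq> p" "y \<noteq> p" "z \<noteq> p"
    and o: "orient p x y \<ge> 0" "orient p y z \<ge> 0" and p: "ang p x z > 0"
  shows "ang p x y + ang p y z = ang p x z"
proof -
  have "turn p x y \<noteq> 0" "turn p y z \<noteq> 0" using turn_nonzero H ne by auto
  have k: "(pairing p y)\<^sup>2 - pairing p p * pairing y y > 0" using pairing_sq_gt[of p y] H ne by simp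
  have "Arg (turn p x y * turn p y z) = ang p x z"
    unfolding turn_mult[OF H(1)] ang_def using k by (simp only: Arg_times_of_real)
  moreover obtain j :: int where "Arg (turn p x y * turn p y z) = ang p x y + ang p y z + 2 * pi * j \<and> j \<in> {-1, 0, 1}"
  proof -
    have "Arg (turn p x y * turn p y z) = ang p x y + ang p y z + 0
       \<or> Arg (turn p x y * turn p y z) = ang p x y + ang p y z - 2 * pi
       \<or> Arg (turn p x y * turn p y z) = ang p x y + ang p y z + 2 * pi"
      using Arg_times'[OF \<open>turn p x y \<noteq> 0\<close> \<open>turn p y z \<noteq> 0\<close>] unfolding ang_def Let_def by auto
    then show ?thesis using that[of 0] that[of "-1"] that[of 1] by auto
  qed
  moreover have "ang p x y \<le> pi" "ang p y z \<le> pi" "ang p x y \<ge> 0" "ang p y z \<ge> 0" "ang p x z \<le> pi"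
    using ang_bounds[OF H(1)] o by (auto simp: ang_def Arg_le_pi)
  ultimately show ?thesis using p pi_gt_zero by auto
qed

section \<open>Gauss--Bonnet for triangles\<close>

lemma measurable_vec2:
  "(\<lambda>(x, y). vector [x, y] :: real ^ 2) \<in> borel_measurable (lborel \<Otimes>\<^sub>M lborel)"
proof -
  have "(\<lambda>z :: real \<times> real. vector [fst z, snd z] :: real ^ 2) = (\<lambda>z. axis 1 (fst z) + axis 2 (snd z))"
    by (auto simp: vec_eq_iff forall_2 axis_def)
  also have "\<dots> = (\<lambda>z. fst z *\<^sub>R axis 1 1 + snd z *\<^sub>R axis 2 1)"
    by (auto simp: vec_eq_iff forall_2 axis_def)
  also have "\<dots> \<in> borel_measurable (lborel \<Otimes>\<^sub>M lborel)" by measurable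
  finally show ?thesis by (simp add: case_prod_unfold)
qed

lemma lborel_vec2_eq_distr:
  "(lborel :: (real ^ 2) measure) = distr (lborel \<Otimes>\<^sub>M lborel) borel (\<lambda>(x, y). vector [x, y])"
proof (rule lborel_eqI)
  note meas = measurable_vec2
  fix l u :: "real ^ 2" assume lu: "\<And>b. b \<in> Basis \<Longrightarrow> l \<bullet> b \<le> u \<bullet> b"
  have le: "l $ i \<le> u $ i" for i using lu[of "axis i 1"] by (simp add: inner_axis axis_in_Basis_iff)
  have vi: "(\<lambda>(x, y). vector [x, y] :: real ^ 2) -` box l u \<inter> space (lborel \<Otimes>\<^sub>M lborel)
    = box (l $ 1) (u $ 1) \<times> box (l $ 2) (u $ 2)"
    by (auto simp: mem_box_cart forall_2 space_pair_measure)
  have "emeasure (distr (lborel \<Otimes>\<^sub>M lborel) borel (\<lambda>(x, y). vector [x, y])) (box l u)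
     = emeasure (lborel \<Otimes>\<^sub>M lborel) (box (l $ 1) (u $ 1) \<times> box (l $ 2) (u $ 2))"
    by (subst emeasure_distr[OF meas]) (simp_all add: vi)
  also have "\<dots> = ennreal ((u $ 1 - l $ 1) * (u $ 2 - l $ 2))"
    using le by (subst lborel.emeasure_pair_measure_Times) (auto simp: ennreal_mult)
  also have "(u $ 1 - l $ 1) * (u $ 2 - l $ 2) = (\<Prod>b\<in>Basis. (u - l) \<bullet> b)"
  proof -
    have "(\<Prod>b\<in>Basis. (u - l) \<bullet> b) = (\<Prod>i\<in>UNIV. (u - l) \<bullet> axis i 1)"
      by (rule prod.reindex_bij_betw[symmetric])
        (auto simp: bij_betw_def inj_on_def axis_eq_axis Basis_vec_def)
    then show ?thesis by (simp add: inner_axis UNIV_2)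
  qed
  finally show "emeasure (distr (lborel \<Otimes>\<^sub>M lborel) borel (\<lambda>(x, y). vector [x, y])) (box l u)
     = ennreal (\<Prod>b\<in>Basis. (u - l) \<bullet> b)" .
qed simp

lemma integral_vec2:
  fixes f :: "real ^ 2 \<Rightarrow> real"
  assumes "integrable lborel f"
  shows "integral\<^sup>L lborel f = (\<integral>y. (\<integral>x. f (vector [x, y]) \<partial>lborel) \<partial>lborel)"
proof -
  note meas = measurable_vec2
  have f: "f \<in> borel_measurable borel" using assms by simp
  have "integrable (lborel \<Otimes>\<^sub>M lborel) (\<lambda>z. f (case z of (x, y) \<Rightarrow> vector [x, y]))"
    using assms unfolding lborel_vec2_eq_distr by (subst (asm) integrable_distr_eq[OF meas f])
  then have i: "integrable (lborel \<Otimes>\<^sub>M lborel) (\<lambda>(x, y). f (vector [x, y]))"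
    by (simp add: case_prod_unfold)
  have "integral\<^sup>L lborel f = integral\<^sup>L (lborel \<Otimes>\<^sub>M lborel) (\<lambda>z. f (case z of (x, y) \<Rightarrow> vector [x, y]))"
    unfolding lborel_vec2_eq_distr by (rule integral_distr[OF meas f])
  also have "\<dots> = integral\<^sup>L (lborel \<Otimes>\<^sub>M lborel) (\<lambda>(x, y). f (vector [x, y]))"
    by (simp add: case_prod_unfold)
  also have "\<dots> = (\<integral>y. (\<integral>x. f (vector [x, y]) \<partial>lborel) \<partial>lborel)"
    using lborel_pair.integral_snd[OF i] by simp
  finally show ?thesis .
qed

lemma continuous_on_harea_density: "continuous_on H2 harea_density"
proof -
  have "continuous_on H2 (\<lambda>p :: real ^ 2. (1 - p \<bullet> p) powr (- 3 / 2))"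
    by (intro continuous_intros) (auto simp: mem_H2)
  then show ?thesis by (rule continuous_on_eq) (simp add: harea_density_eq)
qed

lemma harea_density_nonneg: "p \<in> H2 \<Longrightarrow> harea_density p \<ge> 0"
  by (simp add: harea_density_eq)

lemma harea_integrable:
  assumes "compact S" "S \<subseteq> H2"
  shows "set_integrable lborel S harea_density"
  using borel_integrable_compact[OF assms(1) continuous_on_subset[OF continuous_on_harea_density assms(2)]]
  by (simp add: set_integrable_def)

text \<open>With a = 1 - y^2 this is the primitive x / (a sqrt (a - x^2)) of (a - x^2)^(-3/2), the
  area density along the horizontal chord at height \<open>y\<close>.\<close>

lemma DERIV_slice:
  fixes y :: real
  assumes "1 - y\<^sup>2 - x\<^sup>2 > 0"
  shows "((\<lambda>x. x / ((1 - y\<^sup>2) * sqrt (1 - y\<^sup>2 - x\<^sup>2))) has_real_derivative (1 - y\<^sup>2 - x\<^sup>2) powr (- 3 / 2)) (at x)"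
proof -
  define q where "q = 1 - y\<^sup>2 - x\<^sup>2"
  have q: "q > 0" "1 - y\<^sup>2 > 0" using assms by (auto simp: q_def) (smt (verit) zero_le_power2)
  have e: "q powr (- 3 / 2) = 1 / (q * sqrt q)"
  proof -
    have "q powr (- 3 / 2) = inverse (q powr (1 + 1/2))" by (simp flip: powr_minus)
    also have "q powr (1 + 1/2) = q * sqrt q" using q by (subst powr_add) (simp add: powr_half_sqrt)
    finally show ?thesis by (simp add: inverse_eq_divide)
  qed
  have s2: "sqrt q * sqrt q = q" using q by simp
  have "((\<lambda>x. 1 - y\<^sup>2 - x\<^sup>2) has_real_derivative (- 2 * x)) (at x)"
    by (auto intro!: derivative_eq_intros)
  from DERIV_chain2[OF DERIV_real_sqrt this]
  have d: "((\<lambda>x. sqrt (1 - y\<^sup>2 - x\<^sup>2)) has_real_derivative (inverse (sqrt q) / 2 * (- 2 * x))) (at x)"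
    using q by (simp add: q_def)
  have "((\<lambda>x. x / ((1 - y\<^sup>2) * sqrt (1 - y\<^sup>2 - x\<^sup>2))) has_real_derivative
    (1 * ((1 - y\<^sup>2) * sqrt q) - x * ((1 - y\<^sup>2) * (inverse (sqrt q) / 2 * (- 2 * x)))) /
    (((1 - y\<^sup>2) * sqrt q) * ((1 - y\<^sup>2) * sqrt q))) (at x)"
    using DERIV_divide[OF DERIV_ident DERIV_cmult[OF d, of "1 - y\<^sup>2"]] q by (simp add: q_def)
  also have "(1 * ((1 - y\<^sup>2) * sqrt q) - x * ((1 - y\<^sup>2) * (inverse (sqrt q) / 2 * (- 2 * x)))) /
    (((1 - y\<^sup>2) * sqrt q) * ((1 - y\<^sup>2) * sqrt q)) = 1 / (q * sqrt q)"
  proof -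
    have "1 * ((1 - y\<^sup>2) * sqrt q) - x * ((1 - y\<^sup>2) * (inverse (sqrt q) / 2 * (- 2 * x)))
      = (1 - y\<^sup>2) * (sqrt q * sqrt q + x * x) / sqrt q" using q by (simp add: field_simps)
    also have "sqrt q * sqrt q + x * x = 1 - y\<^sup>2" using s2 by (simp add: q_def power2_eq_square)
    finally have *: "1 * ((1 - y\<^sup>2) * sqrt q) - x * ((1 - y\<^sup>2) * (inverse (sqrt q) / 2 * (- 2 * x)))
      = (1 - y\<^sup>2) * (1 - y\<^sup>2) / sqrt q" .
    have "Y * Y / r / (Y * r * (Y * r)) = 1 / (r * r * r)" if "Y \<noteq> 0" for Y r :: real
      using that by simp
    from this[of "1 - y\<^sup>2" "sqrt q"] show ?thesis unfolding * using q s2 by simp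
  qed
  finally show ?thesis unfolding q_def[symmetric] e .
qed

text \<open>The slice primitive, evaluated on an edge, has an arctangent as its own primitive in
  \<open>y\<close>. This is where area becomes angle.\<close>

lemma DERIV_edge:
  fixes y :: real
  assumes r: "1 - y\<^sup>2 - (\<alpha> + \<beta> * y)\<^sup>2 > 0"
  shows "((\<lambda>y. arctan ((\<beta> + \<alpha> * y) / sqrt (1 - y\<^sup>2 - (\<alpha> + \<beta> * y)\<^sup>2))) has_real_derivative
     (\<alpha> + \<beta> * y) / ((1 - y\<^sup>2) * sqrt (1 - y\<^sup>2 - (\<alpha> + \<beta> * y)\<^sup>2))) (at y)"
proof -
  define q where "q = 1 - y\<^sup>2 - (\<alpha> + \<beta> * y)\<^sup>2"
  define s where "s = sqrt q"
  define N where "N = \<beta> + \<alpha> * y"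
  have q: "q > 0" "1 - y\<^sup>2 > 0" using assms by (auto simp: q_def) (smt (verit) zero_le_power2)
  have s: "s > 0" "s * s = q" using q by (simp_all add: s_def)
  \<comment> \<open>The sum splits into 1 - y^2 and a constant of the edge; the constant is positive
    because the edge meets the open disc.\<close>
  have K: "N\<^sup>2 + q = (1 - y\<^sup>2) * (1 + \<beta>\<^sup>2 - \<alpha>\<^sup>2)"
    unfolding N_def q_def by algebra
  have "N\<^sup>2 + q > 0" using q by (smt (verit) zero_le_power2)
  then have Kp: "1 + \<beta>\<^sup>2 - \<alpha>\<^sup>2 > 0" using K q by (simp add: zero_less_mult_iff)
  have "((\<lambda>y. arctan ((\<beta> + \<alpha> * y) / sqrt (1 - y\<^sup>2 - (\<alpha> + \<beta> * y)\<^sup>2))) has_real_derivative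
     inverse (1 + (N / s)\<^sup>2) * ((\<alpha> * s - N * ((- 2 * y - 2 * (\<alpha> + \<beta> * y) * \<beta>) / (2 * s))) / (s * s))) (at y)"
  proof -
    have "((\<lambda>y. 1 - y\<^sup>2 - (\<alpha> + \<beta> * y)\<^sup>2) has_real_derivative (- 2 * y - 2 * (\<alpha> + \<beta> * y) * \<beta>)) (at y)"
      by (auto intro!: derivative_eq_intros)
    from DERIV_chain2[OF DERIV_real_sqrt this]
    have "((\<lambda>y. sqrt (1 - y\<^sup>2 - (\<alpha> + \<beta> * y)\<^sup>2)) has_real_derivative
        ((- 2 * y - 2 * (\<alpha> + \<beta> * y) * \<beta>) / (2 * s))) (at y)"
      using q s by (simp add: q_def s_def field_simps)
    moreover have "((\<lambda>y. \<beta> + \<alpha> * y) has_real_derivative \<alpha>) (at y)"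
      by (auto intro!: derivative_eq_intros)
    ultimately have "((\<lambda>y. (\<beta> + \<alpha> * y) / sqrt (1 - y\<^sup>2 - (\<alpha> + \<beta> * y)\<^sup>2)) has_real_derivative
      ((\<alpha> * s - N * ((- 2 * y - 2 * (\<alpha> + \<beta> * y) * \<beta>) / (2 * s))) / (s * s))) (at y)"
      using DERIV_divide s by (fastforce simp: s_def q_def N_def)
    from DERIV_chain2[OF DERIV_arctan this] show ?thesis by (simp add: s_def q_def N_def)
  qed
  also have "inverse (1 + (N / s)\<^sup>2) = s * s / (N\<^sup>2 + q)"
    using s by (simp add: field_simps power2_eq_square flip: s(2))
  also have "s * s / (N\<^sup>2 + q) * ((\<alpha> * s - N * ((- 2 * y - 2 * (\<alpha> + \<beta> * y) * \<beta>) / (2 * s))) / (s * s))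
     = (\<alpha> * s - N * ((- 2 * y - 2 * (\<alpha> + \<beta> * y) * \<beta>) / (2 * s))) / (N\<^sup>2 + q)" using s q by simp
  also have "\<alpha> * s - N * ((- 2 * y - 2 * (\<alpha> + \<beta> * y) * \<beta>) / (2 * s)) = (\<alpha> * q + N * (y + (\<alpha> + \<beta> * y) * \<beta>)) / s"
    using s by (simp add: field_simps)
  also have "\<alpha> * q + N * (y + (\<alpha> + \<beta> * y) * \<beta>) = (\<alpha> + \<beta> * y) * (1 + \<beta>\<^sup>2 - \<alpha>\<^sup>2)"
    unfolding q_def N_def by algebra
  also have "(\<alpha> + \<beta> * y) * (1 + \<beta>\<^sup>2 - \<alpha>\<^sup>2) / s / (N\<^sup>2 + q) = (\<alpha> + \<beta> * y) / ((1 - y\<^sup>2) * s)"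
  proof -
    have *: "a * K / s / (Y * K) = a / (Y * s)" if "K > 0" for a K Y :: real
      using that by (simp add: mult.commute)
    show ?thesis unfolding K by (rule *[OF Kp])
  qed
  finally show ?thesis by (simp add: s_def q_def)
qed

text \<open>
  The edge \<open>x = \<alpha> + \<beta> y\<close> makes the angle \<open>\<pi>/2 - edge_angle \<alpha> \<beta> y\<close> with the horizontal chord at height
  \<open>y\<close>. As horizontal chords are perpendicular to the vertical diameter, the area between the
  diameter and the edge is an angle defect, hence a difference of edge angles.
\<close>

definition edge_angle :: "real \<Rightarrow> real \<Rightarrow> real \<Rightarrow> real" where
  "edge_angle \<alpha> \<beta> y = arctan ((\<beta> + \<alpha> * y) / sqrt (1 - y\<^sup>2 - (\<alpha> + \<beta> * y)\<^sup>2))"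

text \<open>Fubini and the fundamental theorem in each coordinate. The parallel sides may shrink to
  points, so triangles with a horizontal side are included.\<close>

lemma harea_trapezoid:
  fixes c d \<alpha> \<beta> \<gamma> \<delta> :: real
  defines "S \<equiv> {p. c \<le> p $ 2 \<and> p $ 2 \<le> d \<and> \<alpha> + \<beta> * p $ 2 \<le> p $ 1 \<and> p $ 1 \<le> \<gamma> + \<delta> * p $ 2}"
  assumes cd: "c \<le> d" and le: "\<And>y. c \<le> y \<Longrightarrow> y \<le> d \<Longrightarrow> \<alpha> + \<beta> * y \<le> \<gamma> + \<delta> * y"
    and S: "compact S" "S \<subseteq> H2"
  shows "harea S = (edge_angle \<gamma> \<delta> d - edge_angle \<gamma> \<delta> c) - (edge_angle \<alpha> \<beta> d - edge_angle \<alpha> \<beta> c)"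
proof -
  define H where "H y x = x / ((1 - y\<^sup>2) * sqrt (1 - y\<^sup>2 - x\<^sup>2))" for y x :: real
  have pos: "1 - y\<^sup>2 - x\<^sup>2 > 0" if "c \<le> y" "y \<le> d" "\<alpha> + \<beta> * y \<le> x" "x \<le> \<gamma> + \<delta> * y" for x y
  proof -
    have "vector [x, y] \<in> S" using that by (simp add: S_def)
    then have "(vector [x, y] :: real ^ 2) \<in> H2" using S by blast
    then show ?thesis by (simp add: mem_H2 inner_vec_def sum_2 power2_eq_square)
  qed
  have int: "integrable lborel (\<lambda>p. indicator S p *\<^sub>R harea_density p)"
    using harea_integrable[OF S] by (simp add: set_integrable_def)
  have inner: "(\<integral>x. indicator S (vector [x, y]) *\<^sub>R harea_density (vector [x, y]) \<partial>lborel)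
     = (H y (\<gamma> + \<delta> * y) - H y (\<alpha> + \<beta> * y)) * indicator {c..d} y" for y
  proof (cases "c \<le> y \<and> y \<le> d")
    case True
    have "(\<lambda>x. indicator S (vector [x, y]) *\<^sub>R harea_density (vector [x, y]))
      = (\<lambda>x. (1 - y\<^sup>2 - x\<^sup>2) powr (- 3 / 2) * indicator {\<alpha> + \<beta> * y .. \<gamma> + \<delta> * y} x)"
    proof
      fix x
      show "indicator S (vector [x, y]) *\<^sub>R harea_density (vector [x, y])
         = (1 - y\<^sup>2 - x\<^sup>2) powr (- 3 / 2) * indicator {\<alpha> + \<beta> * y .. \<gamma> + \<delta> * y} x"
      proof (cases "vector [x, y] \<in> S")
        case True
        then have "(vector [x, y] :: real ^ 2) \<in> H2" using S by blast
        then show ?thesis using True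
          by (simp add: harea_density_eq S_def inner_vec_def sum_2 power2_eq_square algebra_simps)
      next
        case False
        then show ?thesis using \<open>c \<le> y \<and> y \<le> d\<close> by (auto simp: S_def indicator_def)
      qed
    qed
    moreover have "integral\<^sup>L lborel (\<lambda>x. (1 - y\<^sup>2 - x\<^sup>2) powr (- 3 / 2) * indicator {\<alpha> + \<beta> * y .. \<gamma> + \<delta> * y} x) = H y (\<gamma> + \<delta> * y) - H y (\<alpha> + \<beta> * y)"
    proof (rule integral_FTC_Icc_real)
      show "\<alpha> + \<beta> * y \<le> \<gamma> + \<delta> * y" using le True by blast
      fix x assume x: "\<alpha> + \<beta> * y \<le> x" "x \<le> \<gamma> + \<delta> * y"
      have p: "1 - y\<^sup>2 - x\<^sup>2 > 0" using pos x True by blast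
      show "DERIV (H y) x :> (1 - y\<^sup>2 - x\<^sup>2) powr (- 3 / 2)"
        unfolding H_def using DERIV_slice[OF p] .
      show "isCont (\<lambda>x. (1 - y\<^sup>2 - x\<^sup>2) powr (- 3 / 2)) x"
        using p by (intro continuous_intros) auto
    qed
    ultimately show ?thesis using True by simp
  next
    case False
    then have "indicator S (vector [x, y] :: real ^ 2) = (0 :: real)" for x
      by (auto simp: S_def indicator_def)
    then show ?thesis using False by auto
  qed
  have "harea S = (\<integral>y. (H y (\<gamma> + \<delta> * y) - H y (\<alpha> + \<beta> * y)) * indicator {c..d} y \<partial>lborel)"
    unfolding harea_def set_lebesgue_integral_def integral_vec2[OF int] inner ..
  also have "\<dots> = (edge_angle \<gamma> \<delta> d - edge_angle \<alpha> \<beta> d) - (edge_angle \<gamma> \<delta> c - edge_angle \<alpha> \<beta> c)"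
  proof (rule integral_FTC_Icc_real[where F = "\<lambda>y. edge_angle \<gamma> \<delta> y - edge_angle \<alpha> \<beta> y"])
    fix y assume y: "c \<le> y" "y \<le> d"
    have p: "1 - y\<^sup>2 - (\<gamma> + \<delta> * y)\<^sup>2 > 0" "1 - y\<^sup>2 - (\<alpha> + \<beta> * y)\<^sup>2 > 0" using pos y le by auto
    have "1 - y\<^sup>2 > 0" using p by (smt (verit) zero_le_power2)
    show "DERIV (\<lambda>y. edge_angle \<gamma> \<delta> y - edge_angle \<alpha> \<beta> y) y :> H y (\<gamma> + \<delta> * y) - H y (\<alpha> + \<beta> * y)"
      unfolding edge_angle_def H_def by (intro DERIV_diff DERIV_edge p)
    show "isCont (\<lambda>y. H y (\<gamma> + \<delta> * y) - H y (\<alpha> + \<beta> * y)) y"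
      unfolding H_def using p \<open>1 - y\<^sup>2 > 0\<close> by (intro continuous_intros) auto
  qed (use cd in auto)
  finally show ?thesis by simp
qed

lemma harea_Un:
  assumes "compact S" "S \<subseteq> H2" "compact T" "T \<subseteq> H2"
    and ab: "a \<noteq> b" and sub: "S \<inter> T \<subseteq> {x. orient a b x = 0}"
  shows "harea (S \<union> T) = harea S + harea T"
proof -
  define n :: "real ^ 2" where "n = vector [a $ 2 - b $ 2, b $ 1 - a $ 1]"
  have n: "n \<noteq> 0" using ab by (auto simp: n_def vec_eq_iff forall_2)
  have "{x. orient a b x = 0} = {x. n \<bullet> x = n \<bullet> a}"
    by (auto simp: orient_def n_def inner_vec_def sum_2 algebra_simps)
  then have "negligible {x. orient a b x = 0}" using negligible_hyperplane[of n "n \<bullet> a"] n by simp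
  then have "negligible (S \<inter> T)" using sub negligible_subset by blast
  have n: "S \<inter> T \<in> null_sets lebesgue" using \<open>negligible (S \<inter> T)\<close> by (simp add: negligible_iff_null_sets)
  moreover have "S \<inter> T \<in> sets lborel" using assms by (auto intro!: borel_closed compact_imp_closed)
  ultimately have "S \<inter> T \<in> null_sets lborel" by (simp add: null_sets_completion_iff)
  then have "AE x in lborel. \<not> (x \<in> S \<and> x \<in> T)" using AE_not_in by fastforce
  then show ?thesis unfolding harea_def
    by (intro set_integral_Un_AE harea_integrable assms)
      (use assms in \<open>auto intro!: borel_closed compact_imp_closed\<close>)
qed

lemma orient_sum: "orient a b x + orient b c x + orient c a x = orient a b c"
  by (simp add: orient_def algebra_simps)

text \<open>The three orientations divided by \<open>orient a b c\<close> are the barycentric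
  coordinates of \<open>x\<close>.\<close>

lemma mem_triangle_iff:
  assumes "orient a b c > 0"
  shows "x \<in> convex hull {a, b, c} \<longleftrightarrow> orient a b x \<ge> 0 \<and> orient b c x \<ge> 0 \<and> orient c a x \<ge> 0"
proof
  assume "x \<in> convex hull {a, b, c}"
  then obtain u v w where w: "0 \<le> u" "0 \<le> v" "0 \<le> w" "u + v + w = 1" and x: "x = u *\<^sub>R a + v *\<^sub>R b + w *\<^sub>R c"
    by (auto simp: convex_hull_3)
  have u: "u = 1 - v - w" using w by simp
  have "orient a b x = w * orient a b c" "orient b c x = u * orient a b c" "orient c a x = v * orient a b c"
    unfolding x orient_def u by (simp_all add: algebra_simps)
  then show "orient a b x \<ge> 0 \<and> orient b c x \<ge> 0 \<and> orient c a x \<ge> 0" using w assms by simp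
next
  assume o: "orient a b x \<ge> 0 \<and> orient b c x \<ge> 0 \<and> orient c a x \<ge> 0"
  let ?D = "orient a b c"
  have 1: "orient b c x / ?D + orient c a x / ?D + orient a b x / ?D = 1"
    using assms by (simp flip: add_divide_distrib orient_sum[of a b x c] add: algebra_simps)
  have "?D *\<^sub>R x = orient b c x *\<^sub>R a + orient c a x *\<^sub>R b + orient a b x *\<^sub>R c"
    by (simp add: vec_eq_iff forall_2 orient_def algebra_simps)
  then have "(1 / ?D) *\<^sub>R (?D *\<^sub>R x) = (1 / ?D) *\<^sub>R (orient b c x *\<^sub>R a + orient c a x *\<^sub>R b + orient a b x *\<^sub>R c)"
    by simp
  then have "x = (orient b c x / ?D) *\<^sub>R a + (orient c a x / ?D) *\<^sub>R b + (orient a b x / ?D) *\<^sub>R c"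
    using assms by (simp add: scaleR_add_right)
  moreover have "orient b c x / ?D \<ge> 0" "orient c a x / ?D \<ge> 0" "orient a b x / ?D \<ge> 0" using o assms by auto
  ultimately show "x \<in> convex hull {a, b, c}" unfolding convex_hull_3 mem_Collect_eq using 1 by blast
qed

lemma convex_hull_subset_H2: "S \<subseteq> H2 \<Longrightarrow> convex hull S \<subseteq> H2"
  unfolding H2_def by (simp add: hull_minimal)

text \<open>The direction \<open>(\<beta>, 1)\<close> in an orthogonal frame at \<open>v\<close> whose first vector is horizontal.\<close>

definition slope_dir :: "real ^ 2 \<Rightarrow> real \<Rightarrow> complex" where
  "slope_dir v \<beta> = Complex (\<beta> * (1 - (v $ 2)\<^sup>2) + v $ 1 * v $ 2) (sqrt (pairing v v))"

text \<open>On the edge the direction becomes \<open>Complex N r\<close> with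
  \<open>N = \<beta> + \<alpha> * v $ 2\<close> and \<open>r > 0\<close>. Its argument is the
  arccotangent of N / r, and \<open>edge_angle\<close> is the arctangent of the same ratio.\<close>

lemma Arg_slope_dir:
  assumes "v \<in> H2" and "v $ 1 = \<alpha> + \<beta> * v $ 2"
  shows "Arg (slope_dir v \<beta>) = pi / 2 - edge_angle \<alpha> \<beta> (v $ 2)" "0 < Arg (slope_dir v \<beta>)" "Arg (slope_dir v \<beta>) < pi"
proof -
  define r where "r = sqrt (pairing v v)"
  have r: "r > 0" using pairing_pos assms by (simp add: r_def)
  define N where "N = \<beta> + \<alpha> * v $ 2"
  have sd: "slope_dir v \<beta> = Complex N r"
    by (simp add: slope_dir_def r_def N_def assms(2) power2_eq_square algebra_simps)
  have e: "edge_angle \<alpha> \<beta> (v $ 2) = arctan (N / r)"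
    unfolding edge_angle_def N_def r_def pairing_coord assms(2) by (simp add: power2_eq_square algebra_simps)
  define \<theta> where "\<theta> = arctan (N / r)"
  have th: "- (pi / 2) < \<theta>" "\<theta> < pi / 2" unfolding \<theta>_def by (rule arctan_lbound arctan_ubound)+
  have c: "cos \<theta> > 0" using th by (simp add: cos_gt_zero_pi)
  have "N = r * tan \<theta>" using r by (simp add: \<theta>_def tan_arctan)
  have "Complex N r = rcis (r / cos \<theta>) (pi / 2 - \<theta>)"
    using c by (simp add: complex_eq_iff \<open>N = r * tan \<theta>\<close> tan_def sin_diff cos_diff)
  then have "Arg (Complex N r) = pi / 2 - \<theta>"
    using c r th by (intro Arg_unique'[of "r / cos \<theta>"]) auto
  then show "Arg (slope_dir v \<beta>) = pi / 2 - edge_angle \<alpha> \<beta> (v $ 2)"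
     "0 < Arg (slope_dir v \<beta>)" "Arg (slope_dir v \<beta>) < pi"
    using th by (simp_all add: sd e \<theta>_def)
qed

lemma Arg_cnj_mult_upper:
  assumes "0 < Arg z" "Arg z < pi" "0 < Arg w" "Arg w < pi"
  shows "Arg (cnj z * w) = Arg w - Arg z"
proof -
  have z: "z \<notin> \<real>" using assms Arg_eq_0_pi by force
  have "z \<noteq> 0" "w \<noteq> 0" using assms by (metis Arg_of_real of_real_0 order_less_irrefl)+
  have "Arg (cnj z) = - Arg z" using z by (simp add: Arg_cnj)
  then show ?thesis using assms \<open>z \<noteq> 0\<close> \<open>w \<noteq> 0\<close> by (subst Arg_times) auto
qed

text \<open>The conjugate-product form of \<open>turn\<close> for two sloped edges. The factor 1 -
  y^2 appears because the frame vectors are not normalised; it is positive and disappears in the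
  argument.\<close>

lemma turn_slopes:
  assumes "v \<in> H2" "x $ 1 = v $ 1 + k * \<beta>" "x $ 2 = v $ 2 + k" "y $ 1 = v $ 1 + l * \<delta>" "y $ 2 = v $ 2 + l"
  shows "of_real (1 - (v $ 2)\<^sup>2) * turn v x y = of_real (k * l) * (cnj (slope_dir v \<beta>) * slope_dir v \<delta>)"
proof -
  define r where "r = sqrt (pairing v v)"
  have r: "r * r = 1 - v $ 1 * v $ 1 - v $ 2 * v $ 2" using pairing_pos[OF assms(1,1)]
    by (simp add: r_def pairing_coord)
  show ?thesis
    unfolding turn_def slope_dir_def r_def[symmetric] complex_eq_iff
    apply (simp add: pairing_coord orient_def assms(2-) r)
    by (auto simp: power2_eq_square algebra_simps)
qed

lemma turn_horizontal:
  assumes "v \<in> H2" "x $ 1 = v $ 1 + h" "x $ 2 = v $ 2" "y $ 1 = v $ 1 + l * \<delta>" "y $ 2 = v $ 2 + l"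
  shows "turn v x y = of_real (h * l) * slope_dir v \<delta>" "turn v y x = of_real (- h * l) * (- cnj (slope_dir v \<delta>))"
  unfolding turn_def slope_dir_def complex_eq_iff
  by (auto simp: pairing_coord orient_def assms(2-) power2_eq_square algebra_simps)

lemma ang_slopes:
  assumes "v \<in> H2" "x $ 1 = v $ 1 + k * \<beta>" "x $ 2 = v $ 2 + k" "y $ 1 = v $ 1 + l * \<delta>" "y $ 2 = v $ 2 + l" "k * l > 0"
  shows "ang v x y = Arg (slope_dir v \<delta>) - Arg (slope_dir v \<beta>)"
proof -
  have "(v $ 2)\<^sup>2 < 1" using assms(1) unfolding mem_H2 inner_vec_def sum_2
    by (simp add: power2_eq_square) (smt (verit) zero_le_square)
  then have "ang v x y = Arg (of_real (1 - (v $ 2)\<^sup>2) * turn v x y)"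
    unfolding ang_def by (subst Arg_times_of_real) auto
  also have "\<dots> = Arg (cnj (slope_dir v \<beta>) * slope_dir v \<delta>)"
    unfolding turn_slopes[OF assms(1-5)] by (rule Arg_times_of_real[OF assms(6)])
  also have "\<dots> = Arg (slope_dir v \<delta>) - Arg (slope_dir v \<beta>)"
    by (intro Arg_cnj_mult_upper Arg_slope_dir(2,3)[where \<alpha> = "v $ 1 - _ * v $ 2"] assms) auto
  finally show ?thesis .
qed

text \<open>Here \<open>orient v x y = h * l\<close>, so the sign of this product decides which
  order of the two rays is counterclockwise.\<close>

lemma ang_horizontal:
  assumes "v \<in> H2" "x $ 1 = v $ 1 + h" "x $ 2 = v $ 2" "y $ 1 = v $ 1 + l * \<delta>" "y $ 2 = v $ 2 + l"
  shows "h * l > 0 \<Longrightarrow> ang v x y = Arg (slope_dir v \<delta>)"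
    and "h * l < 0 \<Longrightarrow> ang v y x = pi - Arg (slope_dir v \<delta>)"
proof -
  assume "h * l > 0"
  then show "ang v x y = Arg (slope_dir v \<delta>)" unfolding ang_def turn_horizontal(1)[OF assms]
    by (rule Arg_times_of_real)
next
  assume "h * l < 0"
  then have "- h * l > 0" by simp
  have s: "0 < Arg (slope_dir v \<delta>)" "Arg (slope_dir v \<delta>) < pi"
    using Arg_slope_dir(2,3)[where \<alpha> = "v $ 1 - \<delta> * v $ 2" and \<beta> = \<delta>] assms by auto
  then have n: "slope_dir v \<delta> \<notin> \<real>" using Arg_eq_0_pi by force
  then have n0: "slope_dir v \<delta> \<noteq> 0" by auto
  have c: "Arg (cnj (slope_dir v \<delta>)) = - Arg (slope_dir v \<delta>)" using n by (simp add: Arg_cnj)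
  have "ang v y x = Arg (- cnj (slope_dir v \<delta>))"
    unfolding ang_def turn_horizontal(2)[OF assms] by (rule Arg_times_of_real) fact
  also have "\<dots> = pi - Arg (slope_dir v \<delta>)"
    using n0 s by (subst Arg_minus) (auto simp: c)
  finally show "ang v y x = pi - Arg (slope_dir v \<delta>)" .
qed

section \<open>Angle defect: triangles with a horizontal side, then all triangles by cutting\<close>

definition gauss_bonnet :: "real ^ 2 \<Rightarrow> real ^ 2 \<Rightarrow> real ^ 2 \<Rightarrow> bool" where
  "gauss_bonnet a b c \<longleftrightarrow> harea (convex hull {a, b, c}) = pi - ang a b c - ang b c a - ang c a b"

lemma gauss_bonnet_cycle: "gauss_bonnet b c a \<longleftrightarrow> gauss_bonnet a b c"
proof -
  have "{b, c, a} = {a, b, c}" by auto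
  then show ?thesis unfolding gauss_bonnet_def by (simp add: algebra_simps)
qed

text \<open>The triangle is a trapezoid degenerated at the apex \<open>s\<close>. Of the four
  boundary values of \<open>edge_angle\<close>, the two at the base give the base angles up to
  \<pi>/2, and the difference at \<open>s\<close> gives the apex angle. All auxiliary facts hold for
  either sign of \<open>k\<close>, so both positions of the apex share them.\<close>

lemma gauss_bonnet_base:
  assumes H: "p \<in> H2" "q \<in> H2" "s \<in> H2" and pq: "p $ 2 = q $ 2" "p $ 1 < q $ 1"
  shows gauss_bonnet_base_up: "p $ 2 < s $ 2 \<Longrightarrow> gauss_bonnet p q s"
    and gauss_bonnet_base_down: "s $ 2 < p $ 2 \<Longrightarrow> gauss_bonnet q p s"
proof -
  define k where "k = s $ 2 - p $ 2"
  define \<beta> \<delta> where "\<beta> = (s $ 1 - p $ 1) / k" and "\<delta> = (s $ 1 - q $ 1) / k"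
  define \<alpha> \<gamma> where "\<alpha> = p $ 1 - \<beta> * p $ 2" and "\<gamma> = q $ 1 - \<delta> * q $ 2"
  define S where "S c d = {x :: real ^ 2. c \<le> x $ 2 \<and> x $ 2 \<le> d \<and> \<alpha> + \<beta> * x $ 2 \<le> x $ 1 \<and> x $ 1 \<le> \<gamma> + \<delta> * x $ 2}"
    for c d
  have bk: "\<beta> * k = s $ 1 - p $ 1" "\<delta> * k = s $ 1 - q $ 1" if "k \<noteq> 0"
    using that by (simp_all add: \<beta>_def \<delta>_def)
  have facts: "s $ 1 = p $ 1 + k * \<beta>" "s $ 1 = q $ 1 + k * \<delta>" "p $ 1 = s $ 1 + (- k) * \<beta>" "q $ 1 = s $ 1 + (- k) * \<delta>"
    "s $ 2 = p $ 2 + k" "s $ 2 = q $ 2 + k" "p $ 2 = s $ 2 + (- k)" "q $ 2 = s $ 2 + (- k)"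
    "s $ 1 = \<alpha> + \<beta> * s $ 2" "s $ 1 = \<gamma> + \<delta> * s $ 2" "p $ 1 = \<alpha> + \<beta> * p $ 2" "q $ 1 = \<gamma> + \<delta> * q $ 2"
    if "k \<noteq> 0"
  proof -
    note bk = bk[OF that]
    show "s $ 1 = p $ 1 + k * \<beta>" "s $ 1 = q $ 1 + k * \<delta>" "p $ 1 = s $ 1 + (- k) * \<beta>" "q $ 1 = s $ 1 + (- k) * \<delta>"
      using bk by (simp_all add: mult.commute)
    show "s $ 2 = p $ 2 + k" "s $ 2 = q $ 2 + k" "p $ 2 = s $ 2 + (- k)" "q $ 2 = s $ 2 + (- k)"
      using pq(1) by (simp_all add: k_def)
    show "s $ 1 = \<alpha> + \<beta> * s $ 2" "s $ 1 = \<gamma> + \<delta> * s $ 2" "p $ 1 = \<alpha> + \<beta> * p $ 2" "q $ 1 = \<gamma> + \<delta> * q $ 2"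
      using bk pq(1) by (simp_all add: \<alpha>_def \<gamma>_def k_def algebra_simps)
  qed
  note args = Arg_slope_dir(1)[OF H(1) facts(11)] Arg_slope_dir(1)[OF H(2) facts(12)]
    Arg_slope_dir(1)[OF H(3) facts(9)] Arg_slope_dir(1)[OF H(3) facts(10)]
  have gap: "(\<gamma> + \<delta> * y) - (\<alpha> + \<beta> * y) = (q $ 1 - p $ 1) * (s $ 2 - y) / k" if "k \<noteq> 0" for y
  proof -
    note bk = bk[OF that]
    have "((\<gamma> + \<delta> * y) - (\<alpha> + \<beta> * y)) * k = (q $ 1 - p $ 1) * k + (\<delta> * k - \<beta> * k) * (y - p $ 2)"
      using pq(1) by (simp add: \<alpha>_def \<gamma>_def algebra_simps)
    also have "\<dots> = (q $ 1 - p $ 1) * (s $ 2 - y)" unfolding bk by (simp add: k_def algebra_simps)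
    finally show ?thesis using that by (simp add: eq_divide_eq)
  qed
  have edges: "orient p q x = (q $ 1 - p $ 1) * (x $ 2 - p $ 2)" "orient q s x = k * ((\<gamma> + \<delta> * x $ 2) - x $ 1)"
    "orient s p x = k * (x $ 1 - (\<alpha> + \<beta> * x $ 2))" if "k \<noteq> 0" for x
  proof -
    note bk = bk[OF that]
    show "orient p q x = (q $ 1 - p $ 1) * (x $ 2 - p $ 2)" using pq(1) by (simp add: orient_def)
    have "orient q s x = (\<delta> * k) * (x $ 2 - p $ 2) - k * (x $ 1 - q $ 1)"
      unfolding bk by (simp add: orient_def k_def pq(1) algebra_simps)
    then show "orient q s x = k * ((\<gamma> + \<delta> * x $ 2) - x $ 1)"
      by (simp add: \<gamma>_def pq(1) algebra_simps)
    have "orient s p x = - ((\<beta> * k) * (x $ 2 - p $ 2) - k * (x $ 1 - p $ 1))"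
      unfolding bk by (simp add: orient_def k_def pq(1) algebra_simps)
    then show "orient s p x = k * (x $ 1 - (\<alpha> + \<beta> * x $ 2))"
      by (simp add: \<alpha>_def pq(1) algebra_simps)
  qed
  have area: "harea (S c d) = (edge_angle \<gamma> \<delta> d - edge_angle \<gamma> \<delta> c) - (edge_angle \<alpha> \<beta> d - edge_angle \<alpha> \<beta> c)"
    if "S c d = convex hull {p, q, s}" "c \<le> d" "\<And>y. c \<le> y \<Longrightarrow> y \<le> d \<Longrightarrow> 0 \<le> (s $ 2 - y) / k" "k \<noteq> 0" for c d
  proof -
    have "compact (S c d)" "S c d \<subseteq> H2"
      unfolding that(1) using H by (simp_all add: finite_imp_compact_convex_hull convex_hull_subset_H2)
    moreover have "\<alpha> + \<beta> * y \<le> \<gamma> + \<delta> * y" if "c \<le> y" "y \<le> d" for y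
    proof -
      have "0 \<le> (q $ 1 - p $ 1) * ((s $ 2 - y) / k)" using that pq(2) \<open>\<And>y. c \<le> y \<Longrightarrow> y \<le> d \<Longrightarrow> 0 \<le> (s $ 2 - y) / k\<close>
        by (intro mult_nonneg_nonneg) auto
      then show ?thesis using gap[OF \<open>k \<noteq> 0\<close>, of y] by simp
    qed
    ultimately show ?thesis unfolding S_def using \<open>c \<le> d\<close> by (intro harea_trapezoid)
  qed
  \<comment> \<open>Lying between the two edges already keeps \<open>x\<close> on the base side of
    the apex. This reconciles the four bounds of \<open>S\<close> with the three side tests of a
    triangle.\<close>
  have range: "0 \<le> (s $ 2 - x $ 2) / k" if "\<alpha> + \<beta> * x $ 2 \<le> x $ 1" "x $ 1 \<le> \<gamma> + \<delta> * x $ 2" "k \<noteq> 0" for x :: "real ^ 2"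
  proof -
    have "0 \<le> (q $ 1 - p $ 1) * ((s $ 2 - x $ 2) / k)" using gap[OF that(3), of "x $ 2"] that by simp
    then show ?thesis using pq(2) by (simp only: zero_le_mult_iff) linarith
  qed
  show "gauss_bonnet p q s" if "p $ 2 < s $ 2"
  proof -
    have k: "k > 0" "k \<noteq> 0" using that by (simp_all add: k_def)
    have D: "orient p q s > 0" using edges(1)[OF k(2)] that pq by simp
    have "S (p $ 2) (s $ 2) = convex hull {p, q, s}"
    proof (intro set_eqI)
      fix x :: "real ^ 2"
      have "x $ 2 \<le> s $ 2" if "\<alpha> + \<beta> * x $ 2 \<le> x $ 1" "x $ 1 \<le> \<gamma> + \<delta> * x $ 2"
        using range[OF that k(2)] k(1) by (simp add: zero_le_divide_iff)
      then show "x \<in> S (p $ 2) (s $ 2) \<longleftrightarrow> x \<in> convex hull {p, q, s}"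
        unfolding mem_triangle_iff[OF D] edges[OF k(2)] S_def using k pq by (auto simp: zero_le_mult_iff)
    qed
    from area[OF this _ _ k(2)] this have "harea (convex hull {p, q, s}) =
        (edge_angle \<gamma> \<delta> (s $ 2) - edge_angle \<gamma> \<delta> (p $ 2)) - (edge_angle \<alpha> \<beta> (s $ 2) - edge_angle \<alpha> \<beta> (p $ 2))"
      using that k by simp
    moreover have "ang p q s = Arg (slope_dir p \<beta>)"
      by (rule ang_horizontal(1)[where h = "q $ 1 - p $ 1", OF H(1) _ _ facts(1,5)[OF k(2)]]) (use k pq in simp_all)
    moreover have "ang q s p = pi - Arg (slope_dir q \<delta>)"
      by (rule ang_horizontal(2)[where h = "p $ 1 - q $ 1", OF H(2) _ _ facts(2,6)[OF k(2)]])
        (use k pq in \<open>simp_all add: mult_less_0_iff\<close>)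
    moreover have "ang s p q = Arg (slope_dir s \<delta>) - Arg (slope_dir s \<beta>)"
      by (rule ang_slopes[OF H(3) facts(3,7,4,8)[OF k(2)]]) (use k in simp)
    ultimately show ?thesis unfolding gauss_bonnet_def
      using args[OF k(2)] pq(1) by simp
  qed
  show "gauss_bonnet q p s" if "s $ 2 < p $ 2"
  proof -
    have k: "k < 0" "k \<noteq> 0" using that by (simp_all add: k_def)
    have e: "orient q p x = - ((q $ 1 - p $ 1) * (x $ 2 - p $ 2))" "orient p s x = - (k * (x $ 1 - (\<alpha> + \<beta> * x $ 2)))"
      "orient s q x = - (k * ((\<gamma> + \<delta> * x $ 2) - x $ 1))" for x
      using edges[OF k(2), of x] orient_reverse by metis+
    have D: "orient q p s > 0" unfolding e using that pq by (simp add: mult_pos_neg)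
    have pqs: "{q, p, s} = {p, q, s}" by auto
    have "S (s $ 2) (p $ 2) = convex hull {q, p, s}"
    proof (intro set_eqI)
      fix x :: "real ^ 2"
      have "s $ 2 \<le> x $ 2" if "\<alpha> + \<beta> * x $ 2 \<le> x $ 1" "x $ 1 \<le> \<gamma> + \<delta> * x $ 2"
        using range[OF that k(2)] k(1) by (simp add: zero_le_divide_iff)
      then show "x \<in> S (s $ 2) (p $ 2) \<longleftrightarrow> x \<in> convex hull {q, p, s}"
        unfolding mem_triangle_iff[OF D] e S_def using k pq by (auto simp: mult_le_0_iff)
    qed
    from area[OF this[unfolded pqs] _ _ k(2)] this have "harea (convex hull {q, p, s}) =
        (edge_angle \<gamma> \<delta> (p $ 2) - edge_angle \<gamma> \<delta> (s $ 2)) - (edge_angle \<alpha> \<beta> (p $ 2) - edge_angle \<alpha> \<beta> (s $ 2))"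
      using that k by (simp add: divide_nonpos_neg)
    moreover have "ang q p s = Arg (slope_dir q \<delta>)"
      by (rule ang_horizontal(1)[where h = "p $ 1 - q $ 1", OF H(2) _ _ facts(2,6)[OF k(2)]])
        (use k pq in \<open>simp_all add: mult_neg_neg\<close>)
    moreover have "ang p s q = pi - Arg (slope_dir p \<beta>)"
      by (rule ang_horizontal(2)[where h = "q $ 1 - p $ 1", OF H(1) _ _ facts(1,5)[OF k(2)]])
        (use k pq in \<open>simp_all add: mult_less_0_iff\<close>)
    moreover have "ang s q p = Arg (slope_dir s \<beta>) - Arg (slope_dir s \<delta>)"
      by (rule ang_slopes[OF H(3) facts(4,8,3,7)[OF k(2)]]) (use k in \<open>simp add: mult_neg_neg\<close>)
    ultimately show ?thesis unfolding gauss_bonnet_def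
      using args[OF k(2)] pq(1) by simp
  qed
qed

lemma ang_straight:
  assumes H: "m \<in> H2" "s \<in> H2" and "s \<noteq> m" and "p - m = - k *\<^sub>R (s - m)" "k > 0"
  shows "ang m p s = pi"
proof -
  have "turn m p s = of_real (- k * 1) * turn m s s"
    by (rule turn_scale) (use assms in auto)
  moreover have "(pairing m s)\<^sup>2 - pairing m m * pairing s s > 0" using pairing_sq_gt[of m s] assms by auto
  ultimately show ?thesis unfolding ang_def Arg_eq_pi turn_self using assms(5) by (simp add: mult_pos_pos)
qed

lemma H2_segment: "p \<in> H2 \<Longrightarrow> s \<in> H2 \<Longrightarrow> 0 \<le> t \<Longrightarrow> t \<le> 1 \<Longrightarrow> (1 - t) *\<^sub>R p + t *\<^sub>R s \<in> H2"
  unfolding H2_def by (intro convexD convex_ball) auto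

text \<open>Additivity of the defect: the cut from \<open>q\<close> to \<open>m\<close> splits the
  angle at \<open>q\<close>, and the two new angles at \<open>m\<close> add up to \<pi>, which
  cancels the \<pi> of the second triangle.\<close>

lemma gauss_bonnet_split:
  assumes H: "p \<in> H2" "q \<in> H2" "s \<in> H2" and D: "orient p q s > 0"
    and t: "0 < t" "t < 1" and m: "m = (1 - t) *\<^sub>R p + t *\<^sub>R s"
    and gb: "gauss_bonnet p q m" "gauss_bonnet m q s"
  shows "gauss_bonnet p q s"
proof -
  have mH: "m \<in> H2"
    unfolding m using H t by (intro H2_segment) auto
  have d1: "orient p q m = t * orient p q s" "orient m q s = (1 - t) * orient p q s"
    "orient m p x = t * orient s p x" "orient s m x = (1 - t) * orient s p x" for x
    by (simp_all add: m orient_def algebra_simps)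
  have D1: "orient p q m > 0" "orient m q s > 0" using d1 D t by simp_all
  have qm: "orient q m x = - orient m q x" for x by (simp add: orient_def algebra_simps)
  have ne: "q \<noteq> m" "q \<noteq> p" "q \<noteq> s" "p \<noteq> s" "m \<noteq> p" "m \<noteq> s" using D D1 by auto
  have hull: "convex hull {p, q, s} = convex hull {p, q, m} \<union> convex hull {m, q, s}"
  proof
    show "convex hull {p, q, s} \<subseteq> convex hull {p, q, m} \<union> convex hull {m, q, s}"
    proof
      fix x assume "x \<in> convex hull {p, q, s}"
      then have "orient p q x \<ge> 0" "orient q s x \<ge> 0" "orient s p x \<ge> 0" using mem_triangle_iff[OF D] by auto
      then show "x \<in> convex hull {p, q, m} \<union> convex hull {m, q, s}"
        using mem_triangle_iff[OF D1(1), of x] mem_triangle_iff[OF D1(2), of x] d1 qm t by auto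
    qed
    have "m \<in> convex hull {p, s}" using t unfolding m by (intro convexD[OF convex_convex_hull]) (auto simp: hull_inc)
    then have "m \<in> convex hull {p, q, s}" by (metis hull_mono insert_mono subsetD empty_subsetI insert_subset subset_insertI)
    then show "convex hull {p, q, m} \<union> convex hull {m, q, s} \<subseteq> convex hull {p, q, s}"
      by (intro Un_least hull_minimal) (auto simp: hull_inc)
  qed
  have area: "harea (convex hull {p, q, s}) = harea (convex hull {p, q, m}) + harea (convex hull {m, q, s})"
    unfolding hull
  proof (rule harea_Un[OF _ _ _ _ ne(1)])
    show "convex hull {p, q, m} \<inter> convex hull {m, q, s} \<subseteq> {x. orient q m x = 0}"
      using mem_triangle_iff[OF D1(1)] mem_triangle_iff[OF D1(2)] qm by fastforce
  qed (use H mH in \<open>simp_all add: finite_imp_compact_convex_hull convex_hull_subset_H2\<close>)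
  have straight: "ang m p s = pi"
  proof -
    have "p - m = - (t / (1 - t)) *\<^sub>R (s - m)"
    proof -
      have "s - m = (1 - t) *\<^sub>R (s - p)" by (simp add: m algebra_simps)
      then have "(- (t / (1 - t))) *\<^sub>R (s - m) = - t *\<^sub>R (s - p)" using t by simp
      then show ?thesis by (simp add: m algebra_simps)
    qed
    then show "ang m p s = pi" by (rule ang_straight[OF mH H(3) ne(6)[symmetric]]) (use t in auto)
  qed
  have "ang p q m = ang p q s" by (rule ang_scale[where k = 1 and l = t]) (auto simp: m t algebra_simps)
  moreover have "ang s m q = ang s p q"
    by (rule ang_scale[where k = "1 - t" and l = 1]) (use t in \<open>auto simp: m algebra_simps\<close>)
  moreover have "ang q s m + ang q m p = ang q s p"
  proof (rule ang_add)
    show "ang q s p > 0" using ang_bounds_strict[of q s p] D H by (simp add: orient_cycle)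
    show "orient q s m \<ge> 0" using D1(2) orient_cycle[of q s m] by simp
    show "orient q m p \<ge> 0" using D1(1) orient_cycle[of q m p] by simp
  qed (use H mH ne in auto)
  moreover have "ang m p q + ang m q s = ang m p s"
  proof (rule ang_add)
    show "ang m p s > 0" using straight by simp
    show "orient m p q \<ge> 0" using D1(1) orient_cycle[of m p q] orient_cycle[of p q m] by simp
    show "orient m q s \<ge> 0" using D1(2) by simp
  qed (use H mH ne in auto)
  ultimately show ?thesis using gb area straight unfolding gauss_bonnet_def by simp
qed

lemma gauss_bonnet_horizontal:
  assumes H: "a \<in> H2" "b \<in> H2" "c \<in> H2" and D: "orient a b c > 0" and e: "a $ 2 = b $ 2"
  shows "gauss_bonnet a b c"
proof -
  have o: "orient a b c = (b $ 1 - a $ 1) * (c $ 2 - a $ 2)" using e by (simp add: orient_def)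
  show ?thesis
  proof (cases "a $ 1 < b $ 1")
    case True
    then have "c $ 2 > a $ 2" using D o by (simp add: zero_less_mult_iff)
    then show ?thesis using gauss_bonnet_base_up[OF H e True] by simp
  next
    case False
    then have "b $ 1 < a $ 1 \<and> c $ 2 < b $ 2" using D o e by (auto simp: zero_less_mult_iff)
    then show ?thesis using gauss_bonnet_base_down[OF H(2,1,3)] e by simp
  qed
qed

lemma gauss_bonnet_middle:
  assumes H: "p \<in> H2" "q \<in> H2" "s \<in> H2" and D: "orient p q s > 0"
    and mid: "0 < (q $ 2 - p $ 2) * (s $ 2 - q $ 2)"
  shows "gauss_bonnet p q s"
proof -
  \<comment> \<open>Chosen so that \<open>m\<close> has the height of \<open>q\<close>: the
    horizontal cut through the vertex of middle height.\<close>
  define t where "t = (q $ 2 - p $ 2) / (s $ 2 - p $ 2)"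
  define m where "m = (1 - t) *\<^sub>R p + t *\<^sub>R s"
  have t: "0 < t" "t < 1" "s $ 2 \<noteq> p $ 2"
    using mid unfolding t_def by (auto simp: zero_less_mult_iff zero_less_divide_iff divide_less_eq)
  have "t * (s $ 2 - p $ 2) = q $ 2 - p $ 2" using t by (simp add: t_def)
  then have m2: "m $ 2 = q $ 2" by (simp add: m_def algebra_simps)
  have mH: "m \<in> H2"
    unfolding m_def using H t by (intro H2_segment) auto
  have d1: "orient p q m = t * orient p q s" "orient m q s = (1 - t) * orient p q s"
    by (simp_all add: m_def orient_def algebra_simps)
  have D1: "orient p q m > 0" "orient m q s > 0" using d1 D t by simp_all
  have "orient q m p > 0" using D1(1) orient_cycle[of q m p] by simp
  then have "gauss_bonnet q m p" using gauss_bonnet_horizontal H mH m2 by simp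
  then have 1: "gauss_bonnet p q m" by (simp add: gauss_bonnet_cycle)
  have 2: "gauss_bonnet m q s" using gauss_bonnet_horizontal H mH m2 D1 by simp
  show ?thesis by (rule gauss_bonnet_split[OF H D t(1,2) m_def 1 2])
qed

text \<open>Either a side is horizontal or one vertex lies strictly between the others in height;
  cyclic relabelling reduces every case to these two.\<close>

theorem gauss_bonnet_triangle:
  assumes H: "a \<in> H2" "b \<in> H2" "c \<in> H2" and D: "orient a b c > 0"
  shows "harea (convex hull {a, b, c}) = pi - ang a b c - ang b c a - ang c a b"
proof -
  have D': "orient b c a > 0" "orient c a b > 0" using D orient_cycle by metis+
  have "gauss_bonnet a b c"
  proof -
    consider "a $ 2 = b $ 2" | "b $ 2 = c $ 2" | "c $ 2 = a $ 2"
      | "0 < (b $ 2 - a $ 2) * (c $ 2 - b $ 2)" | "0 < (c $ 2 - b $ 2) * (a $ 2 - c $ 2)" | "0 < (a $ 2 - c $ 2) * (b $ 2 - a $ 2)"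
      by (auto simp: zero_less_mult_iff) linarith
    then show ?thesis
    proof cases
      case 1 then show ?thesis using gauss_bonnet_horizontal H D by blast
    next
      case 2 then show ?thesis using gauss_bonnet_horizontal[OF H(2,3,1) D'(1)] gauss_bonnet_cycle by blast
    next
      case 3 then show ?thesis using gauss_bonnet_horizontal[OF H(3,1,2) D'(2)] gauss_bonnet_cycle by blast
    next
      case 4 then show ?thesis using gauss_bonnet_middle H D by blast
    next
      case 5 then show ?thesis using gauss_bonnet_middle[OF H(2,3,1) D'(1)] gauss_bonnet_cycle by blast
    next
      case 6 then show ?thesis using gauss_bonnet_middle[OF H(3,1,2) D'(2)] gauss_bonnet_cycle by blast
    qed
  qed
  then show ?thesis by (simp add: gauss_bonnet_def)
qed

section \<open>Convex polygons\<close>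

lemma convex_orient_ge: "convex {x. orient a b x \<ge> 0}"
  unfolding convex_alt by (auto simp: orient_affine)

lemma convex_orient_le: "convex {x. orient a b x \<le> 0}"
  unfolding convex_alt by (auto simp: orient_affine mult_nonneg_nonpos add_nonpos_nonpos)

text \<open>The lines through \<open>b c\<close> and \<open>c a\<close> keep all of \<open>A\<close>
  on the side of the triangle, so beyond the line through \<open>a b\<close> the new hull contains
  only triangle points. A new point on the other side of \<open>a b\<close> is reached through the
  side \<open>a b\<close>, which belongs to the old hull.\<close>

lemma convex_hull_insert_ear:
  assumes ab: "a \<in> A" "b \<in> A" and c: "orient a b c > 0"
    and A: "\<And>x. x \<in> A \<Longrightarrow> orient a b x \<le> 0 \<and> orient b c x \<ge> 0 \<and> orient c a x \<ge> 0"
  shows "convex hull (insert c A) = convex hull A \<union> convex hull {a, b, c}"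
    and "convex hull A \<inter> convex hull {a, b, c} \<subseteq> {x. orient a b x = 0}"
proof -
  have le: "orient a b x \<le> 0" if "x \<in> convex hull A" for x
    using that hull_minimal[of A "{x. orient a b x \<le> 0}" convex] A convex_orient_le by blast
  have ge: "orient b c x \<ge> 0" "orient c a x \<ge> 0" if "x \<in> convex hull (insert c A)" for x
    using that hull_minimal[of "insert c A" "{x. orient b c x \<ge> 0}" convex]
      hull_minimal[of "insert c A" "{x. orient c a x \<ge> 0}" convex] A convex_orient_ge by auto
  show "convex hull A \<inter> convex hull {a, b, c} \<subseteq> {x. orient a b x = 0}"
    using le mem_triangle_iff[OF c] by (auto intro: order_antisym)
  show "convex hull (insert c A) = convex hull A \<union> convex hull {a, b, c}"
  proof
    show "convex hull A \<union> convex hull {a, b, c} \<subseteq> convex hull (insert c A)"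
      using ab by (intro Un_least hull_mono) auto
    show "convex hull (insert c A) \<subseteq> convex hull A \<union> convex hull {a, b, c}"
    proof
      fix x assume x: "x \<in> convex hull (insert c A)"
      show "x \<in> convex hull A \<union> convex hull {a, b, c}"
      proof (cases "orient a b x \<ge> 0")
        case True
        then show ?thesis using ge[OF x] mem_triangle_iff[OF c] by simp
      next
        case False
        have "A \<noteq> {}" using ab by blast
        from x obtain u v y where uv: "0 \<le> u" "0 \<le> v" "u + v = 1" and y: "y \<in> convex hull A"
          and xe: "x = u *\<^sub>R c + v *\<^sub>R y"
          unfolding convex_hull_insert[OF \<open>A \<noteq> {}\<close>] by auto
        have v: "v = 1 - u" "u \<le> 1" using uv by simp_all
        define O' where "O' = orient a b y"
        have Ox: "orient a b x = (1 - u) * O' + u * orient a b c"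
          unfolding xe v O'_def using orient_affine[of a b u y c] by (simp add: add.commute)
        have O': "O' < 0"
        proof (rule ccontr)
          assume "\<not> O' < 0"
          then have "(1 - u) * O' + u * orient a b c \<ge> 0" using v uv c by (intro add_nonneg_nonneg mult_nonneg_nonneg) auto
          then show False using False Ox by simp
        qed
        \<comment> \<open>The parameter at which the segment from \<open>y\<close> to
          \<open>c\<close> crosses the line through \<open>a\<close> and \<open>b\<close>.\<close>
        define s where "s = - O' / (orient a b c - O')"
        have s: "0 < s" "s < 1" using O' c by (auto simp: s_def field_simps)
        define m where "m = (1 - s) *\<^sub>R y + s *\<^sub>R c"
        have "s * (orient a b c - O') = - O'" using O' c by (simp add: s_def)
        then have Om: "orient a b m = 0" unfolding m_def orient_affine O'_def by (simp add: algebra_simps)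
        have "m \<in> convex hull (insert c A)"
          unfolding m_def using y s hull_mono[of A "insert c A" convex]
          by (intro convexD convex_convex_hull) (auto simp: hull_inc)
        then have mT: "m \<in> convex hull {a, b, c}" using ge mem_triangle_iff[OF c] Om by simp
        then obtain p q r where pqr: "0 \<le> p" "0 \<le> q" "0 \<le> r" "p + q + r = 1" and me: "m = p *\<^sub>R a + q *\<^sub>R b + r *\<^sub>R c"
          by (auto simp: convex_hull_3)
        have pe: "p = 1 - q - r" using pqr by simp
        have "orient a b m = r * orient a b c" unfolding me orient_def pe by (simp add: algebra_simps)
        then have "r = 0" using Om c by simp
        have hA: "a \<in> convex hull A" "b \<in> convex hull A" using ab by (simp_all add: hull_inc)
        have "p *\<^sub>R a + q *\<^sub>R b \<in> convex hull A"
          using convexD[OF convex_convex_hull hA] pqr \<open>r = 0\<close> by simp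
        then have "m \<in> convex hull A" using \<open>r = 0\<close> by (simp add: me)
        have "u < s"
        proof -
          have "(1 - u) * O' + u * orient a b c < 0" using False Ox by simp
          then show ?thesis using O' c by (simp add: s_def field_simps)
        qed
        \<comment> \<open>As \<open>u < s\<close>, the point lies between \<open>y\<close> and the
          crossing point, both in the old hull.\<close>
        have "x = (1 - u / s) *\<^sub>R y + (u / s) *\<^sub>R m"
          unfolding xe v m_def using s by (simp add: algebra_simps)
        also have "\<dots> \<in> convex hull A" using y \<open>m \<in> convex hull A\<close> \<open>u < s\<close> s uv
          by (intro convexD[OF convex_convex_hull]) auto
        finally show ?thesis by blast
      qed
    qed
  qed
qed

section \<open>Convex polygons with vertices indexed periodically by the integers\<close>

lemma int_periodic_mult:
  fixes f :: "int \<Rightarrow> 'a"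
  assumes "\<And>i. f (i + int n) = f i"
  shows "f (i + int n * q) = f i"
proof (induction q rule: int_induct[where k = 0])
  case (step1 q)
  then show ?case using assms[of "i + int n * q"] by (simp add: algebra_simps)
next
  case (step2 q)
  then show ?case using assms[of "i + int n * (q - 1)"] by (simp add: algebra_simps)
qed simp

lemma int_periodic_mod:
  fixes f :: "int \<Rightarrow> 'a"
  assumes "\<And>i. f (i + int n) = f i"
  shows "f (i mod int n + k) = f (i + k)"
proof -
  have "i mod int n + k + int n * (i div int n) = i + k" using mult_div_mod_eq[of "int n" i] by linarith
  then show ?thesis using int_periodic_mult[of f n "i mod int n + k" "i div int n"] assms by metis
qed

text \<open>Counterclockwise strictly convex polygons. Integer indices avoid reduction modulo
  \<open>n\<close>, and convexity is demanded only relative to the lines through consecutive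
  vertices, which is what supporting lines provide.\<close>

locale cyclic_polygon =
  fixes n :: nat and u :: "int \<Rightarrow> real ^ 2"
  assumes n3: "n \<ge> 3" and in_H2: "u i \<in> H2" and periodic: "u (i + int n) = u i"
    and edge: "\<not> int n dvd k - i \<Longrightarrow> \<not> int n dvd k - i - 1 \<Longrightarrow> orient (u i) (u (i + 1)) (u k) > 0"
begin

lemma periodic_mult: "u (i + int n * q) = u i"
  by (rule int_periodic_mult) (rule periodic)

lemma edge_nonneg: "orient (u i) (u (i + 1)) (u k) \<ge> 0"
proof (cases "int n dvd k - i \<or> int n dvd k - i - 1")
  case True
  then show ?thesis
  proof
    assume "int n dvd k - i"
    then obtain q where "k = i + int n * q" by (metis dvdE diff_add_cancel add.commute)
    then show ?thesis using periodic_mult[of i q] by simp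
  next
    assume "int n dvd k - i - 1"
    then obtain q where "k = (i + 1) + int n * q" by (metis dvdE diff_add_cancel add.commute add.assoc)
    then show ?thesis using periodic_mult[of "i + 1" q] by simp
  qed
next
  case False
  then show ?thesis using edge[of k i] by simp
qed

lemma edge':
  assumes "i + 1 < k" "k < i + int n"
  shows "orient (u i) (u (i + 1)) (u k) > 0"
  using assms by (intro edge) (auto dest!: zdvd_imp_le)

lemma edge_last:
  assumes "i < j" "j + 1 < i + int n"
  shows "orient (u i) (u j) (u (j + 1)) > 0"
proof -
  have "orient (u j) (u (j + 1)) (u (i + int n)) > 0" using assms by (intro edge') auto
  then show ?thesis using periodic orient_cycle[of "u j" "u (j + 1)" "u i"] by simp
qed

text \<open>Induction on \<open>k\<close>. The Pluecker relation at \<open>u i\<close> for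
  \<open>i + 1\<close>, \<open>j\<close>, \<open>k\<close>, \<open>k + 1\<close> expresses the new
  triple through triples that contain a side or are covered by the induction hypothesis.\<close>

lemma orient_pos:
  assumes "i < j" "j < k" "k < i + int n"
  shows "orient (u i) (u j) (u k) > 0"
proof -
  have "j + 1 \<le> k" using assms by simp
  then have "k < i + int n \<longrightarrow> orient (u i) (u j) (u k) > 0"
  proof (induction k rule: int_ge_induct)
    case base
    then show ?case using edge_last assms by simp
  next
    case (step k)
    show ?case
    proof
      assume k: "k + 1 < i + int n"
      show "orient (u i) (u j) (u (k + 1)) > 0"
      proof (cases "j = i + 1")
        case True
        then show ?thesis using edge'[of i "k + 1"] k step assms by simp
      next
        case False
        have "orient (u i) (u (i + 1)) (u k) * orient (u i) (u j) (u (k + 1)) > 0"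
          unfolding orient_pluecker[of "u i" "u (i + 1)" "u k"]
          using False k step assms by (intro add_pos_pos mult_pos_pos edge' edge_last) auto
        moreover have "orient (u i) (u (i + 1)) (u k) > 0" using k step assms by (intro edge') auto
        ultimately show ?thesis by (simp add: zero_less_mult_iff)
      qed
    qed
  qed
  then show ?thesis using assms by simp
qed

lemma neq: "i < j \<Longrightarrow> j < i + int n \<Longrightarrow> u i \<noteq> u j"
proof
  assume ij: "i < j" "j < i + int n" and e: "u i = u j"
  show False
  proof (cases "j = i + 1")
    case True
    then show False using orient_pos[of i j "j + 1"] e ij n3 by simp
  next
    case False
    then show False using orient_pos[of i "i + 1" j] e ij by simp
  qed
qed

definition interior_angle :: "int \<Rightarrow> real" where
  "interior_angle i = ang (u i) (u (i + 1)) (u (i - 1))"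

lemma interior_angle_pos: "interior_angle i > 0"
proof -
  have "orient (u i) (u (i + 1)) (u (i - 1 + int n)) > 0" using n3 by (intro orient_pos) auto
  then show ?thesis unfolding interior_angle_def using ang_bounds_strict in_H2 periodic by metis
qed

text \<open>Fan triangulation from \<open>u 0\<close>. Each step adds one ear; the angles at
  \<open>u 0\<close> and at the newest vertex are still incomplete and are therefore kept apart from
  the sum of interior angles.\<close>

lemma harea_partial:
  assumes "2 \<le> j" "j < int n"
  shows "harea (convex hull (u ` {0..j})) = (real_of_int j - 1) * pi - (ang (u 0) (u 1) (u j)
     + (\<Sum>i\<in>{1..<j}. interior_angle i) + ang (u j) (u 0) (u (j - 1)))"
  using assms
proof (induction j rule: int_ge_induct)
  case base
  have s: "{0..2} = {0, 1, 2::int}" by auto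
  have t: "{1..<2} = {1::int}" by auto
  have "orient (u 0) (u 1) (u 2) > 0" using base by (intro orient_pos) auto
  from gauss_bonnet_triangle[OF in_H2 in_H2 in_H2 this] show ?case
    by (simp add: s t interior_angle_def)
next
  case (step j)
  have j: "2 \<le> j" "j + 1 < int n" using step by auto
  have i: "{0..j + 1} = insert (j + 1) {0..j}" using j by auto
  have o1: "orient (u 0) (u j) (u (j + 1)) > 0" using j by (intro orient_pos) auto
  have A: "orient (u 0) (u j) x \<le> 0 \<and> orient (u j) (u (j + 1)) x \<ge> 0 \<and> orient (u (j + 1)) (u 0) x \<ge> 0"
    if "x \<in> u ` {0..j}" for x
  proof -
    from that obtain k where k: "0 \<le> k" "k \<le> j" "x = u k" by auto
    consider "k = 0" | "k = j" | "0 < k \<and> k < j" using k by linarith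
    then show ?thesis
    proof cases
      case 3
      have "orient (u 0) (u k) (u j) > 0" "orient (u k) (u j) (u (j + 1)) > 0" "orient (u 0) (u k) (u (j + 1)) > 0"
        using 3 j by (auto intro!: orient_pos)
      then show ?thesis unfolding k using orient_swap[of "u 0" "u j" "u k"]
        orient_cycle[of "u j" "u (j + 1)" "u k"] orient_cycle[of "u (j + 1)" "u 0" "u k"]
        orient_cycle[of "u k" "u (j + 1)" "u 0"] by simp
    qed (use k o1 orient_cycle[of "u j" "u (j + 1)" "u 0"] orient_cycle[of "u (j + 1)" "u 0" "u j"] in auto)
  qed
  have mem: "u 0 \<in> u ` {0..j}" "u j \<in> u ` {0..j}" using j by auto
  note ear = convex_hull_insert_ear[OF mem o1 A]
  have sub: "u ` {0..j} \<subseteq> H2" using in_H2 by auto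
  have "harea (convex hull (u ` {0..j + 1})) = harea (convex hull (u ` {0..j})) + harea (convex hull {u 0, u j, u (j + 1)})"
  proof -
    have "convex hull (u ` {0..j + 1}) = convex hull (u ` {0..j}) \<union> convex hull {u 0, u j, u (j + 1)}"
      using ear(1) i by (metis image_insert)
    moreover have "u 0 \<noteq> u j" using j by (intro neq) auto
    moreover have "convex hull (u ` {0..j}) \<subseteq> H2" "convex hull {u 0, u j, u (j + 1)} \<subseteq> H2"
      using in_H2 by (auto intro!: convex_hull_subset_H2)
    ultimately show ?thesis using harea_Un[OF _ _ _ _ _ ear(2)]
      by (simp add: finite_imp_compact_convex_hull)
  qed
  moreover have "harea (convex hull {u 0, u j, u (j + 1)}) =
      pi - ang (u 0) (u j) (u (j + 1)) - ang (u j) (u (j + 1)) (u 0) - ang (u (j + 1)) (u 0) (u j)"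
    by (rule gauss_bonnet_triangle[OF in_H2 in_H2 in_H2 o1])
  moreover have "ang (u 0) (u 1) (u j) + ang (u 0) (u j) (u (j + 1)) = ang (u 0) (u 1) (u (j + 1))"
  proof (rule ang_add)
    have "orient (u 0) (u 1) (u (j + 1)) > 0" using j by (intro orient_pos) auto
    then show "ang (u 0) (u 1) (u (j + 1)) > 0" using ang_bounds_strict in_H2 by blast
    show "orient (u 0) (u 1) (u j) \<ge> 0" using j by (intro less_imp_le orient_pos) auto
  qed (use j o1 neq[of 0 1] neq[of 0 j] neq[of 0 "j + 1"] in_H2 in \<open>auto dest: sym\<close>)
  moreover have "ang (u j) (u (j + 1)) (u 0) + ang (u j) (u 0) (u (j - 1)) = ang (u j) (u (j + 1)) (u (j - 1))"
  proof (rule ang_add)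
    show "ang (u j) (u (j + 1)) (u (j - 1)) > 0" using interior_angle_pos[of j] by (simp add: interior_angle_def)
    show "orient (u j) (u (j + 1)) (u 0) \<ge> 0" using o1 orient_cycle[of "u j" "u (j + 1)" "u 0"] by simp
    have "orient (u 0) (u (j - 1)) (u j) > 0" using j by (intro orient_pos) auto
    then show "orient (u j) (u 0) (u (j - 1)) \<ge> 0" using orient_cycle[of "u j" "u 0" "u (j - 1)"]
       orient_cycle[of "u 0" "u (j - 1)" "u j"] by simp
  qed (use j neq[of 0 j] neq[of j "j + 1"] neq[of "j - 1" j] in_H2 n3 in \<open>auto dest: sym\<close>)
  moreover have "(\<Sum>i\<in>{1..<j + 1}. interior_angle i) = (\<Sum>i\<in>{1..<j}. interior_angle i) + ang (u j) (u (j + 1)) (u (j - 1))"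
  proof -
    have "{1..<j + 1} = insert j {1..<j}" using j by auto
    then show ?thesis by (simp add: interior_angle_def)
  qed
  moreover have "u (j + 1 - 1) = u j" by simp
  ultimately show ?case using step j by (simp add: algebra_simps)
qed

definition body :: "(real ^ 2) set" where
  "body = convex hull (u ` {0..<int n})"

lemma body_compact: "compact body" and body_H2: "body \<subseteq> H2"
  unfolding body_def using in_H2
  by (auto intro!: finite_imp_compact_convex_hull convex_hull_subset_H2)

lemma body_edge:
  assumes "x \<in> body"
  shows "orient (u i) (u (i + 1)) x \<ge> 0"
proof -
  have "body \<subseteq> {x. orient (u i) (u (i + 1)) x \<ge> 0}"
    unfolding body_def using edge_nonneg by (intro hull_minimal convex_orient_ge) auto
  then show ?thesis using assms by blast
qed

theorem harea_polygon:
  "harea body = (real n - 2) * pi - (\<Sum>i\<in>{0..<int n}. interior_angle i)"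
proof -
  let ?j = "int n - 1"
  have j: "2 \<le> ?j" using n3 by simp
  have e: "{0..<int n} = {0..?j}" "{0..?j} = insert 0 (insert ?j {1..<?j})" using j by auto
  \<comment> \<open>At the last vertex the two incomplete angles of the fan become interior
    angles.\<close>
  have "u (0 - 1) = u ?j" using periodic[of "-1"] by (simp add: add.commute)
  moreover have "u (?j + 1) = u 0" using periodic[of 0] by simp
  ultimately have a: "interior_angle 0 = ang (u 0) (u 1) (u ?j)" "interior_angle ?j = ang (u ?j) (u 0) (u (?j - 1))"
    by (simp_all add: interior_angle_def)
  have "(\<Sum>i\<in>{0..<int n}. interior_angle i) = interior_angle 0 + (\<Sum>i\<in>{1..<?j}. interior_angle i) + interior_angle ?j"
    unfolding e using j by (subst sum.insert sum.insert; simp)+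
  then show ?thesis using harea_partial[OF j] a e(1) by (simp add: body_def of_nat_diff)
qed

end

section \<open>Apex angle and base angle of a right triangle\<close>

text \<open>
  In a right triangle with angles \<open>\<phi>\<close>, \<open>\<psi>\<close>, \<open>\<pi>/2\<close> in which the hypotenuse and the leg at \<open>\<psi>\<close> have total
  length \<open>w\<close>, \<open>half_apex (tanh (w/2)) (\<pi>/4 - \<phi>/2)\<close> is \<open>\<psi>/2\<close>.
\<close>

definition half_apex :: "real \<Rightarrow> real \<Rightarrow> real" where
  "half_apex s \<eta> = arctan (sqrt (1 - s\<^sup>2) * tan \<eta> / sqrt (1 - s\<^sup>2 * tan \<eta> ^ 4))"

definition half_apex_deriv :: "real \<Rightarrow> real \<Rightarrow> real" where
  "half_apex_deriv s y = sqrt (1 - s\<^sup>2) * (1 + s\<^sup>2 * y ^ 4) / (sqrt (1 - s\<^sup>2 * y ^ 4) * (1 - s\<^sup>2 * y\<^sup>2))"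

lemma tan_open_octant:
  assumes "0 < \<eta>" "\<eta> < pi / 4"
  shows "0 < tan \<eta>" "tan \<eta> < 1"
proof -
  show "0 < tan \<eta>" using assms by (intro tan_gt_zero) auto
  have "tan \<eta> < tan (pi / 4)" using assms pi_gt_zero by (intro tan_monotone) auto
  then show "tan \<eta> < 1" by (simp add: tan_45)
qed

lemma half_apex_denominators:
  fixes s y :: real
  assumes "0 \<le> s" "s < 1" "0 < y" "y < 1"
  shows "s\<^sup>2 < 1" "0 < 1 - s\<^sup>2 * y ^ 4" "0 < 1 - s\<^sup>2 * y\<^sup>2"
proof -
  show s2: "s\<^sup>2 < 1" using assms by (simp add: abs_square_less_1)
  have "y ^ 4 < 1" "y\<^sup>2 < 1" using assms by (simp_all add: power_less_one_iff)
  moreover have "s\<^sup>2 * y ^ 4 \<le> 1 * y ^ 4" "s\<^sup>2 * y\<^sup>2 \<le> 1 * y\<^sup>2" using s2 by (intro mult_right_mono; simp)+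
  ultimately show "0 < 1 - s\<^sup>2 * y ^ 4" "0 < 1 - s\<^sup>2 * y\<^sup>2" by simp_all
qed

lemma DERIV_half_apex:
  assumes s: "0 \<le> s" "s < 1" and \<eta>: "0 < \<eta>" "\<eta> < pi / 4"
  shows "DERIV (half_apex s) \<eta> :> half_apex_deriv s (tan \<eta>)"
proof -
  define y where "y = tan \<eta>"
  define \<kappa> where "\<kappa> = sqrt (1 - s\<^sup>2)"
  define q where "q = 1 - s\<^sup>2 * y ^ 4"
  define r where "r = sqrt q"
  have y: "0 < y" "y < 1" using tan_open_octant[OF \<eta>] by (simp_all add: y_def)
  have s2: "s\<^sup>2 < 1" and q: "q > 0" using half_apex_denominators[OF s y] by (simp_all add: q_def)
  have r: "r > 0" "r * r = q" using q by (simp_all add: r_def)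
  have k: "\<kappa> > 0" "\<kappa> * \<kappa> = 1 - s\<^sup>2" using s2 by (simp_all add: \<kappa>_def)
  have c: "cos \<eta> \<noteq> 0" using \<eta> by (intro less_imp_neq[symmetric] cos_gt_zero_pi) auto
  have t: "DERIV tan \<eta> :> 1 + y\<^sup>2"
    using DERIV_tan[OF c] c by (simp add: y_def tan_sec inverse_eq_divide power_divide)
  have "DERIV (\<lambda>y. 1 - s\<^sup>2 * y ^ 4) y :> - (4 * s\<^sup>2 * y ^ 3)"
    by (auto intro!: derivative_eq_intros)
  from DERIV_chain2[OF DERIV_real_sqrt this]
  have dr: "DERIV (\<lambda>y. sqrt (1 - s\<^sup>2 * y ^ 4)) y :> - (4 * s\<^sup>2 * y ^ 3) / (2 * r)"
    using q by (simp add: q_def[symmetric] r_def[symmetric] field_simps)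
  have "DERIV (\<lambda>y. \<kappa> * y / sqrt (1 - s\<^sup>2 * y ^ 4)) y :> (\<kappa> * r - \<kappa> * y * (- (4 * s\<^sup>2 * y ^ 3) / (2 * r))) / (r * r)"
    using DERIV_divide[OF DERIV_cmult_Id[of \<kappa> y UNIV] dr] r by (simp add: r_def q_def)
  from DERIV_chain2[OF DERIV_arctan this]
  have "DERIV (\<lambda>y. arctan (\<kappa> * y / sqrt (1 - s\<^sup>2 * y ^ 4))) y :>
     inverse (1 + (\<kappa> * y / r)\<^sup>2) * ((\<kappa> * r - \<kappa> * y * (- (4 * s\<^sup>2 * y ^ 3) / (2 * r))) / (r * r))"
    by (simp add: r_def q_def)
  from DERIV_chain2[OF this[unfolded y_def] t[unfolded y_def]]
  have "DERIV (half_apex s) \<eta> :> inverse (1 + (\<kappa> * y / r)\<^sup>2) * ((\<kappa> * r - \<kappa> * y * (- (4 * s\<^sup>2 * y ^ 3) / (2 * r))) / (r * r)) * (1 + y\<^sup>2)"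
    by (simp add: half_apex_def[abs_def] \<kappa>_def y_def)
  also have "inverse (1 + (\<kappa> * y / r)\<^sup>2) * ((\<kappa> * r - \<kappa> * y * (- (4 * s\<^sup>2 * y ^ 3) / (2 * r))) / (r * r)) * (1 + y\<^sup>2)
     = half_apex_deriv s y"
  proof -
    have "1 + (\<kappa> * y / r)\<^sup>2 = (q + (1 - s\<^sup>2) * y\<^sup>2) / q"
      using r q k by (simp add: power_divide power_mult_distrib power2_eq_square add_divide_distrib)
    \<comment> \<open>The factor 1 + y^2 split off here cancels against the derivative of
      tan.\<close>
    also have "q + (1 - s\<^sup>2) * y\<^sup>2 = (1 + y\<^sup>2) * (1 - s\<^sup>2 * y\<^sup>2)" unfolding q_def by algebra
    finally have 1: "inverse (1 + (\<kappa> * y / r)\<^sup>2) = q / ((1 + y\<^sup>2) * (1 - s\<^sup>2 * y\<^sup>2))" by simp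
    have "\<kappa> * r - \<kappa> * y * (- (4 * s\<^sup>2 * y ^ 3) / (2 * r)) = \<kappa> * (r * r + 2 * s\<^sup>2 * y ^ 4) / r"
      using r(1) by (simp add: field_simps power4_eq_xxxx power3_eq_cube)
    also have "r * r + 2 * s\<^sup>2 * y ^ 4 = 1 + s\<^sup>2 * y ^ 4" by (simp add: r q_def)
    finally have 2: "\<kappa> * r - \<kappa> * y * (- (4 * s\<^sup>2 * y ^ 3) / (2 * r)) = \<kappa> * (1 + s\<^sup>2 * y ^ 4) / r" .
    have gen: "Q / (Y * Z) * (K / r / Q) * Y = K / (r * Z)" if "Q > 0" "Y > 0" for Q Y Z K :: real
      using that by simp
    have "1 + y\<^sup>2 > 0" by (simp add: add_pos_nonneg)
    from gen[OF q this] show ?thesis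
      unfolding 1 2 r(2) half_apex_deriv_def \<kappa>_def[symmetric] q_def[symmetric] r_def[symmetric] .
  qed
  finally show ?thesis by (simp add: y_def)
qed

text \<open>The numerator increases in \<open>y\<close> and both factors of the denominator
  decrease. Since tan increases too, this is the convexity of \<open>half_apex s\<close>.\<close>

lemma half_apex_deriv_mono:
  assumes s: "0 \<le> s" "s < 1" and xy: "0 < x" "x \<le> y" "y < 1"
  shows "half_apex_deriv s x \<le> half_apex_deriv s y"
proof -
  have y: "0 < y" using xy by simp
  note p = half_apex_denominators[OF s y xy(3)]
  have y4: "x ^ 4 \<le> y ^ 4" "x\<^sup>2 \<le> y\<^sup>2" using xy by (auto intro!: power_mono)
  have m: "s\<^sup>2 * x ^ 4 \<le> s\<^sup>2 * y ^ 4" "s\<^sup>2 * x\<^sup>2 \<le> s\<^sup>2 * y\<^sup>2" using y4 by (auto intro!: mult_left_mono)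
  show ?thesis unfolding half_apex_deriv_def
    using p m xy by (intro frac_le mult_left_mono mult_mono mult_nonneg_nonneg mult_pos_pos) auto
qed

lemma half_apex_deriv_pos:
  assumes "0 \<le> s" "s < 1" "0 < y" "y < 1"
  shows "half_apex_deriv s y > 0"
  unfolding half_apex_deriv_def using half_apex_denominators[OF assms]
  by (intro divide_pos_pos mult_pos_pos add_pos_nonneg) auto

lemma half_apex_tangent:
  assumes s: "0 \<le> s" "s < 1" and x: "0 < x" "x < pi / 4" and c: "0 < c" "c < pi / 4"
  shows "half_apex s x \<ge> half_apex s c + half_apex_deriv s (tan c) * (x - c)"
proof -
  let ?A = "{0<..<pi / 4}"
  have "convex_on ?A (half_apex s)"
  proof (rule convex_on_realI[where f' = "\<lambda>x. half_apex_deriv s (tan x)"])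
    show "(half_apex s has_real_derivative half_apex_deriv s (tan x)) (at x)" if "x \<in> ?A" for x
      using that DERIV_half_apex s by auto
    show "half_apex_deriv s (tan x) \<le> half_apex_deriv s (tan y)" if "x \<in> ?A" "y \<in> ?A" "x \<le> y" for x y
      using that tan_open_octant[of x] tan_open_octant[of y] pi_gt_zero
      by (intro half_apex_deriv_mono s) (auto simp: tan_mono_le)
  qed auto
  moreover have "(half_apex s has_real_derivative half_apex_deriv s (tan c)) (at c within ?A)"
    using DERIV_half_apex[OF s c] by (rule DERIV_subset) simp
  ultimately have "half_apex s x - half_apex s c \<ge> half_apex_deriv s (tan c) * (x - c)"
    using x c by (intro convex_on_imp_above_tangent[where A = ?A]) (auto simp: interior_open)
  then show ?thesis by simp
qed

text \<open>For y^4 < 1 the quotient (1 - q) / (1 - q y^4) decreases in q = s^2. Thus an upper bound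
  for a width can stand in for the width itself in a lower bound for apex angles.\<close>

lemma half_apex_antimono:
  assumes s: "0 \<le> s" "s \<le> s'" "s' < 1" and x: "0 < x" "x < pi / 4"
  shows "half_apex s' x \<le> half_apex s x"
proof -
  define y where "y = tan x"
  have y: "0 < y" "y < 1" using tan_open_octant[OF x] by (simp_all add: y_def)
  have s2: "s\<^sup>2 \<le> s'\<^sup>2" "s'\<^sup>2 < 1" "0 \<le> s\<^sup>2" using s by (simp_all add: power_mono power_less_one_iff abs_square_less_1)
  have y4: "y ^ 4 < 1" using y by (simp add: power_less_one_iff)
  have p: "1 - s'\<^sup>2 * y ^ 4 > 0" "1 - s\<^sup>2 * y ^ 4 > 0"
    using half_apex_denominators[of _ y] s y by auto
  have "(1 - s'\<^sup>2) / (1 - s'\<^sup>2 * y ^ 4) \<le> (1 - s\<^sup>2) / (1 - s\<^sup>2 * y ^ 4)"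
  proof -
    have "(s'\<^sup>2 - s\<^sup>2) * (1 - y ^ 4) \<ge> 0" using s2 y4 by simp
    then have "(1 - s'\<^sup>2) * (1 - s\<^sup>2 * y ^ 4) \<le> (1 - s\<^sup>2) * (1 - s'\<^sup>2 * y ^ 4)" by (simp add: algebra_simps)
    then show ?thesis using p by (simp add: divide_simps mult.commute)
  qed
  then have "sqrt ((1 - s'\<^sup>2) / (1 - s'\<^sup>2 * y ^ 4)) * y \<le> sqrt ((1 - s\<^sup>2) / (1 - s\<^sup>2 * y ^ 4)) * y"
    using y by (intro mult_right_mono) auto
  then show ?thesis unfolding half_apex_def y_def[symmetric] by (simp add: real_sqrt_divide arctan_le_iff)
qed

lemma tan_half_squared:
  assumes "0 < z" "z < pi"
  shows "(tan (z / 2))\<^sup>2 = (1 - cos z) / (1 + cos z)"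
proof -
  have c: "cos (z / 2) > 0" using assms by (intro cos_gt_zero_pi) auto
  have 1: "1 + cos z = 2 * (cos (z / 2))\<^sup>2" using cos_double_cos[of "z / 2"] by simp
  have 2: "1 - cos z = 2 * (sin (z / 2))\<^sup>2" using cos_double_sin[of "z / 2"] by simp
  show ?thesis unfolding 1 2 tan_def using c by (simp add: power_divide)
qed

text \<open>Here tan^2 (\<psi>/2) = sinh (c - b) / sinh (c + b) and tan^2 \<eta> = tanh ((c - b)/2)
  / tanh ((c + b)/2). So tanh ((c - b)/2) = s tan^2 \<eta>, and expressing sinh by tanh of the half
  argument gives the formula. The proof checks its squared form as an identity in the sinh and cosh
  of \<open>b\<close> and \<open>c\<close>, then takes positive roots.\<close>

lemma half_apex_right_triangle:
  assumes bc: "0 < b" "b < c" and \<phi>: "0 < \<phi>" "\<phi> < pi / 2" and \<psi>: "0 < \<psi>" "\<psi> < pi / 2"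
    and cos: "cos \<psi> = tanh b / tanh c" and sin: "sin \<phi> = sinh b / sinh c"
  shows "\<psi> / 2 = half_apex (tanh ((b + c) / 2)) (pi / 4 - \<phi> / 2)"
proof -
  define B C p q where "B = sinh b" and "C = sinh c" and "p = cosh b" and "q = cosh c"
  have pos: "B > 0" "C > B" "p > 0" "q > 0" using bc by (simp_all add: B_def C_def p_def q_def)
  have pq: "p\<^sup>2 = 1 + B\<^sup>2" "q\<^sup>2 = 1 + C\<^sup>2" by (simp_all add: p_def q_def B_def C_def cosh_square_eq)
  define W where "W = cosh (b + c)"
  have W: "W = p * q + B * C" by (simp add: W_def cosh_add p_def q_def B_def C_def)
  define s x y where "s = tanh ((b + c) / 2)" and "x = tan (\<psi> / 2)" and "y = tan (pi / 4 - \<phi> / 2)"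
  have "W > 0" by (simp add: W_def)
  have s2: "s\<^sup>2 = (W - 1) / (W + 1)"
  proof -
    define h where "h = (b + c) / 2"
    have "2 * h = b + c" by (simp add: h_def)
    then have W2: "W = cosh (2 * h)" by (simp add: W_def)
    have "W = 2 * (cosh h)\<^sup>2 - 1" "W = 2 * (sinh h)\<^sup>2 + 1"
      unfolding W2 using cosh_double_cosh[of h] cosh_square_eq[of h] by linarith+
    then have "W + 1 = 2 * (cosh h)\<^sup>2" "W - 1 = 2 * (sinh h)\<^sup>2" by simp_all
    then show ?thesis by (simp add: s_def h_def tanh_def power_divide)
  qed
  have y: "0 < y" "y < 1" unfolding y_def using \<phi> by (intro tan_open_octant; simp)+
  have x: "0 < x" unfolding x_def using \<psi> by (intro tan_gt_zero) auto
  have ratio: "(1 - N / M) / (1 + N / M) = (M - N) / (M + N)" if "M > 0" for M N :: real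
  proof -
    have "1 - N / M = (M - N) / M" "1 + N / M = (M + N) / M"
      using that by (simp_all add: diff_divide_distrib add_divide_distrib)
    then show ?thesis using that by simp
  qed
  have x2: "x\<^sup>2 = (C * p - B * q) / (C * p + B * q)"
  proof -
    have "cos \<psi> = (B * q) / (C * p)" unfolding cos tanh_def by (simp add: B_def C_def p_def q_def)
    moreover have "x\<^sup>2 = (1 - cos \<psi>) / (1 + cos \<psi>)" unfolding x_def using \<psi> by (intro tan_half_squared) auto
    moreover have "C * p > 0" using pos by simp
    ultimately show ?thesis using ratio by simp
  qed
  have y2: "y\<^sup>2 = (C - B) / (C + B)"
  proof -
    have "y\<^sup>2 = (1 - cos (pi / 2 - \<phi>)) / (1 + cos (pi / 2 - \<phi>))"
      using tan_half_squared[of "pi / 2 - \<phi>"] \<phi> by (simp add: y_def diff_divide_distrib)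
    also have "cos (pi / 2 - \<phi>) = B / C" unfolding B_def C_def sin[symmetric] by (simp add: cos_diff)
    finally show ?thesis using ratio[of C B] pos by simp
  qed
  have s1: "0 \<le> s" "s < 1" using bc by (simp_all add: s_def tanh_real_lt_1)
  have s21: "s\<^sup>2 < 1" and Q: "1 - s\<^sup>2 * y ^ 4 > 0" using half_apex_denominators[OF s1 y] by simp_all
  have xy: "x\<^sup>2 * (1 - s\<^sup>2 * y ^ 4) = (1 - s\<^sup>2) * y\<^sup>2"
  proof -
    have e1: "1 - s\<^sup>2 = 2 / (W + 1)" unfolding s2 using \<open>W > 0\<close> by (simp add: field_simps)
    have y4e: "y ^ 4 = (C - B)\<^sup>2 / (C + B)\<^sup>2" using y2 by (metis power_divide power_even_eq mult_2 numeral_Bit0 power2_eq_square power_mult)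
    have e2: "1 - s\<^sup>2 * y ^ 4 = 2 * (C * p + B * q)\<^sup>2 / ((W + 1) * (C + B)\<^sup>2)"
    proof -
      have "(W + 1) * (C + B)\<^sup>2 - (W - 1) * (C - B)\<^sup>2 = 4 * B * C * W + 2 * (B\<^sup>2 + C\<^sup>2)" by algebra
      also have "\<dots> = 2 * (C\<^sup>2 * p\<^sup>2 + B\<^sup>2 * q\<^sup>2 + 2 * B * C * p * q)" unfolding W pq by algebra
      also have "\<dots> = 2 * (C * p + B * q)\<^sup>2" by algebra
      finally have *: "(W + 1) * (C + B)\<^sup>2 - (W - 1) * (C - B)\<^sup>2 = 2 * (C * p + B * q)\<^sup>2" .
      have "(W + 1) * (C + B)\<^sup>2 > 0" using pos \<open>W > 0\<close> by simp
      moreover have "(M - X) / M = 1 - X / M" if "M > 0" for M X :: real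
        using that by (simp add: diff_divide_distrib)
      ultimately have "1 - s\<^sup>2 * y ^ 4 = ((W + 1) * (C + B)\<^sup>2 - (W - 1) * (C - B)\<^sup>2) / ((W + 1) * (C + B)\<^sup>2)"
        unfolding s2 y4e times_divide_times_eq by simp
      then show ?thesis unfolding * .
    qed
    have Dp: "C * p + B * q > 0" using pos by (auto intro!: add_pos_pos mult_pos_pos)
    have "(C * p - B * q) * (C * p + B * q) = C\<^sup>2 * p\<^sup>2 - B\<^sup>2 * q\<^sup>2" by algebra
    also have "\<dots> = (C - B) * (C + B)" unfolding pq by algebra
    finally have e3: "(C * p - B * q) * (C * p + B * q) = (C - B) * (C + B)" .
    have "x\<^sup>2 * (1 - s\<^sup>2 * y ^ 4) = 2 * ((C * p - B * q) * (C * p + B * q)) / ((W + 1) * (C + B)\<^sup>2)"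
    proof -
      have "A / M * (2 * M\<^sup>2 / N) = 2 * (A * M) / N" if "M > 0" for A M N :: real
        using that by (simp add: power2_eq_square)
      from this[OF Dp] show ?thesis unfolding x2 e2 .
    qed
    also have "\<dots> = 2 / (W + 1) * ((C - B) / (C + B))"
    proof -
      have "2 * (X * Y) / (V * Y\<^sup>2) = 2 / V * (X / Y)" if "Y > 0" for X Y V :: real
        using that by (simp add: power2_eq_square)
      then show ?thesis unfolding e3 using pos by simp
    qed
    finally show ?thesis unfolding e1 y2 .
  qed
  have e: "x\<^sup>2 = (1 - s\<^sup>2) * y\<^sup>2 / (1 - s\<^sup>2 * y ^ 4)"
    by (rule eq_divide_imp[OF _ xy]) (use Q in linarith)
  define \<kappa> r where "\<kappa> = sqrt (1 - s\<^sup>2)" and "r = sqrt (1 - s\<^sup>2 * y ^ 4)"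
  have kr: "\<kappa> > 0" "r > 0" "\<kappa>\<^sup>2 = 1 - s\<^sup>2" "r\<^sup>2 = 1 - s\<^sup>2 * y ^ 4"
    unfolding \<kappa>_def r_def by (use Q s21 in \<open>intro real_sqrt_gt_zero real_sqrt_pow2; linarith\<close>)+
  have "x\<^sup>2 = (\<kappa> * y / r)\<^sup>2" unfolding e power_divide power_mult_distrib kr(3,4) ..
  then have "x = \<kappa> * y / r"
    by (rule power2_eq_imp_eq) (use kr(1,2) x y(1) in simp_all)
  then have "half_apex s (pi / 4 - \<phi> / 2) = arctan x"
    unfolding half_apex_def y_def[symmetric] \<kappa>_def r_def by (rule arg_cong[OF sym])
  also have "\<dots> = \<psi> / 2" unfolding x_def using \<psi> by (intro arctan_tan) auto
  finally show ?thesis by (simp add: s_def)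
qed

section \<open>Hyperbolic trigonometry\<close>

lemma hdist_commute: "hdist x y = hdist y x"
  by (simp add: hdist_def inner_commute mult.commute)

lemma hdist_self [simp]: "x \<in> H2 \<Longrightarrow> hdist x x = 0"
  using mem_H2[of x] by (simp add: hdist_def)

lemma cosh_hdist_pairing:
  assumes "x \<in> H2" "y \<in> H2"
  shows "cosh (hdist x y) = pairing x y / sqrt (pairing x x * pairing y y)"
  using cosh_hdist[OF assms] by (simp add: pairing_def)

lemma sinh_hdist_pairing:
  assumes "x \<in> H2" "y \<in> H2"
  shows "sinh (hdist x y) = sqrt ((pairing x y)\<^sup>2 - pairing x x * pairing y y) / sqrt (pairing x x * pairing y y)"
  using sinh_hdist[OF assms] by (simp add: pairing_def)

lemma hdist_pos:
  assumes "x \<in> H2" "y \<in> H2" "x \<noteq> y"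
  shows "hdist x y > 0"
proof -
  have "sinh (hdist x y) > 0" unfolding sinh_hdist_pairing[OF assms(1,2)]
    using pairing_sq_gt[OF assms] pairing_pos assms by (intro divide_pos_pos) auto
  then show ?thesis by simp
qed

lemma Re_turn_hdist:
  assumes "p \<in> H2" "x \<in> H2" "y \<in> H2"
  shows "cosh (hdist p x) * cosh (hdist p y) - cosh (hdist x y)
    = Re (turn p x y) / (pairing p p * (sqrt (pairing x x) * sqrt (pairing y y)))"
proof -
  define P X Y where "P = sqrt (pairing p p)" and "X = sqrt (pairing x x)" and "Y = sqrt (pairing y y)"
  have pos: "P > 0" "X > 0" "Y > 0" using pairing_pos assms by (simp_all add: P_def X_def Y_def)
  have P2: "pairing p p = P * P" using pairing_pos[OF assms(1,1)] by (simp add: P_def)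
  have "cosh (hdist p x) * cosh (hdist p y) - cosh (hdist x y) =
     pairing p x / (P * X) * (pairing p y / (P * Y)) - pairing x y / (X * Y)"
    unfolding cosh_hdist_pairing[OF assms(1,2)] cosh_hdist_pairing[OF assms(1,3)] cosh_hdist_pairing[OF assms(2,3)]
    by (simp add: P_def X_def Y_def real_sqrt_mult)
  also have "\<dots> = (pairing p x * pairing p y - P * P * pairing x y) / (P * P * (X * Y))"
    using pos by (simp add: field_simps)
  finally show ?thesis by (simp add: turn_def P2 X_def Y_def)
qed

lemma cos_ang:
  assumes H: "p \<in> H2" "x \<in> H2" "y \<in> H2" and ne: "x \<noteq> p" "y \<noteq> p"
  shows "cos (ang p x y) = (cosh (hdist p x) * cosh (hdist p y) - cosh (hdist x y)) / (sinh (hdist p x) * sinh (hdist p y))"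
    (is "_ = ?l / ?r")
proof -
  define P X Y where "P = sqrt (pairing p p)" and "X = sqrt (pairing x x)" and "Y = sqrt (pairing y y)"
  have pos: "P > 0" "X > 0" "Y > 0" using pairing_pos H by (simp_all add: P_def X_def Y_def)
  have P2: "pairing p p = P * P" using pairing_pos[OF H(1,1)] by (simp add: P_def)
  have nz: "turn p x y \<noteq> 0" using turn_nonzero[OF H ne] .
  have "cmod (turn p x y) = sqrt ((cmod (turn p x y))\<^sup>2)" by simp
  also have "\<dots> = sqrt ((pairing p x)\<^sup>2 - pairing p p * pairing x x) * sqrt ((pairing p y)\<^sup>2 - pairing p p * pairing y y)"
    unfolding norm_turn[OF H(1)] by (rule real_sqrt_mult)
  finally have m: "?r = cmod (turn p x y) / (P * P * (X * Y))"
    unfolding sinh_hdist_pairing[OF H(1,2)] sinh_hdist_pairing[OF H(1,3)]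
    by (simp add: P_def X_def Y_def real_sqrt_mult mult_ac)
  have "?l = Re (turn p x y) / (P * P * (X * Y))"
    unfolding Re_turn_hdist[OF H] by (simp add: P2 X_def Y_def)
  then have "?l / ?r = Re (turn p x y) / cmod (turn p x y)" unfolding m using pos nz by simp
  then show ?thesis unfolding ang_def using nz by (simp add: cos_Arg)
qed

lemma cosh_law:
  assumes H: "p \<in> H2" "x \<in> H2" "y \<in> H2" and ne: "x \<noteq> p" "y \<noteq> p"
  shows "cosh (hdist x y) = cosh (hdist p x) * cosh (hdist p y) - sinh (hdist p x) * sinh (hdist p y) * cos (ang p x y)"
proof -
  have "sinh (hdist p x) > 0" "sinh (hdist p y) > 0" using hdist_pos H ne by auto
  then show ?thesis unfolding cos_ang[OF assms] by simp
qed

lemma hdist_triangle: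
  assumes H: "p \<in> H2" "x \<in> H2" "y \<in> H2"
  shows "hdist x y \<le> hdist x p + hdist p y"
proof (cases "x = p \<or> y = p")
  case True
  then show ?thesis using H by auto
next
  case False
  then have ne: "x \<noteq> p" "y \<noteq> p" by auto
  have "cosh (hdist x y) \<le> cosh (hdist p x) * cosh (hdist p y) + sinh (hdist p x) * sinh (hdist p y)"
  proof -
    have "sinh (hdist p x) * sinh (hdist p y) \<ge> 0" using hdist_nonneg H by simp
    then have "sinh (hdist p x) * sinh (hdist p y) * (- cos (ang p x y)) \<le> sinh (hdist p x) * sinh (hdist p y) * 1"
      by (intro mult_left_mono) (use cos_ge_minus_one[of "ang p x y"] in auto)
    then show ?thesis using cosh_law[OF H ne] by simp
  qed
  also have "\<dots> = cosh (hdist p x + hdist p y)" by (simp add: cosh_add)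
  finally have "hdist x y \<le> hdist p x + hdist p y"
    using hdist_nonneg H by (subst (asm) cosh_real_nonneg_le_iff) auto
  then show ?thesis by (simp add: hdist_commute)
qed

lemma klein_metric_turn:
  assumes "p \<in> H2"
  shows "klein_metric p (x - p) (y - p) = Re (turn p x y) / (pairing p p)\<^sup>2"
proof -
  have "pairing p p > 0" using pairing_pos assms by blast
  then have "klein_metric p (x - p) (y - p) = ((x - p) \<bullet> (y - p) * pairing p p + (p \<bullet> (x - p)) * (p \<bullet> (y - p))) / (pairing p p)\<^sup>2"
    unfolding klein_metric_def pairing_def[symmetric] by (simp add: add_divide_distrib power2_eq_square)
  also have "(x - p) \<bullet> (y - p) * pairing p p + (p \<bullet> (x - p)) * (p \<bullet> (y - p)) = Re (turn p x y)"
    by (simp add: turn_def pairing_def inner_diff inner_commute algebra_simps)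
  finally show ?thesis .
qed

lemma hangle_eq_ang:
  assumes H: "p \<in> H2" "x \<in> H2" "y \<in> H2" and ne: "x \<noteq> p" "y \<noteq> p" and o: "orient p x y \<ge> 0"
  shows "hangle p x y = ang p x y"
proof -
  have P: "(pairing p p)\<^sup>2 > 0" using pairing_pos[OF H(1,1)] by simp
  have nz: "turn p x y \<noteq> 0" using turn_nonzero[OF H ne] .
  have "klein_metric p (x - p) (x - p) * klein_metric p (y - p) (y - p) = (cmod (turn p x y) / (pairing p p)\<^sup>2)\<^sup>2"
    unfolding klein_metric_turn[OF H(1)] power_divide[of "cmod _"] norm_turn[OF H(1)] turn_self Re_complex_of_real
    by (simp add: power2_eq_square)
  then have "sqrt (klein_metric p (x - p) (x - p) * klein_metric p (y - p) (y - p)) = cmod (turn p x y) / (pairing p p)\<^sup>2"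
    using P by (simp only: real_sqrt_abs) simp
  then have "hangle p x y = arccos (Re (turn p x y) / cmod (turn p x y))"
    unfolding hangle_def klein_metric_turn[OF H(1)] using P by simp
  also have "\<dots> = arccos (cos (ang p x y))" unfolding ang_def using nz by (simp add: cos_Arg)
  also have "\<dots> = ang p x y" using ang_bounds[OF H(1) o] by (intro arccos_cos) auto
  finally show ?thesis .
qed

lemma ang_right:
  assumes "orient p x y > 0" "p \<in> H2" "Re (turn p x y) = 0"
  shows "ang p x y = pi / 2"
proof -
  have "Im (turn p x y) > 0" using assms pairing_pos[of p p] by (simp add: turn_def)
  then have "turn p x y = of_real (Im (turn p x y)) * \<i>" using assms by (simp add: complex_eq_iff)
  then have "ang p x y = Arg \<i>" unfolding ang_def using \<open>Im (turn p x y) > 0\<close> by (metis Arg_times_of_real)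
  then show ?thesis by (simp add: Arg_ii)
qed

lemma pythagoras:
  assumes "p \<in> H2" "x \<in> H2" "y \<in> H2" "Re (turn p x y) = 0"
  shows "cosh (hdist x y) = cosh (hdist p x) * cosh (hdist p y)"
  using Re_turn_hdist[OF assms(1-3)] assms(4) by simp

text \<open>Here \<open>c\<close> is the hypotenuse, \<phi> lies opposite \<open>b\<close> and
  \<psi> opposite \<open>a\<close>; the assumptions are Pythagoras and the law of cosines.\<close>

lemma right_triangle_angles:
  fixes a b c :: real
  assumes pos: "a > 0" "b > 0" "c > 0" and pyth: "cosh c = cosh a * cosh b"
    and \<phi>: "0 < \<phi>" "\<phi> < pi" and cos\<phi>: "cos \<phi> = (cosh a * cosh c - cosh b) / (sinh a * sinh c)"
    and \<psi>: "0 < \<psi>" "\<psi> < pi" and cos\<psi>: "cos \<psi> = (cosh b * cosh c - cosh a) / (sinh b * sinh c)"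
  shows "b < c" "\<phi> < pi / 2" "\<psi> < pi / 2" "cos \<psi> = tanh b / tanh c" "sin \<phi> = sinh b / sinh c"
proof -
  have ca: "cosh a > 1" using cosh_real_strict_mono[of 0 a] pos by simp
  have "1 * cosh b < cosh a * cosh b" using ca by (intro mult_strict_right_mono) auto
  then have "cosh b < cosh c" using pyth by simp
  then show bc: "b < c" using pos by (subst (asm) cosh_real_nonneg_less_iff) auto
  have sp: "sinh a > 0" "sinh b > 0" "sinh c > 0" using pos by auto
  have cp: "cosh a > 0" "cosh b > 0" "cosh c > 0" by auto
  have "cosh b * cosh c - cosh a = cosh a * ((cosh b)\<^sup>2 - 1)" by (simp add: pyth power2_eq_square algebra_simps)
  then have "cosh b * cosh c - cosh a = cosh a * (sinh b)\<^sup>2" by (simp add: cosh_square_eq)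
  then have "cos \<psi> = cosh a * sinh b / sinh c" unfolding cos\<psi> using sp by (simp add: power2_eq_square)
  also have "\<dots> = tanh b / tanh c" using cp sp by (simp add: tanh_def pyth)
  finally show t: "cos \<psi> = tanh b / tanh c" .
  have "cosh a * cosh c - cosh b = cosh b * ((cosh a)\<^sup>2 - 1)" by (simp add: pyth power2_eq_square algebra_simps)
  then have "cosh a * cosh c - cosh b = cosh b * (sinh a)\<^sup>2" by (simp add: cosh_square_eq)
  then have c\<phi>: "cos \<phi> = cosh b * sinh a / sinh c" unfolding cos\<phi> using sp by (simp add: power2_eq_square)
  have lt: "x < pi / 2" if "cos x > 0" "x < pi" "0 < x" for x
  proof (rule ccontr)
    assume "\<not> x < pi / 2"
    then have "cos x \<le> cos (pi / 2)" using that by (intro cos_monotone_0_pi_le) auto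
    then show False using that by simp
  qed
  show "\<phi> < pi / 2" using c\<phi> sp cp \<phi> by (intro lt) auto
  show "\<psi> < pi / 2" using t pos \<psi> by (intro lt) auto
  have "(sin \<phi>)\<^sup>2 = 1 - (cos \<phi>)\<^sup>2" by (simp add: sin_squared_eq)
  also have "\<dots> = ((sinh c)\<^sup>2 - (cosh b)\<^sup>2 * (sinh a)\<^sup>2) / (sinh c)\<^sup>2"
    unfolding c\<phi> using sp by (simp add: power_divide power_mult_distrib diff_divide_distrib)
  also have "(sinh c)\<^sup>2 - (cosh b)\<^sup>2 * (sinh a)\<^sup>2 = (sinh b)\<^sup>2"
  proof -
    have "(sinh c)\<^sup>2 = (cosh a)\<^sup>2 * (cosh b)\<^sup>2 - 1"
      using cosh_square_eq[of c] by (simp add: pyth power_mult_distrib)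
    then show ?thesis by (simp add: cosh_square_eq algebra_simps)
  qed
  finally have "(sin \<phi>)\<^sup>2 = (sinh b / sinh c)\<^sup>2" by (simp add: power_divide)
  then show "sin \<phi> = sinh b / sinh c"
    by (rule power2_eq_imp_eq) (use sp sin_gt_zero[OF \<phi>] in simp_all)
qed

text \<open>At a fixed angle, the leg \<open>b\<close> is a contracting function of the hypotenuse \<open>c\<close>.\<close>

lemma right_triangle_eq:
  fixes b b' c c' k :: real
  assumes "0 < b" "b < c" "0 < b'" "b' < c'" "0 < k" "k < 1"
    and "tanh b = k * tanh c" "tanh b' = k * tanh c'" and "b + c' = b' + c"
  shows "c = c'" "b = b'"
proof -
  have *: False if "0 < b" "b < c" "0 < b'" "b' < c'" "0 < k" "k < 1"
    "tanh b = k * tanh c" "tanh b' = k * tanh c'" "b + c' = b' + c" "c < c'" for b b' c c' k :: real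
  proof -
    \<comment> \<open>The legs and the hypotenuses differ by the same amount. By this formula tanh
      grows less between the hypotenuses, where cosh is larger, and the factor \<open>k\<close>
      shrinks the growth further, so equality is impossible.\<close>
    have d: "tanh y - tanh x = sinh (y - x) / (cosh x * cosh y)" for x y :: real
      by (simp add: tanh_def sinh_diff field_simps)
    define s where "s = sinh (c' - c)"
    have s: "s > 0" using that by (simp add: s_def)
    have "b' - b = c' - c" using that by simp
    then have "s / (cosh b * cosh b') = tanh b' - tanh b" using d[of b' b] by (simp add: s_def)
    also have "\<dots> = k * (tanh c' - tanh c)" using that by (simp add: right_diff_distrib)
    also have "\<dots> = k * (s / (cosh c * cosh c'))" unfolding d s_def ..
    finally have "s / (cosh b * cosh b') = k * (s / (cosh c * cosh c'))" .
    moreover have "cosh b * cosh b' < cosh c * cosh c'"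
      using that by (intro mult_strict_mono cosh_real_strict_mono) auto
    then have "s / (cosh c * cosh c') < s / (cosh b * cosh b')" using s by (intro divide_strict_left_mono) auto
    moreover have "k * (s / (cosh c * cosh c')) \<le> s / (cosh c * cosh c')"
      using that s by (intro mult_left_le_one_le) auto
    ultimately show False by linarith
  qed
  show "c = c'" using *[of b c b' c' k] *[of b' c' b c k] assms by (cases c c' rule: linorder_cases) auto
  then show "b = b'" using assms by simp
qed

section \<open>Ordinary reduced polygons\<close>

lemma harea_mono:
  assumes "compact S" "compact T" "S \<subseteq> T" "T \<subseteq> H2"
  shows "harea S \<le> harea T"
  unfolding harea_def set_lebesgue_integral_def
proof (rule integral_mono)
  show "integrable lborel (\<lambda>x. indicator S x *\<^sub>R harea_density x)" "integrable lborel (\<lambda>x. indicator T x *\<^sub>R harea_density x)"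
    using harea_integrable assms by (auto simp: set_integrable_def)
  show "indicator S x *\<^sub>R harea_density x \<le> indicator T x *\<^sub>R harea_density x" for x
    using assms harea_density_nonneg[of x] by (auto simp: indicator_def)
qed

lemma harea_Un_le:
  assumes "compact S" "compact T" "S \<subseteq> H2" "T \<subseteq> H2"
  shows "harea (S \<union> T) \<le> harea S + harea T"
proof -
  have i: "integrable lborel (\<lambda>x. indicator S x *\<^sub>R harea_density x)" "integrable lborel (\<lambda>x. indicator T x *\<^sub>R harea_density x)"
    "integrable lborel (\<lambda>x. indicator (S \<union> T) x *\<^sub>R harea_density x)"
    using harea_integrable assms compact_Un[of S T] by (auto simp: set_integrable_def)
  show ?thesis
    unfolding harea_def set_lebesgue_integral_def Bochner_Integration.integral_add[OF i(1,2), symmetric]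
  proof (rule integral_mono)
    show "indicator (S \<union> T) x *\<^sub>R harea_density x \<le> indicator S x *\<^sub>R harea_density x + indicator T x *\<^sub>R harea_density x" for x
      using assms harea_density_nonneg[of x] by (auto simp: indicator_def)
  qed (use i in auto)
qed

lemma harea_UN_le:
  assumes "finite I" "\<And>i. i \<in> I \<Longrightarrow> compact (S i) \<and> S i \<subseteq> H2"
  shows "harea (\<Union>i\<in>I. S i) \<le> (\<Sum>i\<in>I. harea (S i))"
  using assms
proof (induction I rule: finite_induct)
  case empty
  then show ?case by (simp add: harea_def set_lebesgue_integral_def)
next
  case (insert j I)
  have "harea (S j \<union> (\<Union>i\<in>I. S i)) \<le> harea (S j) + harea (\<Union>i\<in>I. S i)"
    using insert by (intro harea_Un_le) (auto intro!: compact_UN)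
  also have "\<dots> \<le> harea (S j) + (\<Sum>i\<in>I. harea (S i))" using insert by auto
  finally show ?case using insert by simp
qed

text \<open>The diagonals \<open>a c\<close> and \<open>b d\<close> of a convex quadrilateral cross.
  Each is divided in the ratio of the areas that the other one cuts off, and \<open>s\<close> is
  twice the whole area.\<close>

lemma quadrilateral_diagonals:
  assumes "orient a b c > 0" "orient a b d > 0" "orient a c d > 0" "orient b c d > 0"
  obtains p \<kappa> \<mu> where "0 < \<kappa>" "\<kappa> < 1" "0 < \<mu>" "\<mu> < 1"
    "p = (1 - \<kappa>) *\<^sub>R a + \<kappa> *\<^sub>R c" "p = (1 - \<mu>) *\<^sub>R b + \<mu> *\<^sub>R d"
proof -
  define s where "s = orient a b d + orient b c d"
  have s: "s > 0" "s = orient a b c + orient a c d"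
    using assms by (auto simp: s_def) (simp add: orient_def algebra_simps)
  define \<kappa> \<mu> where "\<kappa> = orient a b d / s" and "\<mu> = orient a b c / s"
  have l: "s * \<kappa> = orient a b d" "s * (1 - \<kappa>) = orient b c d"
    using s by (auto simp: \<kappa>_def right_diff_distrib) (simp add: s_def)
  have m: "s * \<mu> = orient a b c" "s * (1 - \<mu>) = orient a c d" using s by (auto simp: \<mu>_def right_diff_distrib)
  have "s *\<^sub>R ((1 - \<kappa>) *\<^sub>R a + \<kappa> *\<^sub>R c) = s *\<^sub>R ((1 - \<mu>) *\<^sub>R b + \<mu> *\<^sub>R d)"
    unfolding scaleR_add_right scaleR_scaleR l m
    by (simp add: vec_eq_iff forall_2 orient_def algebra_simps)
  then have "(1 - \<kappa>) *\<^sub>R a + \<kappa> *\<^sub>R c = (1 - \<mu>) *\<^sub>R b + \<mu> *\<^sub>R d" using s by simp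
  moreover have "0 < \<kappa>" "0 < \<mu>" using assms s by (simp_all add: \<kappa>_def \<mu>_def)
  moreover have "\<kappa> < 1" "\<mu> < 1" using l(2) m(2) assms s(1) by (simp_all add: zero_less_mult_iff flip: l(2) m(2))
  ultimately show ?thesis using that by blast
qed

lemma cos_ang_commute:
  assumes "p \<in> H2" "x \<in> H2" "y \<in> H2" "x \<noteq> p" "y \<noteq> p"
  shows "cos (ang p x y) = cos (ang p y x)"
  using cos_ang[OF assms] cos_ang[OF assms(1,3,2,5,4)] by (simp add: hdist_commute mult.commute)

text \<open>The right angle is at \<open>t\<close>. Only the cosines of the angles enter and either
  orientation is allowed, so that the two oppositely oriented triangles of a butterfly are treated
  alike.\<close>

lemma right_triangle:
  assumes H: "v \<in> H2" "t \<in> H2" "z \<in> H2" and o: "orient v t z \<noteq> 0" and r: "Re (turn t v z) = 0"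
    and \<phi>: "0 < \<phi>" "\<phi> < pi" "cos \<phi> = cos (ang v t z)"
    and \<psi>: "0 < \<psi>" "\<psi> < pi" "cos \<psi> = cos (ang z v t)"
  shows "0 < hdist z t" "hdist z t < hdist z v" "\<phi> < pi / 2" "\<psi> < pi / 2"
    "cos \<psi> = tanh (hdist z t) / tanh (hdist z v)" "sin \<phi> = sinh (hdist z t) / sinh (hdist z v)"
proof -
  have ne: "t \<noteq> v" "z \<noteq> v" "z \<noteq> t" "v \<noteq> z" "t \<noteq> z" using o by auto
  have "cosh (hdist v z) = cosh (hdist t v) * cosh (hdist t z)" by (rule pythagoras[OF H(2,1,3) r])
  then have p: "cosh (hdist z v) = cosh (hdist t v) * cosh (hdist z t)" by (simp add: hdist_commute)
  have pos: "hdist t v > 0" "hdist z t > 0" "hdist z v > 0" using hdist_pos H ne by auto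
  have c1: "cos \<phi> = (cosh (hdist t v) * cosh (hdist z v) - cosh (hdist z t)) / (sinh (hdist t v) * sinh (hdist z v))"
    unfolding \<phi>(3) cos_ang[OF H ne(1,2)] by (simp add: hdist_commute)
  have c2: "cos \<psi> = (cosh (hdist z t) * cosh (hdist z v) - cosh (hdist t v)) / (sinh (hdist z t) * sinh (hdist z v))"
    unfolding \<psi>(3) cos_ang[OF H(3,1,2) ne(4,5)] by (simp add: hdist_commute mult.commute)
  note R = right_triangle_angles[OF pos p \<phi>(1,2) c1 \<psi>(1,2) c2]
  show "0 < hdist z t" "hdist z t < hdist z v" "\<phi> < pi / 2" "\<psi> < pi / 2"
    "cos \<psi> = tanh (hdist z t) / tanh (hdist z v)" "sin \<phi> = sinh (hdist z t) / sinh (hdist z v)"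
    using pos(2) R by auto
qed

lemma hdist_segment:
  assumes "x \<in> H2" "y \<in> H2" "0 \<le> t" "t \<le> 1" "z = (1 - t) *\<^sub>R x + t *\<^sub>R y"
  shows "hdist x z + hdist z y = hdist x y"
proof -
  have "z \<in> closed_segment x y" using assms by (auto simp: in_segment)
  then show ?thesis using geodesic_segment_eq_closed_segment[OF assms(1,2)] by (auto simp: geodesic_segment_def)
qed

lemma sum_periodic_shift:
  fixes f :: "int \<Rightarrow> real"
  assumes "n > 0" "\<And>i. f (i + int n) = f i"
  shows "(\<Sum>i\<in>{0..<int n}. f (i + k)) = (\<Sum>i\<in>{0..<int n}. f i)"
proof -
  have mod: "f (i mod int n) = f i" for i
    using int_periodic_mod[of f n i 0] assms(2) by simp
  show ?thesis
  proof (rule sum.reindex_bij_witness[where i = "\<lambda>i. (i - k) mod int n" and j = "\<lambda>i. (i + k) mod int n"])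
    show "f ((a + k) mod int n) = f (a + k)" for a by (rule mod)
  qed (use assms(1) in \<open>auto simp: mod_simps\<close>)
qed

text \<open>Here \<open>t i\<close> is the foot of the altitude from \<open>u i\<close>, and a right
  angle is a vanishing real part of \<open>turn\<close>.\<close>

locale ordinary_polygon = cyclic_polygon +
  fixes m :: nat and t :: "int \<Rightarrow> real ^ 2" and w :: real
  assumes n_odd: "n = 2 * m + 1" and t_periodic: "t (i + int n) = t i"
    and t_side: "t i \<in> open_segment (u (i + int m)) (u (i + int m + 1))"
    and t_right: "Re (turn (t i) (u i) (u (i + int m))) = 0" "Re (turn (t i) (u i) (u (i + int m + 1))) = 0"
    and t_dist: "hdist (u i) (t i) = w"
begin

lemma m1: "m \<ge> 1" using n_odd n3 by simp

definition base_angle :: "int \<Rightarrow> real" where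
  "base_angle i = ang (u i) (u (i + 1)) (t i)"

lemma base_angle_periodic: "base_angle (i + int n) = base_angle i"
  using periodic[of i] periodic[of "i + 1"] t_periodic by (simp add: base_angle_def algebra_simps)

lemma t_obtain:
  obtains s where "0 < s" "s < 1" "t i = (1 - s) *\<^sub>R u (i + int m) + s *\<^sub>R u (i + int m + 1)"
  using t_side[of i] by (auto simp: in_segment)

lemma t_H2: "t i \<in> H2"
proof -
  obtain s where "0 < s" "s < 1" "t i = (1 - s) *\<^sub>R u (i + int m) + s *\<^sub>R u (i + int m + 1)"
    by (rule t_obtain)
  then show ?thesis using H2_segment[OF in_H2 in_H2, of s] by simp
qed

text \<open>Given by the formula instead of as an angle at a crossing point, so that it visibly
  depends on \<open>w\<close> and the base angle alone; \<open>butterfly\<close> identifies it with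
  \<psi>.\<close>

definition apex_angle :: "int \<Rightarrow> real" where
  "apex_angle i = 2 * half_apex (tanh (w / 2)) (pi / 4 - base_angle i / 2)"

text \<open>The crossing point \<open>z\<close> is that of the diagonals of the quadrilateral
  \<open>u i\<close>, \<open>t j\<close>, \<open>t i\<close>, \<open>u j\<close>. A nonnegative
  product of orientations means equal sides of the two altitudes, and together with the two polygon
  sides this places the point in one of the triangles at \<open>z\<close>. The set is existential so
  that \<open>z\<close> can stay local to the proof.\<close>

lemma butterfly:
  fixes i :: int
  defines "j \<equiv> i + int m + 1"
  shows "ang (u j) (t j) (u (j - 1)) = base_angle i" "0 < base_angle i" "base_angle i < pi / 2"
    and "\<exists>S. compact S \<and> S \<subseteq> H2 \<and> harea S \<le> pi - 2 * base_angle i - 2 * apex_angle i \<and>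
      (\<forall>x\<in>body. 0 \<le> orient (u i) (t i) x * orient (u j) (t j) x \<longrightarrow> x \<in> S)"
proof -
  obtain r where r: "0 < r" "r < 1" and ti: "t i = (1 - r) *\<^sub>R u (j - 1) + r *\<^sub>R u j"
    using t_obtain[of i] by (auto simp: j_def)
  \<comment> \<open>Because \<open>j + m = i + n\<close>, the side opposite \<open>u j\<close> is
    the one that starts at \<open>u i\<close>.\<close>
  have j2: "u (j + int m) = u i" "u (j + int m + 1) = u (i + 1)"
    using periodic[of i] periodic[of "i + 1"] by (simp_all add: j_def n_odd algebra_simps)
  obtain s where s: "0 < s" "s < 1" and tj: "t j = (1 - s) *\<^sub>R u i + s *\<^sub>R u (i + 1)"
    using t_obtain[of j] j2 by metis
  have e1: "orient (u i) (t j) x = s * orient (u i) (u (i + 1)) x" for x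
    unfolding tj by (simp add: orient_def algebra_simps)
  have e2: "orient a (t i) (u j) = (1 - r) * orient a (u (j - 1)) (u j)" for a
    unfolding ti by (simp add: orient_def algebra_simps)
  have p1: "orient (u i) (u (i + 1)) (u j) > 0" using m1 n_odd by (intro orient_pos) (auto simp: j_def)
  have p2: "orient (u i) (u (j - 1)) (u j) > 0" using m1 n_odd by (intro orient_pos) (auto simp: j_def)
  \<comment> \<open>Only weakly positive: in a triangle, \<open>m = 1\<close>, the vertices
    \<open>u (i + 1)\<close> and \<open>u (j - 1)\<close> coincide.\<close>
  have p3: "orient (u i) (u (i + 1)) (u (j - 1)) \<ge> 0" "orient (u (i + 1)) (u (j - 1)) (u j) \<ge> 0"
  proof -
    have "orient (u i) (u (i + 1)) (u (j - 1)) \<ge> 0 \<and> orient (u (i + 1)) (u (j - 1)) (u j) \<ge> 0"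
    proof (cases "m = 1")
      case True
      then have "j - 1 = i + 1" by (simp add: j_def)
      then show ?thesis by (simp only: orient_self) simp
    next
      case False
      then show ?thesis using m1 n_odd by (auto simp: j_def intro!: less_imp_le orient_pos)
    qed
    then show "orient (u i) (u (i + 1)) (u (j - 1)) \<ge> 0" "orient (u (i + 1)) (u (j - 1)) (u j) \<ge> 0" by auto
  qed
  have O2: "orient (u i) (t j) (u j) > 0" unfolding e1 using s p1 by simp
  have O1: "orient (u i) (t j) (t i) > 0" unfolding e1 unfolding ti orient_affine
    using s p1 p3 r by (intro mult_pos_pos add_nonneg_pos mult_nonneg_nonneg) auto
  have O3: "orient (u i) (t i) (u j) > 0" unfolding e2 using r p2 by simp
  have "orient (t j) (u (j - 1)) (u j) = (1 - s) * orient (u i) (u (j - 1)) (u j) + s * orient (u (i + 1)) (u (j - 1)) (u j)"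
    unfolding tj by (simp add: orient_def algebra_simps)
  also have "\<dots> > 0" using s p2 p3 by (intro add_pos_nonneg mult_pos_pos mult_nonneg_nonneg) auto
  finally have O4: "orient (t j) (t i) (u j) > 0" unfolding e2 using r by simp
  obtain z \<kappa> \<mu> where lm: "0 < \<kappa>" "\<kappa> < 1" "0 < \<mu>" "\<mu> < 1"
    and z1: "z = (1 - \<kappa>) *\<^sub>R u i + \<kappa> *\<^sub>R t i" and z2: "z = (1 - \<mu>) *\<^sub>R t j + \<mu> *\<^sub>R u j"
    using quadrilateral_diagonals[OF O1 O2 O3 O4] by blast
  have H: "u i \<in> H2" "u j \<in> H2" "t i \<in> H2" "t j \<in> H2" using in_H2 t_H2 by auto
  have zH: "z \<in> H2" unfolding z1 using H lm by (intro H2_segment) auto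
  have T1: "orient (u i) (t j) z > 0"
  proof -
    have "orient (u i) (t j) z = \<kappa> * orient (u i) (t j) (t i)" unfolding z1 by (simp add: orient_affine)
    then show ?thesis using O1 lm by simp
  qed
  have T2: "orient z (t i) (u j) > 0"
  proof -
    have "orient z (t i) (u j) = (1 - \<kappa>) * orient (u i) (t i) (u j)" unfolding z1 by (simp add: orient_def algebra_simps)
    then show ?thesis using O3 lm by simp
  qed
  have T1': "orient (t j) z (u i) > 0" "orient z (u i) (t j) > 0" using T1 orient_cycle by metis+
  have T2': "orient (t i) (u j) z > 0" "orient (u j) z (t i) > 0" using T2 orient_cycle by metis+
  have "z - t j = \<mu> *\<^sub>R (u j - t j)" "z - u j = (1 - \<mu>) *\<^sub>R (t j - u j)"
    unfolding z2 by (simp_all add: algebra_simps)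
  moreover have "z - t i = (1 - \<kappa>) *\<^sub>R (u i - t i)" "z - u i = \<kappa> *\<^sub>R (t i - u i)"
    unfolding z1 by (simp_all add: algebra_simps)
  ultimately have d: "z - t j = \<mu> *\<^sub>R (u j - t j)" "z - t i = (1 - \<kappa>) *\<^sub>R (u i - t i)"
    "z - u i = \<kappa> *\<^sub>R (t i - u i)" "z - u j = (1 - \<mu>) *\<^sub>R (t j - u j)"
    by simp_all
  have dt: "t j - u i = s *\<^sub>R (u (i + 1) - u i)" "t i - u j = (1 - r) *\<^sub>R (u (j - 1) - u j)"
    using ti tj by (simp_all add: algebra_simps)
  have R1: "Re (turn (t j) z (u i)) = 0"
    using turn_scale[of z "t j" \<mu> "u j" "u i" 1 "u i"] d(1) t_right(1)[of j] j2 by simp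
  have R2: "Re (turn (t i) (u j) z) = 0"
  proof -
    have "Re (turn (t i) z (u j)) = 0"
      using turn_scale[of z "t i" "1 - \<kappa>" "u i" "u j" 1 "u j"] d(2) t_right(2)[of i] by (simp add: j_def)
    then show ?thesis by (simp add: turn_def pairing_commute mult.commute)
  qed
  have R1': "Re (turn (t j) (u i) z) = 0" using R1 by (simp add: turn_def pairing_commute mult.commute)
  define \<phi> \<psi> \<phi>' where "\<phi> = ang (u i) (t j) z" and "\<psi> = ang z (u i) (t j)" and "\<phi>' = ang (u j) z (t i)"
  \<comment> \<open>Vertical angles: both rays are reversed, so both scaling factors are negative
    and their product is positive.\<close>
  have \<psi>2: "ang z (t i) (u j) = \<psi>"
    unfolding \<psi>_def
  proof (rule ang_scale)
    have "t i - z = - ((1 - \<kappa>) / \<kappa>) *\<^sub>R (u i - z)"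
    proof -
      have "u i - z = - \<kappa> *\<^sub>R (t i - u i)" using d(3) by (simp add: algebra_simps)
      then have e: "u i - z = (- \<kappa>) *\<^sub>R (t i - u i)" .
      have "- ((1 - \<kappa>) / \<kappa>) *\<^sub>R (u i - z) = (1 - \<kappa>) *\<^sub>R (t i - u i)" unfolding e scaleR_scaleR using lm by simp
      also have "\<dots> = t i - z" using d(2) by (simp add: algebra_simps)
      finally show ?thesis by simp
    qed
    then show "t i - z = (- ((1 - \<kappa>) / \<kappa>)) *\<^sub>R (u i - z)" .
    have "u j - z = - ((1 - \<mu>) / \<mu>) *\<^sub>R (t j - z)"
    proof -
      have "t j - z = - \<mu> *\<^sub>R (u j - t j)" using d(1) by (simp add: algebra_simps)
      then have e: "t j - z = (- \<mu>) *\<^sub>R (u j - t j)" .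
      have "- ((1 - \<mu>) / \<mu>) *\<^sub>R (t j - z) = (1 - \<mu>) *\<^sub>R (u j - t j)" unfolding e scaleR_scaleR using lm by simp
      also have "\<dots> = u j - z" using d(4) by (simp add: algebra_simps)
      finally show ?thesis by simp
    qed
    then show "u j - z = (- ((1 - \<mu>) / \<mu>)) *\<^sub>R (t j - z)" .
    show "0 < - ((1 - \<kappa>) / \<kappa>) * - ((1 - \<mu>) / \<mu>)" using lm by simp
  qed
  have f1: "\<phi> = base_angle i" unfolding \<phi>_def base_angle_def
    by (rule ang_scale[OF dt(1) d(3)]) (use s lm in simp)
  have f2: "\<phi>' = ang (u j) (t j) (u (j - 1))" unfolding \<phi>'_def
    by (rule ang_scale[OF d(4) dt(2)]) (use r lm in simp)
  have a: "0 < \<phi>" "\<phi> < pi" "0 < \<psi>" "\<psi> < pi" "0 < \<phi>'" "\<phi>' < pi"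
    unfolding \<phi>_def \<psi>_def \<phi>'_def using ang_bounds_strict H zH T1 T1' T2' by blast+
  have ne: "z \<noteq> u i" "z \<noteq> u j" "z \<noteq> t i" "z \<noteq> t j" "u j \<noteq> t i" using T1 T2 by auto
  have cc: "cos \<phi>' = cos (ang (u j) (t i) z)" unfolding \<phi>'_def
    using cos_ang_commute[of "u j" z "t i"] H zH ne by auto
  have cp: "cos \<psi> = cos (ang z (u j) (t i))" unfolding \<psi>2[symmetric]
    using cos_ang_commute[of z "t i" "u j"] H zH ne by auto
  have on: "orient (u i) (t j) z \<noteq> 0" "orient (u j) (t i) z \<noteq> 0"
    using T1 T2'(2) orient_swap[of "u j" "t i" z] by auto
  note R = right_triangle[OF H(1,4) zH on(1) R1' a(1,2) _ a(3,4)]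
  note R1 = R[OF arg_cong[OF \<phi>_def] arg_cong[OF \<psi>_def]]
  note R2 = right_triangle[OF H(2,3) zH on(2) R2 a(5,6) cc a(3,4) cp]
  have th: "tanh (hdist z (u i)) > 0" "tanh (hdist z (u j)) > 0" using R1(1,2) R2(1,2) by auto
  have k: "0 < cos \<psi>" "cos \<psi> < 1"
    using a R1(4) cos_gt_zero[of \<psi>] cos_monotone_0_pi[of 0 \<psi>] by auto
  have w1: "hdist z (u i) + hdist z (t i) = w"
    using hdist_segment[OF H(1,3) _ _ z1] lm t_dist[of i] by (simp add: hdist_commute)
  have w2: "hdist z (t j) + hdist z (u j) = w"
    using hdist_segment[OF H(4,2) _ _ z2] lm t_dist[of j] by (simp add: hdist_commute)
  have m1: "tanh (hdist z (t j)) = cos \<psi> * tanh (hdist z (u i))"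
    unfolding R1(5) using less_imp_neq[OF th(1)] by simp
  have m2: "tanh (hdist z (t i)) = cos \<psi> * tanh (hdist z (u j))"
    unfolding R2(5) using less_imp_neq[OF th(2)] by simp
  have w3: "hdist z (t j) + hdist z (u j) = hdist z (t i) + hdist z (u i)" using w1 w2 by simp
  note eq = right_triangle_eq[OF R1(1,2) R2(1,2) k m1 m2 w3]
  have "sin \<phi> = sin \<phi>'" using R1(6) R2(6) eq by simp
  then have ff: "\<phi> = \<phi>'" using a R1(3) R2(3) sin_inj_pi[of \<phi> \<phi>'] by auto
  show "ang (u j) (t j) (u (j - 1)) = base_angle i" "0 < base_angle i" "base_angle i < pi / 2"
    using ff f1 f2 a R1(3) by auto
  have "\<psi> / 2 = half_apex (tanh ((hdist z (t j) + hdist z (u i)) / 2)) (pi / 4 - \<phi> / 2)"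
    by (rule half_apex_right_triangle[OF R1(1,2) a(1) R1(3) a(3) R1(4) R1(5) R1(6)])
  also have "hdist z (t j) + hdist z (u i) = w" using eq w1 by simp
  finally have ps: "\<psi> = apex_angle i" by (simp add: apex_angle_def f1)
  let ?S1 = "convex hull {u i, t j, z}" and ?S2 = "convex hull {z, t i, u j}"
  have C: "compact ?S1" "compact ?S2" "?S1 \<subseteq> H2" "?S2 \<subseteq> H2"
    using H zH by (simp_all add: finite_imp_compact_convex_hull convex_hull_subset_H2)
  have A1: "harea ?S1 = pi / 2 - \<phi> - \<psi>"
    using gauss_bonnet_triangle[OF H(1,4) zH T1] ang_right[OF T1'(1) H(4) \<open>Re (turn (t j) z (u i)) = 0\<close>]
    by (simp add: \<phi>_def \<psi>_def)
  have A2: "harea ?S2 = pi / 2 - \<phi>' - \<psi>"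
    using gauss_bonnet_triangle[OF zH H(3,2) T2] ang_right[OF T2'(1) H(3) \<open>Re (turn (t i) (u j) z) = 0\<close>] \<psi>2
    by (simp add: \<phi>'_def)
  have "harea (?S1 \<union> ?S2) \<le> pi - 2 * base_angle i - 2 * apex_angle i"
    using harea_Un_le[OF C] A1 A2 ff f1 ps by simp
  moreover have "x \<in> ?S1 \<union> ?S2" if x: "x \<in> body" and sg: "0 \<le> orient (u i) (t i) x * orient (u j) (t j) x" for x
  proof -
    have b: "orient (u i) (u (i + 1)) x \<ge> 0" "orient (u (j - 1)) (u j) x \<ge> 0"
      using body_edge[OF x, of i] body_edge[OF x, of "j - 1"] by auto
    have e: "orient (u i) (t j) x = s * orient (u i) (u (i + 1)) x" "orient (t i) (u j) x = (1 - r) * orient (u (j - 1)) (u j) x"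
      unfolding ti tj by (simp_all add: orient_def algebra_simps)
    have e': "orient (t j) z x = - (\<mu> * orient (u j) (t j) x)" "orient (u j) z x = (1 - \<mu>) * orient (u j) (t j) x"
      unfolding z2 by (simp_all add: orient_def algebra_simps)
    have e'': "orient z (u i) x = - (\<kappa> * orient (u i) (t i) x)" "orient z (t i) x = (1 - \<kappa>) * orient (u i) (t i) x"
      unfolding z1 by (simp_all add: orient_def algebra_simps)
    consider "orient (u i) (t i) x \<le> 0" "orient (u j) (t j) x \<le> 0" | "orient (u i) (t i) x \<ge> 0" "orient (u j) (t j) x \<ge> 0"
      using sg by (auto simp: zero_le_mult_iff)
    then show ?thesis
    proof cases
      case 1
      then have "x \<in> ?S1" unfolding mem_triangle_iff[OF T1] e e' e'' using b s lm
        by (auto simp: mult_nonneg_nonpos)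
      then show ?thesis by blast
    next
      case 2
      then have "x \<in> ?S2" unfolding mem_triangle_iff[OF T2] e e' e'' using b r lm by auto
      then show ?thesis by blast
    qed
  qed
  moreover have "compact (?S1 \<union> ?S2)" "?S1 \<union> ?S2 \<subseteq> H2" using C by (auto intro!: compact_Un)
  ultimately show "\<exists>S. compact S \<and> S \<subseteq> H2 \<and> harea S \<le> pi - 2 * base_angle i - 2 * apex_angle i \<and>
      (\<forall>x\<in>body. 0 \<le> orient (u i) (t i) x * orient (u j) (t j) x \<longrightarrow> x \<in> S)" by blast
qed

text \<open>The altitude cuts the interior angle in two. The part towards \<open>u (i - 1)\<close>
  is seen from the other end of the butterfly with index \<open>i - m - 1\<close>, where the
  congruence of its triangles makes it a base angle too.\<close>

lemma interior_angle_split: "interior_angle i = base_angle i + base_angle (i - int m - 1)"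
proof -
  have "ang (u i) (t i) (u (i - 1)) = base_angle (i - int m - 1)"
    using butterfly(1)[of "i - int m - 1"] by simp
  moreover have "ang (u i) (u (i + 1)) (t i) + ang (u i) (t i) (u (i - 1)) = ang (u i) (u (i + 1)) (u (i - 1))"
  proof (rule ang_add)
    show "0 < ang (u i) (u (i + 1)) (u (i - 1))" using interior_angle_pos by (simp add: interior_angle_def)
    obtain s where s: "0 < s" "s < 1" "t i = (1 - s) *\<^sub>R u (i + int m) + s *\<^sub>R u (i + int m + 1)"
      by (rule t_obtain)
    have "orient (u i) (u (i + 1)) (u (i + int m)) \<ge> 0"
      using m1 n_odd orient_pos[of i "i + 1" "i + int m"] by (cases "m = 1") auto
    moreover have "orient (u i) (u (i + 1)) (u (i + int m + 1)) > 0"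
      using m1 n_odd by (intro orient_pos) auto
    ultimately have 1: "orient (u i) (u (i + 1)) (t i) > 0" unfolding s(3) orient_affine
      using s by (intro add_nonneg_pos mult_nonneg_nonneg) auto
    then show "orient (u i) (u (i + 1)) (t i) \<ge> 0" by simp
    have per: "u (i - 1) = u (i - 1 + int n)" using periodic[of "i - 1"] by simp
    have "orient (u i) (u (i + int m)) (u (i - 1)) > 0"
      unfolding per using m1 n_odd by (intro orient_pos) auto
    moreover have "orient (u i) (u (i + int m + 1)) (u (i - 1)) \<ge> 0"
    proof (cases "m = 1")
      case True
      then have "i + int m + 1 = i - 1 + int n" using n_odd by simp
      then have "u (i + int m + 1) = u (i - 1)" using per by (simp only:)
      then show ?thesis by simp
    next
      case False
      then show ?thesis unfolding per using m1 n_odd by (intro less_imp_le orient_pos) auto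
    qed
    moreover have "orient (u i) (t i) (u (i - 1)) = (1 - s) * orient (u i) (u (i + int m)) (u (i - 1))
       + s * orient (u i) (u (i + int m + 1)) (u (i - 1))"
      unfolding s(3) by (simp add: orient_def algebra_simps)
    ultimately show "orient (u i) (t i) (u (i - 1)) \<ge> 0" using s by simp
    show "t i \<noteq> u i" using 1 by auto
    show "u (i + 1) \<noteq> u i" using 1 by auto
    show "u (i - 1) \<noteq> u i" using neq[of "i - 1" i] n3 by simp
  qed (use in_H2 t_H2 in auto)
  ultimately show ?thesis by (simp add: interior_angle_def base_angle_def)
qed

lemma harea_body: "harea body = (real n - 2) * pi - 2 * (\<Sum>i\<in>{0..<int n}. base_angle i)"
proof -
  have "(\<Sum>i\<in>{0..<int n}. base_angle (i + (- int m - 1))) = (\<Sum>i\<in>{0..<int n}. base_angle i)"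
    using n3 base_angle_periodic by (intro sum_periodic_shift) auto
  then have "(\<Sum>i\<in>{0..<int n}. interior_angle i) = 2 * (\<Sum>i\<in>{0..<int n}. base_angle i)"
    by (simp add: interior_angle_split sum.distrib algebra_simps)
  then show ?thesis using harea_polygon by simp
qed

lemma altitudes_separate:
  obtains i where "0 \<le> orient (u i) (t i) x * orient (u (i + int m + 1)) (t (i + int m + 1)) x"
proof (rule ccontr)
  assume no: "\<not> thesis"
  define \<sigma> where "\<sigma> k = orient (u (int k * (int m + 1))) (t (int k * (int m + 1))) x" for k :: nat
  have alt: "\<sigma> k * \<sigma> (Suc k) < 0" for k
    using no that[of "int k * (int m + 1)"] by (force simp: \<sigma>_def algebra_simps)
  have "(- 1) ^ k * (\<sigma> 0 * \<sigma> k) > 0" for k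
  proof (induction k)
    case 0
    have "\<sigma> 0 \<noteq> 0" using alt[of 0] by auto
    then show ?case by (simp add: zero_less_mult_iff) linarith
  next
    case (Suc k)
    have "((- 1) ^ k * (\<sigma> 0 * \<sigma> k)) * (\<sigma> k * \<sigma> (Suc k)) < 0" using Suc alt[of k] by (rule mult_pos_neg)
    then have "(\<sigma> k)\<^sup>2 * ((- 1) ^ k * (\<sigma> 0 * \<sigma> (Suc k))) < 0" by (simp add: power2_eq_square mult_ac)
    then have "(- 1) ^ k * (\<sigma> 0 * \<sigma> (Suc k)) < 0" by (simp add: mult_less_0_iff)
    then show ?case by simp
  qed
  \<comment> \<open>The index has advanced by \<open>n * (m + 1)\<close>, a multiple of the period,
    but the number of sign changes is odd.\<close>
  from this[of n] have "\<sigma> 0 * \<sigma> n < 0" using n_odd by simp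
  moreover have "\<sigma> n = \<sigma> 0"
  proof -
    have "u (0 + int n * (int m + 1)) = u 0" "t (0 + int n * (int m + 1)) = t 0"
      using int_periodic_mult[of u n] int_periodic_mult[of t n] periodic t_periodic by blast+
    then show ?thesis by (simp add: \<sigma>_def)
  qed
  ultimately show False by (simp add: mult_less_0_iff)
qed

lemma sum_apex_angle: "(\<Sum>i\<in>{0..<int n}. apex_angle i) \<le> pi"
proof -
  define S where "S i = (SOME S. compact S \<and> S \<subseteq> H2 \<and> harea S \<le> pi - 2 * base_angle i - 2 * apex_angle i \<and>
      (\<forall>x\<in>body. 0 \<le> orient (u i) (t i) x * orient (u (i + int m + 1)) (t (i + int m + 1)) x \<longrightarrow> x \<in> S))" for i
  have S: "compact (S i) \<and> S i \<subseteq> H2 \<and> harea (S i) \<le> pi - 2 * base_angle i - 2 * apex_angle i \<and>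
      (\<forall>x\<in>body. 0 \<le> orient (u i) (t i) x * orient (u (i + int m + 1)) (t (i + int m + 1)) x \<longrightarrow> x \<in> S i)" for i
    unfolding S_def by (rule someI_ex[OF butterfly(4)])
  have mod: "u (i mod int n + k) = u (i + k)" "t (i mod int n + k) = t (i + k)" for i k
    using int_periodic_mod[of u n] int_periodic_mod[of t n] periodic t_periodic by auto
  have "body \<subseteq> (\<Union>i\<in>{0..<int n}. S i)"
  proof
    fix x assume x: "x \<in> body"
    obtain i where i: "0 \<le> orient (u i) (t i) x * orient (u (i + int m + 1)) (t (i + int m + 1)) x"
      by (rule altitudes_separate)
    have "0 \<le> orient (u (i mod int n)) (t (i mod int n)) x *
       orient (u (i mod int n + int m + 1)) (t (i mod int n + int m + 1)) x"
      using i mod[of i 0] mod[of i "int m + 1"] by (simp add: add.assoc)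
    then have "x \<in> S (i mod int n)" using S x by blast
    then show "x \<in> (\<Union>i\<in>{0..<int n}. S i)" using n3 by auto
  qed
  then have "harea body \<le> harea (\<Union>i\<in>{0..<int n}. S i)"
    using S body_compact by (intro harea_mono) (auto intro!: compact_UN)
  also have "\<dots> \<le> (\<Sum>i\<in>{0..<int n}. harea (S i))" using S by (intro harea_UN_le) auto
  also have "\<dots> \<le> (\<Sum>i\<in>{0..<int n}. pi - 2 * base_angle i - 2 * apex_angle i)" using S by (intro sum_mono) auto
  also have "\<dots> = real n * pi - 2 * (\<Sum>i\<in>{0..<int n}. base_angle i) - 2 * (\<Sum>i\<in>{0..<int n}. apex_angle i)"
    by (simp add: sum_subtractf sum_distrib_left)
  finally show ?thesis unfolding harea_body by (simp add: algebra_simps)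
qed

lemma harea_body_half_angles:
  obtains \<eta> where "\<And>i. 0 < \<eta> i" "\<And>i. \<eta> i < pi / 4"
    "(\<Sum>i\<in>{0..<int n}. half_apex (tanh (w / 2)) (\<eta> i)) \<le> pi / 2"
    "harea body = 4 * (\<Sum>i\<in>{0..<int n}. \<eta> i) - 2 * pi"
proof
  let ?\<eta> = "\<lambda>i. pi / 4 - base_angle i / 2"
  show "0 < ?\<eta> i" "?\<eta> i < pi / 4" for i using butterfly(2,3)[of i] by simp_all
  show "(\<Sum>i\<in>{0..<int n}. half_apex (tanh (w / 2)) (?\<eta> i)) \<le> pi / 2"
    using sum_apex_angle by (simp add: apex_angle_def flip: sum_distrib_left)
  show "harea body = 4 * (\<Sum>i\<in>{0..<int n}. ?\<eta> i) - 2 * pi"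
    unfolding harea_body by (simp add: sum_subtractf algebra_simps flip: sum_divide_distrib)
qed

end

section \<open>Regular polygons\<close>

lemma cramer3_zero:
  fixes x y z :: real
  assumes "p1 * x + p2 * y + p3 * z = 0" "q1 * x + q2 * y + q3 * z = 0" "r1 * x + r2 * y + r3 * z = 0"
    and D: "p1 * (q2 * r3 - q3 * r2) - p2 * (q1 * r3 - q3 * r1) + p3 * (q1 * r2 - q2 * r1) \<noteq> 0"
  shows "x = 0" "y = 0" "z = 0"
proof -
  let ?D = "p1 * (q2 * r3 - q3 * r2) - p2 * (q1 * r3 - q3 * r1) + p3 * (q1 * r2 - q2 * r1)"
  have "?D * x = (p1 * x + p2 * y + p3 * z) * (q2 * r3 - q3 * r2) + (q1 * x + q2 * y + q3 * z) * (r2 * p3 - r3 * p2)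
     + (r1 * x + r2 * y + r3 * z) * (p2 * q3 - p3 * q2)" by (simp add: algebra_simps)
  then have "?D * x = 0" unfolding assms(1-3) by simp
  then show "x = 0" using D by (simp only: mult_eq_0_iff simp_thms)
  have "?D * y = (p1 * x + p2 * y + p3 * z) * (q3 * r1 - q1 * r3) + (q1 * x + q2 * y + q3 * z) * (r3 * p1 - r1 * p3)
     + (r1 * x + r2 * y + r3 * z) * (p3 * q1 - p1 * q3)" by (simp add: algebra_simps)
  then have "?D * y = 0" unfolding assms(1-3) by simp
  then show "y = 0" using D by (simp only: mult_eq_0_iff simp_thms)
  have "?D * z = (p1 * x + p2 * y + p3 * z) * (q1 * r2 - q2 * r1) + (q1 * x + q2 * y + q3 * z) * (r1 * p2 - r2 * p1)
     + (r1 * x + r2 * y + r3 * z) * (p1 * q2 - p2 * q1)" by (simp add: algebra_simps)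
  then have "?D * z = 0" unfolding assms(1-3) by simp
  then show "z = 0" using D by (simp only: mult_eq_0_iff simp_thms)
qed

definition det3 :: "real \<times> real \<times> real \<Rightarrow> real \<times> real \<times> real \<Rightarrow> real \<times> real \<times> real \<Rightarrow> real" where
  "det3 = (\<lambda>(a0, a1, a2) (b0, b1, b2) (c0, c1, c2).
     a0 * (b1 * c2 - b2 * c1) - a1 * (b0 * c2 - b2 * c0) + a2 * (b0 * c1 - b1 * c0))"

text \<open>The Lorentz form with the timelike coordinate first; the hyperboloid model is the sheet
  where it takes the value 1 and the first coordinate is positive.\<close>

definition lform :: "real \<times> real \<times> real \<Rightarrow> real \<times> real \<times> real \<Rightarrow> real" where
  "lform = (\<lambda>(a0, a1, a2) (b0, b1, b2). a0 * b0 - a1 * b1 - a2 * b2)"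

lemma lform_linear:
  "lform (a + b) c = lform a c + lform b c" "lform (a - b) c = lform a c - lform b c" "lform (k *\<^sub>R a) c = k * lform a c"
  "lform c (a + b) = lform c a + lform c b" "lform c (a - b) = lform c a - lform c b" "lform c (k *\<^sub>R a) = k * lform c a"
  by (auto simp: lform_def case_prod_unfold algebra_simps)

lemma lform_commute: "lform a b = lform b a"
  by (simp add: lform_def case_prod_unfold mult.commute)

lemma det3_linear: "det3 a b (c + d) = det3 a b c + det3 a b d" "det3 a b (c - d) = det3 a b c - det3 a b d"
  "det3 a b (k *\<^sub>R c) = k * det3 a b c" "det3 a b b = 0" "det3 a b a = 0" "det3 b c a = det3 a b c"
  by (auto simp: det3_def case_prod_unfold algebra_simps)

text \<open>The right-hand side is the Gram determinant; no sign appears because diag(1, -1, -1) has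
  determinant 1.\<close>

lemma det3_sq:
  "(det3 a b c)\<^sup>2 = lform a a * lform b b * lform c c + 2 * lform a b * lform b c * lform a c
     - lform a a * (lform b c)\<^sup>2 - lform b b * (lform a c)\<^sup>2 - lform c c * (lform a b)\<^sup>2"
proof -
  obtain a0 a1 a2 b0 b1 b2 c0 c1 c2 where "a = (a0, a1, a2)" "b = (b0, b1, b2)" "c = (c0, c1, c2)"
    by (metis surj_pair)
  then show ?thesis by (simp add: det3_def lform_def power2_eq_square algebra_simps)
qed

text \<open>The three linear forms in \<open>z\<close> are independent: the determinant of their
  coefficients is the Gram determinant of \<open>b\<close> and \<open>c\<close>.\<close>

lemma lform_nondegenerate:
  assumes "lform b z = 0" "lform c z = 0" "det3 b c z = 0" and "lform b b * lform c c \<noteq> (lform b c)\<^sup>2"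
  shows "z = 0"
proof -
  obtain b0 b1 b2 c0 c1 c2 z0 z1 z2 where e: "b = (b0, b1, b2)" "c = (c0, c1, c2)" "z = (z0, z1, z2)"
    by (metis surj_pair)
  have 1: "b0 * z0 + (- b1) * z1 + (- b2) * z2 = 0" "c0 * z0 + (- c1) * z1 + (- c2) * z2 = 0"
    using assms(1,2) by (simp_all add: e lform_def)
  have 2: "(b1 * c2 - b2 * c1) * z0 + (b2 * c0 - b0 * c2) * z1 + (b0 * c1 - b1 * c0) * z2 = 0"
    using assms(3) by (simp add: e det3_def algebra_simps)
  have "b0 * (- c1 * (b0 * c1 - b1 * c0) - - c2 * (b2 * c0 - b0 * c2)) - (- b1) * (c0 * (b0 * c1 - b1 * c0) - - c2 * (b1 * c2 - b2 * c1))
     + (- b2) * (c0 * (b2 * c0 - b0 * c2) - - c1 * (b1 * c2 - b2 * c1)) = lform b b * lform c c - (lform b c)\<^sup>2"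
    by (simp add: e lform_def power2_eq_square algebra_simps)
  then have D: "b0 * (- c1 * (b0 * c1 - b1 * c0) - - c2 * (b2 * c0 - b0 * c2)) - (- b1) * (c0 * (b0 * c1 - b1 * c0) - - c2 * (b1 * c2 - b2 * c1))
     + (- b2) * (c0 * (b2 * c0 - b0 * c2) - - c1 * (b1 * c2 - b2 * c1)) \<noteq> 0" using assms(4) by simp
  show ?thesis using cramer3_zero[OF 1 2 D] by (simp add: e zero_prod_def)
qed

text \<open>Four consecutive vertices of an equilateral equiangular chain form an isosceles trapezoid:
  in the hyperboloid model its parallel sides are proportional as vectors.\<close>

lemma regular_recurrence:
  assumes u: "lform a a = 1" "lform b b = 1" "lform c c = 1" "lform d d = 1"
    and C: "lform a b = C" "lform b c = C" "lform c d = C" "C > 1"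
    and B: "lform a c = B" "lform b d = B" and p: "det3 a b c > 0" "det3 b c d > 0"
  shows "d = a + ((B - C) / (C - 1)) *\<^sub>R (c - b)"
proof -
  \<comment> \<open>Pairing the claim with \<open>b\<close> forces this value: B = C + l (C -
    1).\<close>
  let ?l = "(B - C) / (C - 1)"
  have l: "?l * (C - 1) = B - C" using C(4) by simp
  \<comment> \<open>Both triples have the same Gram matrix entries up to reversal, so the
    determinants agree up to sign, and the common orientation fixes the sign.\<close>
  have "(det3 a b c)\<^sup>2 = (det3 b c d)\<^sup>2" unfolding det3_sq u C B by simp
  then have e: "det3 a b c = det3 b c d" using p by (simp add: power2_eq_iff_nonneg)
  define z where "z = a + ?l *\<^sub>R (c - b) - d"
  have "lform b z = C + ?l * (C - 1) - B"
    unfolding z_def lform_linear lform_commute[of b a] u C B by simp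
  then have 1: "lform b z = 0" unfolding l by simp
  have "lform c z = B - ?l * (C - 1) - C"
    unfolding z_def lform_linear lform_commute[of c a] lform_commute[of c b] u C B by (simp add: right_diff_distrib)
  then have 2: "lform c z = 0" unfolding l by simp
  have 3: "det3 b c z = 0" unfolding z_def det3_linear(1-3) using det3_linear(4)[of b c] det3_linear(5)[of b c] det3_linear(6)[of b c a] e by simp
  have "C\<^sup>2 > 1" using C(4) by (intro one_less_power) auto
  then have "lform b b * lform c c \<noteq> (lform b c)\<^sup>2" unfolding u C by simp
  then have "z = 0" using lform_nondegenerate 1 2 3 by blast
  then show ?thesis by (simp add: z_def)
qed

lemma det3_orient:
  "det3 (k, k * a $ 1, k * a $ 2) (l, l * b $ 1, l * b $ 2) (h, h * c $ 1, h * c $ 2) = k * l * h * orient a b c"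
  by (simp add: det3_def orient_def algebra_simps)

text \<open>For \<open>p\<close> in the plane this is a closed disc about \<open>p\<close>, as the
  condition bounds the cosh of the distance. It is convex because \<open>pairing p\<close> is affine
  while the root of \<open>pairing y y\<close> is concave by the reversed Cauchy-Schwarz
  inequality.\<close>

lemma convex_pairing_ball:
  assumes "k \<ge> 0"
  shows "convex {y \<in> H2. pairing p y \<le> k * sqrt (pairing y y)}"
  unfolding convex_alt
proof (intro ballI allI impI)
  fix x y and t :: real
  assume x: "x \<in> {y \<in> H2. pairing p y \<le> k * sqrt (pairing y y)}" and y: "y \<in> {y \<in> H2. pairing p y \<le> k * sqrt (pairing y y)}"
    and t: "0 \<le> t \<and> t \<le> 1"
  define z where "z = (1 - t) *\<^sub>R x + t *\<^sub>R y"
  have H: "x \<in> H2" "y \<in> H2" using x y by simp_all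
  have z: "z \<in> H2" unfolding z_def using H t by (intro H2_segment) simp_all
  define X Y where "X = sqrt (pairing x x)" and "Y = sqrt (pairing y y)"
  have px: "pairing p x \<le> k * X" "pairing p y \<le> k * Y" using x y by (simp_all add: X_def Y_def)
  note pos = pairing_pos[OF H(1,1)] pairing_pos[OF H(2,2)] pairing_pos[OF H]
  have X: "X\<^sup>2 = pairing x x" "Y\<^sup>2 = pairing y y" using pos(1,2) by (simp_all add: X_def Y_def)
  have "(X * Y)\<^sup>2 \<le> (pairing x y)\<^sup>2" unfolding power_mult_distrib X by (rule pairing_sq_ge[OF H])
  then have XY: "X * Y \<le> pairing x y" by (rule power2_le_imp_le) (use pos(3) in linarith)
  have "2 * (t * (1 - t)) * (X * Y) \<le> 2 * (t * (1 - t)) * pairing x y"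
    by (rule mult_left_mono[OF XY]) (use t in simp)
  moreover have "pairing z z = (1 - t)\<^sup>2 * pairing x x + 2 * (t * (1 - t)) * pairing x y + t\<^sup>2 * pairing y y"
    unfolding z_def pairing_coord by (simp add: power2_eq_square algebra_simps)
  ultimately have "(1 - t)\<^sup>2 * X\<^sup>2 + 2 * (t * (1 - t)) * (X * Y) + t\<^sup>2 * Y\<^sup>2 \<le> pairing z z"
    unfolding X by linarith
  moreover have "(1 - t)\<^sup>2 * X\<^sup>2 + 2 * (t * (1 - t)) * (X * Y) + t\<^sup>2 * Y\<^sup>2 = ((1 - t) * X + t * Y)\<^sup>2"
    by (simp add: power2_eq_square algebra_simps)
  ultimately have "(1 - t) * X + t * Y \<le> sqrt (pairing z z)" by (intro real_le_rsqrt) simp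
  then have "k * ((1 - t) * X + t * Y) \<le> k * sqrt (pairing z z)" by (rule mult_left_mono) (rule assms)
  moreover have "pairing p z \<le> (1 - t) * (k * X) + t * (k * Y)"
    unfolding z_def pairing_affine using px t by (intro add_mono mult_left_mono) simp_all
  ultimately have "pairing p z \<le> k * sqrt (pairing z z)" by (simp add: algebra_simps)
  then show "(1 - t) *\<^sub>R x + t *\<^sub>R y \<in> {y \<in> H2. pairing p y \<le> k * sqrt (pairing y y)}"
    using z by (simp add: z_def)
qed

lemma hdist_eqI:
  assumes "a \<in> H2" "b \<in> H2" "c \<in> H2" "d \<in> H2" "cosh (hdist a b) = cosh (hdist c d)"
  shows "hdist a b = hdist c d"
  using arg_cong[OF assms(5), of arcosh] hdist_nonneg[OF assms(1,2)] hdist_nonneg[OF assms(3,4)]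
  by (simp add: arcosh_cosh_real)

text \<open>Side-side-side congruence for mirror images: \<open>x\<close> corresponds to
  \<open>y'\<close> and \<open>y\<close> to \<open>x'\<close>.\<close>

lemma ang_eqI:
  assumes H: "p \<in> H2" "x \<in> H2" "y \<in> H2" "p' \<in> H2" "x' \<in> H2" "y' \<in> H2"
    and o: "orient p x y > 0" "orient p' x' y' > 0"
    and d: "hdist p x = hdist p' y'" "hdist p y = hdist p' x'" "hdist x y = hdist x' y'"
  shows "ang p x y = ang p' x' y'"
proof -
  have ne: "x \<noteq> p" "y \<noteq> p" "x' \<noteq> p'" "y' \<noteq> p'" using o by auto
  have "cos (ang p x y) = cos (ang p' x' y')"
    unfolding cos_ang[OF H(1-3) ne(1,2)] cos_ang[OF H(4-6) ne(3,4)] d by (simp add: mult.commute)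
  with ang_bounds_strict[OF H(1) o(1)] ang_bounds_strict[OF H(4) o(2)] show ?thesis
    using cos_inj_pi[of "ang p x y" "ang p' x' y'"] by linarith
qed

section \<open>Centre, circumradius and central angle of a regular polygon\<close>

locale regular_polygon = cyclic_polygon +
  fixes s \<alpha> :: real
  assumes side: "hdist (u i) (u (i + 1)) = s" and angle: "interior_angle i = \<alpha>"
begin

definition \<rho> :: "int \<Rightarrow> real" where "\<rho> i = sqrt (pairing (u i) (u i))"

text \<open>The vertex in the hyperboloid model.\<close>

definition lift :: "int \<Rightarrow> real \<times> real \<times> real" where
  "lift i = (1 / \<rho> i, 1 / \<rho> i * u i $ 1, 1 / \<rho> i * u i $ 2)"

lemma rho_pos: "\<rho> i > 0"
  using pairing_pos in_H2 by (simp add: \<rho>_def)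

lemma lform_lift: "lform (lift i) (lift k) = pairing (u i) (u k) / (\<rho> i * \<rho> k)"
  using rho_pos[of i] rho_pos[of k] by (simp add: lform_def lift_def pairing_coord field_simps)

lemma lform_lift_hdist: "lform (lift i) (lift k) = cosh (hdist (u i) (u k))"
  unfolding lform_lift cosh_hdist_pairing[OF in_H2 in_H2] by (simp add: \<rho>_def real_sqrt_mult)

lemma s_pos: "s > 0"
  using hdist_pos[OF in_H2 in_H2 neq[of 0 1]] side[of 0] n3 by simp

text \<open>By the law of cosines, the cosh of the shortest diagonal \<open>u i\<close>,
  \<open>u (i + 2)\<close>.\<close>

definition diagonal_form :: real where "diagonal_form = (cosh s)\<^sup>2 - (sinh s)\<^sup>2 * cos \<alpha>"

lemma lform_lift_2: "lform (lift i) (lift (i + 2)) = diagonal_form"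
proof -
  have ne: "u (i + 2) \<noteq> u (i + 1)" "u i \<noteq> u (i + 1)"
    using neq[of "i + 1" "i + 2"] neq[of i "i + 1"] n3 by auto
  have "cosh (hdist (u (i + 2)) (u i)) = cosh (hdist (u (i + 1)) (u (i + 2))) * cosh (hdist (u (i + 1)) (u i))
      - sinh (hdist (u (i + 1)) (u (i + 2))) * sinh (hdist (u (i + 1)) (u i)) * cos (ang (u (i + 1)) (u (i + 2)) (u i))"
    by (rule cosh_law[OF in_H2 in_H2 in_H2 ne])
  moreover have "ang (u (i + 1)) (u (i + 2)) (u i) = \<alpha>"
    using angle[of "i + 1"] by (simp add: interior_angle_def add.assoc)
  moreover have "hdist (u (i + 1)) (u (i + 2)) = s" using side[of "i + 1"] by (simp add: add.assoc)
  moreover have "hdist (u (i + 1)) (u i) = s" using side[of i] by (simp add: hdist_commute)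
  ultimately show ?thesis unfolding lform_lift_hdist diagonal_form_def by (simp add: hdist_commute power2_eq_square)
qed

definition trapezoid_ratio :: real where "trapezoid_ratio = (diagonal_form - cosh s) / (cosh s - 1)"

lemma lift_recurrence: "lift (i + 3) = lift i + trapezoid_ratio *\<^sub>R (lift (i + 2) - lift (i + 1))"
  unfolding trapezoid_ratio_def
proof (rule regular_recurrence)
  have unit: "lform (lift k) (lift k) = 1" for k using in_H2 by (simp add: lform_lift_hdist)
  show "lform (lift i) (lift i) = 1" "lform (lift (i + 1)) (lift (i + 1)) = 1" "lform (lift (i + 2)) (lift (i + 2)) = 1"
    "lform (lift (i + 3)) (lift (i + 3)) = 1" by (rule unit)+
  show "lform (lift i) (lift (i + 1)) = cosh s" "lform (lift (i + 1)) (lift (i + 2)) = cosh s"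
    "lform (lift (i + 2)) (lift (i + 3)) = cosh s"
    unfolding lform_lift_hdist using side[of i] side[of "i + 1"] side[of "i + 2"]
    by (simp_all only: add.assoc one_add_one arith_special semiring_norm)
  show "1 < cosh s" using cosh_real_strict_mono[of 0 s] s_pos by simp
  show "lform (lift i) (lift (i + 2)) = diagonal_form" by (rule lform_lift_2)
  show "lform (lift (i + 1)) (lift (i + 3)) = diagonal_form" using lform_lift_2[of "i + 1"] by (simp add: add.assoc)
  have "orient (u k) (u (k + 1)) (u (k + 2)) > 0" for k using n3 by (intro orient_pos) auto
  then have d: "det3 (lift k) (lift (k + 1)) (lift (k + 2)) > 0" for k
    unfolding lift_def det3_orient using rho_pos by simp
  show "0 < det3 (lift i) (lift (i + 1)) (lift (i + 2))" by (rule d)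
  show "0 < det3 (lift (i + 1)) (lift (i + 2)) (lift (i + 3))" using d[of "i + 1"] by (simp add: add.assoc)
qed

text \<open>By the constant-coefficient recurrence, all distances depend on the index difference only;
  therefore the sum of the lifted vertices has the same product with each of them.\<close>

lemma lform_lift_shift: "lform (lift i) (lift (i + int k)) = lform (lift 0) (lift (int k))"
proof (induction k rule: less_induct)
  case (less k)
  consider "k = 0" | "k = 1" | "k = 2" | "k \<ge> 3" by linarith
  then show ?case
  proof cases
    case 1 then show ?thesis using in_H2 by (simp add: lform_lift_hdist)
  next
    case 2 then show ?thesis using side[of i] side[of 0] by (simp add: lform_lift_hdist)
  next
    case 3 then show ?thesis using lform_lift_2[of i] lform_lift_2[of 0] by simp
  next
    case 4
    have e: "lform (lift i) (lift (i + int k)) = lform (lift i) (lift (i + int (k - 3))) +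
       trapezoid_ratio * (lform (lift i) (lift (i + int (k - 1))) - lform (lift i) (lift (i + int (k - 2))))" for i
    proof -
      have a: "i + int k = i + int (k - 3) + 3" "i + int (k - 3) + 2 = i + int (k - 1)" "i + int (k - 3) + 1 = i + int (k - 2)"
        using 4 by auto
      show ?thesis unfolding a(1) lift_recurrence a(2,3) lform_linear ..
    qed
    have lt: "k - 3 < k" "k - 2 < k" "k - 1 < k" using 4 by auto
    show ?thesis unfolding e[of i] less.IH[OF lt(1)] less.IH[OF lt(2)] less.IH[OF lt(3)] e[of 0, unfolded add_0] ..
  qed
qed

definition weight :: "int \<Rightarrow> real" where
  "weight i = 1 / \<rho> i / (\<Sum>k\<in>{0..<int n}. 1 / \<rho> k)"

text \<open>The sum of the lifted vertices, projected back to the disc: weights proportional to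
  \<open>1 / \<rho> k\<close> make it a Euclidean convex combination of the vertices.\<close>

definition centre :: "real ^ 2" where
  "centre = (\<Sum>k\<in>{0..<int n}. weight k *\<^sub>R u k)"

lemma weight_total_pos: "(\<Sum>k\<in>{0..<int n}. 1 / \<rho> k) > 0"
  using n3 rho_pos by (intro sum_pos) auto

lemma weight_pos: "weight i > 0"
  using weight_total_pos rho_pos by (simp add: weight_def)

lemma weight_sum: "(\<Sum>k\<in>{0..<int n}. weight k) = 1"
  unfolding weight_def sum_divide_distrib[symmetric] using weight_total_pos by simp

lemma centre_in_body: "centre \<in> body"
  unfolding centre_def body_def using weight_pos weight_sum
  by (intro convex_sum) (auto simp: hull_inc intro: less_imp_le)

lemma centre_H2: "centre \<in> H2"
  using centre_in_body body_H2 by blast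

lemma pairing_centre: "pairing centre x = (\<Sum>k\<in>{0..<int n}. weight k * pairing (u k) x)"
proof -
  have "(\<Sum>k\<in>{0..<int n}. weight k * pairing (u k) x) = (\<Sum>k\<in>{0..<int n}. weight k) - (\<Sum>k\<in>{0..<int n}. weight k * (u k \<bullet> x))"
    by (simp add: pairing_def right_diff_distrib sum_subtractf)
  then show ?thesis by (simp add: weight_sum pairing_def centre_def inner_sum_left)
qed

lemma orient_centre: "orient (u i) (u (i + 1)) centre = (\<Sum>k\<in>{0..<int n}. weight k * orient (u i) (u (i + 1)) (u k))"
proof -
  have e: "orient a b x = (b $ 1 - a $ 1) * x $ 2 - (b $ 2 - a $ 2) * x $ 1 - ((b $ 1 - a $ 1) * a $ 2 - (b $ 2 - a $ 2) * a $ 1)" for a b x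
    by (simp add: orient_def algebra_simps)
  let ?a = "u i" and ?b = "u (i + 1)"
  have "(\<Sum>k\<in>{0..<int n}. weight k * orient ?a ?b (u k)) =
     (\<Sum>k\<in>{0..<int n}. (?b $ 1 - ?a $ 1) * (weight k * u k $ 2) - (?b $ 2 - ?a $ 2) * (weight k * u k $ 1)
        - weight k * ((?b $ 1 - ?a $ 1) * ?a $ 2 - (?b $ 2 - ?a $ 2) * ?a $ 1))"
    unfolding e[of ?a ?b] by (simp add: algebra_simps)
  also have "\<dots> = (?b $ 1 - ?a $ 1) * (\<Sum>k\<in>{0..<int n}. weight k * u k $ 2) - (?b $ 2 - ?a $ 2) * (\<Sum>k\<in>{0..<int n}. weight k * u k $ 1)
     - (\<Sum>k\<in>{0..<int n}. weight k) * ((?b $ 1 - ?a $ 1) * ?a $ 2 - (?b $ 2 - ?a $ 2) * ?a $ 1)"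
    by (simp only: sum_subtractf sum_distrib_left sum_distrib_right)
  also have "\<dots> = orient ?a ?b centre"
    unfolding e[of ?a ?b] weight_sum by (simp add: centre_def)
  finally show ?thesis ..
qed

lemma orient_centre_pos: "orient (u i) (u (i + 1)) centre > 0"
proof -
  let ?k = "(i + 2) mod int n"
  have "u ?k = u (i + 2)" using periodic_mult[of ?k "(i + 2) div int n"] by (simp add: mult.commute)
  then have "orient (u i) (u (i + 1)) (u ?k) > 0" using n3 by (auto intro!: orient_pos)
  then show ?thesis unfolding orient_centre using weight_pos edge_nonneg n3
    by (intro sum_pos2[where i = ?k]) (auto intro: less_imp_le mult_nonneg_nonneg)
qed

text \<open>Equidistance of the vertices from the centre in unnormalised form; the multiplier is a
  sum of Lorentz products that index shifts leave unchanged.\<close>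

lemma pairing_centre_vertex:
  obtains k where "k > 0" "\<And>i. pairing centre (u i) = k * \<rho> i"
proof
  let ?W = "\<Sum>k\<in>{0..<int n}. 1 / \<rho> k"
  let ?k = "(\<Sum>k\<in>{0..<int n}. lform (lift 0) (lift k)) / ?W"
  show eq: "pairing centre (u i) = ?k * \<rho> i" for i
  proof -
    have "pairing centre (u i) = (\<Sum>k\<in>{0..<int n}. lform (lift i) (lift k) * (\<rho> i / ?W))"
      unfolding pairing_centre
    proof (rule sum.cong[OF refl])
      fix k
      show "weight k * pairing (u k) (u i) = lform (lift i) (lift k) * (\<rho> i / ?W)"
        unfolding weight_def lform_lift using rho_pos[of i] rho_pos[of k] by (simp add: pairing_commute)
    qed
    also have "\<dots> = (\<Sum>k\<in>{0..<int n}. lform (lift i) (lift k)) * (\<rho> i / ?W)" by (rule sum_distrib_right[symmetric])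
    also have "(\<Sum>k\<in>{0..<int n}. lform (lift i) (lift k)) = (\<Sum>k\<in>{0..<int n}. lform (lift i) (lift (k + i)))"
      using n3 periodic by (intro sum_periodic_shift[symmetric]) (auto simp: lift_def \<rho>_def)
    also have "\<dots> = (\<Sum>k\<in>{0..<int n}. lform (lift 0) (lift k))"
    proof (rule sum.cong[OF refl])
      fix k assume "k \<in> {0..<int n}"
      then have "int (nat k) = k" by simp
      then show "lform (lift i) (lift (k + i)) = lform (lift 0) (lift k)"
        using lform_lift_shift[of i "nat k"] by (simp add: add.commute)
    qed
    finally show ?thesis by simp
  qed
  have "pairing centre (u 0) > 0" using pairing_pos centre_H2 in_H2 by blast
  then have "0 < ?k * \<rho> 0" unfolding eq .
  then show "0 < ?k" by (rule zero_less_mult_pos2) (rule rho_pos)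
qed

lemma hdist_centre: "hdist centre (u i) = hdist centre (u k)"
proof -
  obtain K where K: "\<And>i. pairing centre (u i) = K * \<rho> i" using pairing_centre_vertex by blast
  have "cosh (hdist centre (u i)) = K / sqrt (pairing centre centre)" for i
    unfolding cosh_hdist_pairing[OF centre_H2 in_H2] K using rho_pos[of i] by (simp add: \<rho>_def real_sqrt_mult)
  then show ?thesis using centre_H2 in_H2 by (intro hdist_eqI) auto
qed

text \<open>The circumscribed disc is convex and contains the vertices.\<close>

lemma hdist_centre_body:
  assumes "y \<in> body"
  shows "hdist centre y \<le> hdist centre (u i)"
proof -
  obtain K where K: "K > 0" "\<And>i. pairing centre (u i) = K * \<rho> i" using pairing_centre_vertex by blast
  have "body \<subseteq> {y \<in> H2. pairing centre y \<le> K * sqrt (pairing y y)}"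
    unfolding body_def using in_H2 K by (intro hull_minimal convex_pairing_ball) (auto simp: \<rho>_def)
  then have y: "y \<in> H2" "pairing centre y \<le> K * sqrt (pairing y y)" using assms by auto
  have p: "sqrt (pairing y y) > 0" "sqrt (pairing centre centre) > 0" using pairing_pos y centre_H2 by auto
  have "cosh (hdist centre y) = pairing centre y / (sqrt (pairing centre centre) * sqrt (pairing y y))"
    unfolding cosh_hdist_pairing[OF centre_H2 y(1)] by (simp add: real_sqrt_mult)
  also have "\<dots> \<le> K * sqrt (pairing y y) / (sqrt (pairing centre centre) * sqrt (pairing y y))"
    using y p by (intro divide_right_mono) auto
  also have "\<dots> = K / sqrt (pairing centre centre)" using p by simp
  also have "\<dots> = cosh (hdist centre (u i))"
    unfolding cosh_hdist_pairing[OF centre_H2 in_H2] K using rho_pos[of i] by (simp add: \<rho>_def real_sqrt_mult)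
  finally show ?thesis using hdist_nonneg centre_H2 y in_H2
    by (subst (asm) cosh_real_nonneg_le_iff) auto
qed

definition central_angle :: real where "central_angle = ang centre (u 0) (u 1)"

lemma central_angle: "ang centre (u i) (u (i + 1)) = central_angle"
proof -
  have o: "orient centre (u i) (u (i + 1)) > 0" for i using orient_centre_pos[of i] orient_cycle by metis
  have "ang centre (u i) (u (i + 1)) = ang centre (u 0) (u (0 + 1))"
    by (rule ang_eqI[OF centre_H2 in_H2 in_H2 centre_H2 in_H2 in_H2 o o hdist_centre hdist_centre]) (simp only: side)
  then show ?thesis by (simp add: central_angle_def)
qed

lemma central_angle_bounds: "0 < central_angle" "central_angle < pi"
  unfolding central_angle_def using orient_centre_pos[of 0] ang_bounds_strict[OF centre_H2, of "u 0" "u 1"] orient_cycle[of centre "u 0" "u 1"] orient_cycle[of "u 1" centre "u 0"] by auto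

lemma vertex_neq_centre: "u i \<noteq> centre"
  using orient_centre_pos[of i] by auto

text \<open>The turns around the centre multiply to a positive number, so the central angles add up to a
  positive multiple of \<open>2 \<pi>\<close>.\<close>

lemma central_angle_ge: "2 * pi / real n \<le> central_angle"
proof -
  have sq0: "(pairing centre (u 0))\<^sup>2 - pairing centre centre * pairing (u 0) (u 0) > 0"
    using pairing_sq_gt[OF centre_H2 in_H2[of 0]] vertex_neq_centre[of 0] by auto
  \<comment> \<open>The accumulated angle is kept inside \<open>cis\<close>, since an argument would
    be reduced modulo 2 \<pi> along the way.\<close>
  have "\<exists>r>0. turn centre (u 0) (u (int k)) = of_real r * cis (real k * central_angle)" for k
  proof (induction k)
    case 0
    show ?case using sq0 by (intro exI[of _ "(pairing centre (u 0))\<^sup>2 - pairing centre centre * pairing (u 0) (u 0)"])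
      (simp add: turn_self)
  next
    case (Suc k)
    then obtain r where r: "r > 0" "turn centre (u 0) (u (int k)) = of_real r * cis (real k * central_angle)" by blast
    let ?c = "(pairing centre (u (int k)))\<^sup>2 - pairing centre centre * pairing (u (int k)) (u (int k))"
    have c: "?c > 0" using pairing_sq_gt[OF centre_H2 in_H2[of "int k"]] vertex_neq_centre[of "int k"] by auto
    let ?t = "turn centre (u (int k)) (u (int k + 1))"
    have nz: "?t \<noteq> 0" using turn_nonzero centre_H2 in_H2 vertex_neq_centre by blast
    have t: "?t = of_real (cmod ?t) * cis central_angle"
      using rcis_cmod_Arg[of ?t] central_angle[of "int k"] by (simp add: ang_def rcis_def)
    have "of_real ?c * turn centre (u 0) (u (int k + 1)) = turn centre (u 0) (u (int k)) * ?t"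
      by (rule turn_mult[OF centre_H2, symmetric])
    also have "\<dots> = of_real (r * cmod ?t) * cis (real (Suc k) * central_angle)"
      unfolding r(2) by (subst t) (simp add: cis_mult algebra_simps)
    finally have e: "of_real ?c * turn centre (u 0) (u (int k + 1)) = of_real (r * cmod ?t) * cis (real (Suc k) * central_angle)" .
    have "X = of_real (q / c) * Z" if "of_real c * X = of_real q * Z" "c > 0" for c q :: real and X Z :: complex
      using that by (simp add: eq_divide_eq mult.commute)
    from this[OF e c] have "turn centre (u 0) (u (int (Suc k))) = of_real (r * cmod ?t / ?c) * cis (real (Suc k) * central_angle)"
      by (simp only: of_nat_Suc add.commute[of 1])
    moreover have "r * cmod ?t / ?c > 0" using r c nz by simp
    ultimately show ?case by blast
  qed
  from this[of n] obtain r where r: "r > 0" "turn centre (u 0) (u (int n)) = of_real r * cis (real n * central_angle)" by blast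
  have "u (int n) = u 0" using periodic[of 0] by simp
  then have "turn centre (u 0) (u (int n)) = of_real ((pairing centre (u 0))\<^sup>2 - pairing centre centre * pairing (u 0) (u 0))"
    by (simp only: turn_self)
  with sq0 have "r * cos (real n * central_angle) > 0" "r * sin (real n * central_angle) = 0"
    using r(2) by (auto simp: complex_eq_iff)
  then have sc: "cos (real n * central_angle) > 0" "sin (real n * central_angle) = 0"
    using r(1) by (auto simp: zero_less_mult_iff)
  have "(cos (real n * central_angle))\<^sup>2 = 1" using sc(2) by (simp add: cos_squared_eq)
  then have "cos (real n * central_angle) = 1" using sc(1) by (simp add: power2_eq_1_iff)
  then obtain j :: int where j: "real n * central_angle = of_int j * 2 * pi" using cos_one_2pi_int by blast
  have "real n * central_angle > 0" using central_angle_bounds n3 by simp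
  \<comment> \<open>The winding number enters only through its lower bound 1.\<close>
  then have "j > 0" unfolding j using pi_gt_zero by (simp add: zero_less_mult_iff)
  then have "of_int j * 2 * pi \<ge> 1 * 2 * pi" by (intro mult_right_mono) auto
  then have "2 * pi \<le> real n * central_angle" unfolding j by simp
  then show ?thesis using n3 by (simp add: field_simps)
qed

text \<open>The triangle of \<open>u 0\<close>, the midpoint \<open>x\<close> of a side and the
  centre is right-angled at \<open>x\<close>, with half the interior angle at \<open>u 0\<close> and
  half the central angle at the centre. Its sides \<open>b\<close> and \<open>c\<close> are inradius
  and circumradius. The last two claims are what bounds the minimal width by
  \<open>b + c\<close>.\<close>

theorem regular_half_angle:
  obtains b c \<eta> x where "0 < b" "0 < c" "0 < \<eta>" "\<eta> < pi / 4"
    "pi / (2 * real n) \<le> half_apex (tanh ((b + c) / 2)) \<eta>"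
    "harea body = 4 * (real n * \<eta>) - 2 * pi"
    "x \<in> closed_segment (u 0) (u 1)" "\<And>y. y \<in> body \<Longrightarrow> hdist x y \<le> b + c"
proof -
  obtain K where K: "K > 0" "\<And>i. pairing centre (u i) = K * \<rho> i" using pairing_centre_vertex by blast
  define C where "C = cosh s"
  have rho: "\<rho> 0 > 0" "\<rho> 1 > 0" by (rule rho_pos)+
  have rr: "pairing (u 0) (u 0) = \<rho> 0 * \<rho> 0" "pairing (u 1) (u 1) = \<rho> 1 * \<rho> 1"
    using pairing_pos[OF in_H2[of 0] in_H2[of 0]] pairing_pos[OF in_H2[of 1] in_H2[of 1]] by (simp_all add: \<rho>_def)
  have c01: "pairing (u 0) (u 1) = C * (\<rho> 0 * \<rho> 1)"
    using cosh_hdist_pairing[OF in_H2[of 0] in_H2[of 1]] side[of 0] rho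
    by (simp add: C_def \<rho>_def real_sqrt_mult)
  \<comment> \<open>The hyperbolic midpoint of the side is the sum of its lifted ends, so the disc
    weights are inversely proportional to \<open>\<rho>\<close>.\<close>
  define t where "t = \<rho> 0 / (\<rho> 0 + \<rho> 1)"
  define q where "q = \<rho> 0 * \<rho> 1 / (\<rho> 0 + \<rho> 1)"
  have t: "0 < t" "t < 1" using rho by (simp_all add: t_def)
  have "1 - t = \<rho> 1 / (\<rho> 0 + \<rho> 1)" using rho by (simp add: t_def diff_divide_eq_iff)
  then have t1: "1 - t = q / \<rho> 0" "t = q / \<rho> 1" using rho by (simp_all add: t_def q_def)
  have q: "q > 0" using rho by (simp add: q_def)
  define x where "x = (1 - t) *\<^sub>R u 0 + t *\<^sub>R u 1"
  have xH: "x \<in> H2" unfolding x_def using t in_H2 by (intro H2_segment) auto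
  have px: "pairing p x = q * (pairing p (u 0) / \<rho> 0 + pairing p (u 1) / \<rho> 1)" for p
    unfolding x_def pairing_affine unfolding t1(1) unfolding t1(2) by (simp add: distrib_left)
  have x0: "pairing (u 0) x = q * ((1 + C) * \<rho> 0)"
    unfolding px rr c01 using rho by (simp add: distrib_right)
  have x1: "pairing (u 1) x = q * ((1 + C) * \<rho> 1)"
    unfolding px rr pairing_commute[of "u 1" "u 0"] c01 using rho by (simp add: distrib_right add.commute)
  have xo: "pairing centre x = q * (2 * K)" unfolding px K using rho by simp
  have xx: "pairing x x = q * (q * (2 * (1 + C)))"
    unfolding px[of x] pairing_commute[of x "u _"] x0 x1 using rho by simp
  have right: "Re (turn x (u 0) centre) = 0"
    unfolding turn_def complex.sel pairing_commute[of x "u 0"] pairing_commute[of x centre] pairing_commute[of "u 0" centre]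
      x0 xo xx K by (simp add: algebra_simps)
  have d01: "hdist (u 0) x = hdist x (u 1)"
  proof (intro hdist_eqI in_H2 xH)
    have "cosh (hdist (u 0) x) = q * (1 + C) / sqrt (pairing x x)"
      unfolding cosh_hdist_pairing[OF in_H2 xH] x0 using rho by (simp add: real_sqrt_mult \<rho>_def)
    moreover have "cosh (hdist x (u 1)) = q * (1 + C) / sqrt (pairing x x)"
      unfolding cosh_hdist_pairing[OF xH in_H2] pairing_commute[of x "u 1"] x1 using rho by (simp add: real_sqrt_mult \<rho>_def)
    ultimately show "cosh (hdist (u 0) x) = cosh (hdist x (u 1))" by simp
  qed
  have o0: "orient (u 0) (u 1) centre > 0" using orient_centre_pos[of 0] by simp
  have ox: "orient (u 0) x centre = t * orient (u 0) (u 1) centre" "orient x (u 1) centre = (1 - t) * orient (u 0) (u 1) centre"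
    unfolding x_def by (simp_all add: orient_def algebra_simps)
  have ox': "orient (u 0) x centre > 0" "orient x (u 1) centre > 0" unfolding ox using o0 t by simp_all
  have ox2: "orient centre (u 0) x > 0" "orient centre x (u 1) > 0" "orient centre (u 0) (u 1) > 0"
    using ox' o0 orient_cycle by metis+
  have ne: "x \<noteq> centre" "u 0 \<noteq> centre" "u 1 \<noteq> centre" "u 1 \<noteq> u 0" "centre \<noteq> u 0" using ox2 by auto
  have "ang centre (u 0) x = ang centre x (u 1)"
    by (rule ang_eqI[OF centre_H2 in_H2 xH centre_H2 xH in_H2 ox2(1,2) hdist_centre refl d01])
  moreover have "ang centre (u 0) x + ang centre x (u 1) = ang centre (u 0) (u 1)"
    using ox2 central_angle_bounds(1) ne centre_H2 xH in_H2
    by (intro ang_add) (auto simp: central_angle_def)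
  ultimately have psi: "ang centre (u 0) x = central_angle / 2" by (simp add: central_angle_def)
  have per: "u (- 1) = u (int n - 1)" using periodic[of "-1"] by (simp add: add.commute)
  have o1: "orient (u 0) centre (u (- 1)) > 0"
    using orient_centre_pos[of "-1"] orient_cycle[of "u 0" centre "u (-1)"] orient_cycle[of centre "u (-1)" "u 0"] by simp
  have "ang (u 0) (u 1) centre = ang (u 0) centre (u (- 1))"
  proof (rule ang_eqI[OF in_H2 in_H2 centre_H2 in_H2 centre_H2 in_H2 o0 o1])
    show "hdist (u 0) (u 1) = hdist (u 0) (u (- 1))" using side[of 0] side[of "-1"] by (simp add: hdist_commute)
    show "hdist (u 1) centre = hdist centre (u (- 1))" using hdist_centre[of 1 "-1"] by (simp add: hdist_commute)
  qed simp
  moreover have "ang (u 0) (u 1) centre + ang (u 0) centre (u (- 1)) = ang (u 0) (u 1) (u (- 1))"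
  proof (rule ang_add)
    show "0 < ang (u 0) (u 1) (u (- 1))" using interior_angle_pos[of 0] by (simp add: interior_angle_def)
    show "u (- 1) \<noteq> u 0" using neq[of "-1" 0] n3 by simp
  qed (use o0 o1 ne in_H2 centre_H2 in auto)
  moreover have "ang (u 0) (u 1) (u (- 1)) = \<alpha>" using angle[of 0] by (simp add: interior_angle_def)
  moreover have "ang (u 0) x centre = ang (u 0) (u 1) centre"
    by (rule ang_scale[where k = t and l = 1]) (use t in \<open>auto simp: x_def algebra_simps\<close>)
  ultimately have phi: "ang (u 0) x centre = \<alpha> / 2" by simp
  have pb: "0 < \<alpha> / 2" "\<alpha> / 2 < pi" unfolding phi[symmetric] using ang_bounds_strict[OF in_H2 ox'(1)] by auto
  have sb: "0 < central_angle / 2" "central_angle / 2 < pi" using central_angle_bounds by auto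
  have on: "orient (u 0) x centre \<noteq> 0" using ox' by simp
  note R = right_triangle[OF in_H2 xH centre_H2 on right pb arg_cong[OF phi[symmetric]] sb arg_cong[OF psi[symmetric]]]
  define b c where "b = hdist centre x" and "c = hdist centre (u 0)"
  have H: "central_angle / 2 / 2 = half_apex (tanh ((b + c) / 2)) (pi / 4 - \<alpha> / 2 / 2)"
    unfolding b_def c_def by (rule half_apex_right_triangle[OF R(1,2) pb(1) R(3) sb(1) R(4,5,6)])
  show ?thesis
  proof
    show "0 < b" "0 < c" using R(1,2) by (simp_all add: b_def c_def)
    show "0 < pi / 4 - \<alpha> / 2 / 2" "pi / 4 - \<alpha> / 2 / 2 < pi / 4" using pb R(3) by simp_all
    show "pi / (2 * real n) \<le> half_apex (tanh ((b + c) / 2)) (pi / 4 - \<alpha> / 2 / 2)"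
      unfolding H[symmetric] using central_angle_ge by simp
    show "harea body = 4 * (real n * (pi / 4 - \<alpha> / 2 / 2)) - 2 * pi"
      unfolding harea_polygon angle by (simp add: algebra_simps)
    show "x \<in> closed_segment (u 0) (u 1)" using t unfolding in_segment x_def by (intro exI[of _ t]) auto
    fix y assume "y \<in> body"
    then have "hdist x y \<le> hdist x centre + hdist centre y"
      using body_H2 centre_H2 xH by (intro hdist_triangle) auto
    then show "hdist x y \<le> b + c" using hdist_centre_body[OF \<open>y \<in> body\<close>, of 0] by (simp add: b_def c_def hdist_commute)
  qed
qed

end

section \<open>Sides, vertices and width\<close>

lemma supporting_line_subset: "supporting_line K l \<Longrightarrow> l \<subseteq> H2"
  by (auto simp: supporting_line_def)

lemma hsetdist_le:
  assumes "l \<subseteq> H2" "l' \<subseteq> H2" "x \<in> l" "y \<in> l'"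
  shows "hsetdist l l' \<le> hdist x y"
proof -
  have "(INF (x, y)\<in>l \<times> l'. hdist x y) \<le> (case (x, y) of (x, y) \<Rightarrow> hdist x y)"
    using assms hdist_nonneg by (intro cINF_lower bdd_belowI2[where m = 0]) auto
  then show ?thesis by (simp add: hsetdist_def)
qed

text \<open>Every other supporting line contains a point of \<open>K\<close>, and this point is
  within \<open>h\<close> of \<open>x\<close>; hence the width with respect to \<open>l\<close> is
  at most \<open>h\<close>.\<close>

lemma minimal_width_le:
  assumes K: "K \<subseteq> H2" and l: "supporting_line K l" and x: "x \<in> l" and h: "\<And>y. y \<in> K \<Longrightarrow> hdist x y \<le> h"
  shows "minimal_width K \<le> h"
proof -
  have xH: "x \<in> H2" using supporting_line_subset[OF l] x by blast
  have le: "hsetdist l1 l2 \<le> hdist y1 y2" if "supporting_line K l1" "supporting_line K l2" "y1 \<in> l1" "y2 \<in> l2" for l1 l2 y1 y2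
    using that supporting_line_subset by (intro hsetdist_le) auto
  \<comment> \<open>Real suprema and infima obey the expected rules only for bounded families; this
    supplies the boundedness.\<close>
  have bound: "hsetdist l1 l2 \<le> h + h" if l12: "supporting_line K l1" "supporting_line K l2" for l1 l2
  proof -
    obtain y1 y2 where y: "y1 \<in> K" "y1 \<in> l1" "y2 \<in> K" "y2 \<in> l2"
      using l12 unfolding supporting_line_def by blast
    have "hsetdist l1 l2 \<le> hdist y1 y2" using le l12 y by blast
    also have "\<dots> \<le> hdist y1 x + hdist x y2" using K y xH by (intro hdist_triangle) auto
    also have "\<dots> \<le> h + h" using h y by (intro add_mono) (auto simp: hdist_commute[of y1])
    finally show ?thesis .
  qed
  have "hwidth K l1 \<ge> 0" if l1: "supporting_line K l1" for l1
  proof -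
    have "0 \<le> hsetdist l1 l1"
      unfolding hsetdist_def using l1 supporting_line_subset[OF l1] hdist_nonneg
      by (intro cINF_greatest) (auto simp: supporting_line_def)
    also have "\<dots> \<le> hwidth K l1"
      unfolding hwidth_def using l1 bound[OF l1] by (intro cSUP_upper bdd_aboveI2[where M = "h + h"]) auto
    finally show ?thesis .
  qed
  then have "minimal_width K \<le> hwidth K l"
    unfolding minimal_width_def using l by (intro cINF_lower bdd_belowI2[where m = 0]) auto
  also have "\<dots> \<le> h"
    unfolding hwidth_def
  proof (rule cSUP_least)
    fix l' assume "l' \<in> {l'. supporting_line K l'}"
    then have l': "supporting_line K l'" by simp
    then obtain y where y: "y \<in> K" "y \<in> l'" unfolding supporting_line_def by blast
    have "hsetdist l l' \<le> hdist x y" using le[OF l l' x y(2)] .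
    also have "\<dots> \<le> h" by (rule h[OF y(1)])
    finally show "hsetdist l l' \<le> h" .
  qed (use l in auto)
  finally show ?thesis .
qed

lemma hline_mem: "p \<in> H2 \<Longrightarrow> p \<in> hline p q" "q \<in> H2 \<Longrightarrow> q \<in> hline p q"
  by (simp_all add: hline_def hull_inc)

lemma closed_segment_subset_hline:
  assumes "p \<in> H2" "q \<in> H2"
  shows "closed_segment p q \<subseteq> hline p q"
proof -
  have "closed_segment p q \<subseteq> affine hull {p, q}"
    unfolding segment_convex_hull by (rule convex_hull_subset_affine_hull)
  moreover have "closed_segment p q \<subseteq> H2" using assms unfolding H2_def by (simp add: closed_segment_subset)
  ultimately show ?thesis by (simp add: hline_def)
qed

text \<open>The normal \<open>a\<close> is orthogonal to \<open>q - p\<close>, so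
  \<open>a \<bullet> x - b\<close> is a nonzero constant multiple of
  \<open>orient p q x\<close>.\<close>

lemma supporting_line_orient:
  assumes sl: "supporting_line K (hline p q)" and H: "p \<in> H2" "q \<in> H2" and ne: "p \<noteq> q"
  shows "(\<forall>x\<in>K. orient p q x \<ge> 0) \<or> (\<forall>x\<in>K. orient p q x \<le> 0)"
proof -
  obtain a b where l: "hline p q = {x \<in> H2. a \<bullet> x = b}" and a: "a \<noteq> 0" and K: "K \<subseteq> {x \<in> H2. a \<bullet> x \<le> b}"
    using sl unfolding supporting_line_def by blast
  have "p \<in> hline p q" "q \<in> hline p q" using hline_mem H by simp_all
  then have "a \<bullet> p = b" "a \<bullet> q = b" unfolding l by simp_all
  then have ap: "a $ 1 * p $ 1 + a $ 2 * p $ 2 = b" "a $ 1 * q $ 1 + a $ 2 * q $ 2 = b"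
    by (simp_all add: inner_vec_def sum_2)
  define d1 d2 where "d1 = q $ 1 - p $ 1" and "d2 = q $ 2 - p $ 2"
  have d: "a $ 1 * d1 + a $ 2 * d2 = 0" using ap by (simp add: d1_def d2_def algebra_simps)
  have "d1 \<noteq> 0 \<or> d2 \<noteq> 0" using ne by (auto simp: d1_def d2_def vec_eq_iff forall_2)
  then have dd: "d1 * d1 + d2 * d2 > 0" by (auto simp: sum_squares_gt_zero_iff)
  define k where "k = a $ 2 * d1 - a $ 1 * d2"
  have key: "(a $ 1 * e1 + a $ 2 * e2) * (d1 * d1 + d2 * d2) = k * (d1 * e2 - d2 * e1)" for e1 e2
  proof -
    have "(a $ 1 * e1 + a $ 2 * e2) * (d1 * d1 + d2 * d2) = k * (d1 * e2 - d2 * e1) + (a $ 1 * d1 + a $ 2 * d2) * (d1 * e1 + d2 * e2)"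
      by (simp add: k_def algebra_simps)
    then show ?thesis by (simp add: d)
  qed
  have "a \<bullet> x - b = a $ 1 * (x $ 1 - p $ 1) + a $ 2 * (x $ 2 - p $ 2)" for x
    using ap by (simp add: inner_vec_def sum_2 algebra_simps)
  then have ax: "(a \<bullet> x - b) * (d1 * d1 + d2 * d2) = k * orient p q x" for x
    using key by (simp add: orient_def d1_def d2_def)
  have kx: "k * orient p q x \<le> 0" if "x \<in> K" for x
  proof -
    have "a \<bullet> x - b \<le> 0" using K that by auto
    then show ?thesis unfolding ax[symmetric] using dd by (intro mult_nonpos_nonneg) auto
  qed
  have "k \<noteq> 0"
  proof
    assume "k = 0"
    then have "a $ 1 * e1 + a $ 2 * e2 = 0" for e1 e2 using key[of e1 e2] dd by auto
    from this[of 1 0] this[of 0 1] have "a = 0" by (simp add: vec_eq_iff forall_2)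
    then show False using a by simp
  qed
  then show ?thesis using kx by (cases "k > 0") (auto simp: mult_le_0_iff)
qed

lemma orient_zero_collinear:
  assumes "orient p q x = 0" "p \<noteq> q"
  shows "collinear {p, x, q}"
proof -
  define d1 d2 e1 e2 where "d1 = q $ 1 - p $ 1" and "d2 = q $ 2 - p $ 2" and "e1 = x $ 1 - p $ 1" and "e2 = x $ 2 - p $ 2"
  note defs = d1_def d2_def e1_def e2_def
  have o: "d1 * e2 = d2 * e1" using assms(1) by (simp add: orient_def defs)
  have "d1 \<noteq> 0 \<or> d2 \<noteq> 0" using assms(2) by (auto simp: defs vec_eq_iff forall_2)
  then have dd: "d1 * d1 + d2 * d2 > 0" by (auto simp: sum_squares_gt_zero_iff)
  define t where "t = (d1 * e1 + d2 * e2) / (d1 * d1 + d2 * d2)"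
  have t: "e1 = t * d1" "e2 = t * d2"
    using dd o by (auto simp: t_def eq_divide_eq algebra_simps)
  have "x = (1 - t) *\<^sub>R p + (1 - (1 - t)) *\<^sub>R q"
    using t by (simp add: defs vec_eq_iff forall_2 algebra_simps)
  then show ?thesis unfolding collinear_3_expand by blast
qed

lemma extreme_points_not_collinear:
  assumes e: "p extreme_point_of K" "q extreme_point_of K" "r extreme_point_of K" and ne: "p \<noteq> q" "q \<noteq> r" "p \<noteq> r"
  shows "orient p q r \<noteq> 0"
proof
  assume "orient p q r = 0"
  then have "between (r, q) p \<or> between (q, p) r \<or> between (p, r) q"
    using orient_zero_collinear ne(1) collinear_between_cases by blast
  moreover have "p \<notin> open_segment r q" "r \<notin> open_segment q p" "q \<notin> open_segment p r"
    using e by (auto simp: extreme_point_of_def)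
  ultimately show False using ne by (auto simp: between_mem_segment open_segment_def)
qed

lemma hvertices_extreme:
  assumes "K \<subseteq> H2"
  shows "hvertices K = {x. x extreme_point_of K}"
proof -
  have "geodesic_segment x y = closed_segment x y" if "x \<in> K" "y \<in> K" for x y
    using that assms by (intro geodesic_segment_eq_closed_segment) auto
  then show ?thesis
    by (auto simp: hvertices_def extreme_point_of_def open_segment_def)
qed

section \<open>From vertex lists to integer-indexed polygons\<close>

definition cyc :: "nat \<Rightarrow> (nat \<Rightarrow> 'a) \<Rightarrow> int \<Rightarrow> 'a" where
  "cyc n v i = v (nat (i mod int n))"

lemma cyc_nat: "n > 0 \<Longrightarrow> cyc n v (int k) = v (k mod n)"
  by (simp add: cyc_def flip: zmod_int)

lemma cyc_periodic: "cyc n v (i + int n) = cyc n v i"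
  by (simp add: cyc_def)

lemma cyc_cong: "i mod int n = k mod int n \<Longrightarrow> cyc n v i = cyc n v k"
  by (simp add: cyc_def)

text \<open>A property of the sequence as seen from a starting index has to be checked only at the
  \<open>n\<close> indices of the list.\<close>

lemma cyc_all:
  assumes "n > 0" "\<And>k. k < n \<Longrightarrow> P (\<lambda>d. cyc n v (int k + d))"
  shows "P (\<lambda>d. cyc n v (i + d))"
proof -
  have "nat (i mod int n) < n" using assms(1) by (simp add: nat_less_iff)
  from assms(2)[OF this] have "P (\<lambda>d. cyc n v (i mod int n + d))" using assms(1) by simp
  moreover have "cyc n v (i mod int n + d) = cyc n v (i + d)" for d by (rule cyc_cong) (simp add: mod_simps)
  ultimately show ?thesis by simp
qed

text \<open>The vertices may be listed clockwise; \<open>\<sigma>\<close> reverses their order in this case.\<close>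

lemma cyclic_polygon_of_hngon:
  assumes n: "n \<ge> 3" and K: "hngon n K" and v: "cyclic_vertices n v K"
  obtains \<sigma> :: int where "\<sigma> = 1 \<or> \<sigma> = - 1" "cyclic_polygon n (\<lambda>i. cyc n v (\<sigma> * i))"
    "K = convex hull ((\<lambda>i. cyc n v (\<sigma> * i)) ` {0..<int n})"
proof -
  define U where "U = cyc n v"
  have KK: "K \<subseteq> H2" "convex K" "compact K" using K by (auto simp: hngon_def hpolygon_def hconvex_body_def hconvex_iff)
  have bij: "bij_betw v {..<n} (hvertices K)" using v by (simp add: cyclic_vertices_def)
  have ext: "hvertices K = {x. x extreme_point_of K}" by (rule hvertices_extreme[OF KK(1)])
  have lt: "nat (i mod int n) < n" for i using n by (simp add: nat_less_iff)
  have Ue: "U i extreme_point_of K" for i using bij lt[of i] ext unfolding U_def cyc_def bij_betw_def by blast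
  have UK: "U i \<in> K" for i using Ue by (simp add: extreme_point_of_def)
  have UH: "U i \<in> H2" for i using UK KK by blast
  have Uper: "U (i + int n) = U i" for i by (simp add: U_def cyc_periodic)
  have Une: "U i \<noteq> U k" if "\<not> int n dvd i - k" for i k
  proof
    assume "U i = U k"
    then have "nat (i mod int n) = nat (k mod int n)" using bij lt unfolding U_def cyc_def bij_betw_def inj_on_def by blast
    then have "i mod int n = k mod int n" using n by (simp add: nat_eq_iff)
    then show False using that by (simp add: mod_eq_dvd_iff)
  qed
  have nd: "\<not> int n dvd 1" "\<not> int n dvd 2" "\<not> int n dvd - 1" "\<not> int n dvd - 2"
    using n zdvd_not_zless[of 1 "int n"] zdvd_not_zless[of 2 "int n"] by auto
  have image: "U ` {0..<int n} = hvertices K"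
  proof -
    have "U ` {0..<int n} = v ` {..<n}"
    proof -
      have "{0..<int n} = int ` {..<n}" by (simp add: image_int_atLeastLessThan lessThan_atLeast0)
      then show ?thesis using n by (simp add: image_image U_def cyc_def)
    qed
    then show ?thesis using bij by (simp add: bij_betw_def)
  qed
  have hull: "K = convex hull (U ` {0..<int n})"
    unfolding image ext by (rule Krein_Milman_Minkowski[OF KK(3,2)])
  have sl: "supporting_line K (hline (U i) (U (i + 1)))" for i
  proof -
    have "supporting_line K (hline (cyc n v (i + 0)) (cyc n v (i + 1)))"
    proof (rule cyc_all[where P = "\<lambda>f. supporting_line K (hline (f 0) (f 1))"])
      fix k assume "k < n"
      moreover have "int k + 1 = int (k + 1)" by simp
      ultimately show "supporting_line K (hline (cyc n v (int k + 0)) (cyc n v (int k + 1)))"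
        using v n unfolding cyclic_vertices_def by (simp only: add_0_right cyc_nat) simp
    qed (use n in simp)
    then show ?thesis by (simp add: U_def)
  qed
  have sign: "(\<forall>x\<in>K. orient (U i) (U (i + 1)) x \<ge> 0) \<or> (\<forall>x\<in>K. orient (U i) (U (i + 1)) x \<le> 0)" for i
    using sl UH Une[of i "i + 1"] nd by (intro supporting_line_orient) auto
  have nz: "orient (U i) (U (i + 1)) (U k) \<noteq> 0" if "\<not> int n dvd k - i" "\<not> int n dvd k - i - 1" for i k
  proof (rule extreme_points_not_collinear[OF Ue Ue Ue])
    show "U i \<noteq> U (i + 1)" using Une[of i "i + 1"] nd by simp
    have "k - (i + 1) = k - i - 1" by simp
    then show "U (i + 1) \<noteq> U k" using Une[of k "i + 1"] that by metis
    show "U i \<noteq> U k" using Une[of k i] that by metis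
  qed
  have nz2: "orient (U i) (U (i + 1)) (U (i + 2)) \<noteq> 0" for i using nz[of "i + 2" i] nd by simp
  \<comment> \<open>Neighbouring sides share this nonzero triple, so the side of the line on which
    \<open>K\<close> lies cannot switch from one side of the polygon to the next.\<close>
  have eq2: "orient (U (i + 1)) (U (i + 1 + 1)) (U i) = orient (U i) (U (i + 1)) (U (i + 2))" for i
    using orient_cycle[of "U (i + 1)" "U (i + 2)" "U i"] by (simp add: add.assoc)
  define P where "P i \<longleftrightarrow> (\<forall>x\<in>K. orient (U i) (U (i + 1)) x \<ge> 0)" for i
  define N where "N i \<longleftrightarrow> (\<forall>x\<in>K. orient (U i) (U (i + 1)) x \<le> 0)" for i
  have PN: "P i \<or> N i" for i using sign by (simp add: P_def N_def)
  have Pstep: "P (i + 1)" if "P i" for i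
  proof -
    have "orient (U (i + 1)) (U (i + 1 + 1)) (U i) > 0"
      unfolding eq2 using that nz2[of i] UK by (auto simp: P_def order_less_le)
    then have "\<not> N (i + 1)" using UK[of i] by (auto simp: N_def not_le)
    then show ?thesis using PN by blast
  qed
  have Nstep: "N (i + 1)" if "N i" for i
  proof -
    have "orient (U (i + 1)) (U (i + 1 + 1)) (U i) < 0"
      unfolding eq2 using that nz2[of i] UK by (auto simp: N_def order_less_le)
    then have "\<not> P (i + 1)" using UK[of i] by (auto simp: P_def not_le)
    then show ?thesis using PN by blast
  qed
  \<comment> \<open>Forward induction only reaches nonnegative indices; periodicity gives the
    rest.\<close>
  have red: "Q i" if "Q (0 :: int)" "\<And>i. Q i \<Longrightarrow> Q (i + 1)" "\<And>i. Q (i mod int n) \<longleftrightarrow> Q i" for Q i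
  proof -
    have "Q (int k)" for k
    proof (induction k)
      case (Suc k)
      then have "Q (int k + 1)" by (rule that(2))
      then show ?case by (simp add: add.commute)
    qed (use that(1) in simp)
    from this[of "nat (i mod int n)"] have "Q (i mod int n)" using n by simp
    then show ?thesis using that(3) by simp
  qed
  have Umod: "U (i mod int n) = U i" "U (i mod int n + 1) = U (i + 1)" for i
    unfolding U_def by (rule cyc_cong, simp add: mod_simps)+
  show ?thesis
  proof (cases "P 0")
    case True
    then have "P i" for i using Pstep by (rule red[of P]) (simp_all add: P_def Umod)
    then have "orient (U i) (U (i + 1)) (U k) \<ge> 0" for i k using UK by (auto simp: P_def)
    then have "cyclic_polygon n U"
      using n UH Uper nz by unfold_locales (auto simp: order_less_le)
    then show ?thesis using that[of 1] hull by (simp add: U_def)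
  next
    case False
    then have "N 0" using PN by blast
    then have "N i" for i using Nstep by (rule red[of N]) (simp_all add: N_def Umod)
    then have le: "orient (U i) (U (i + 1)) (U k) \<le> 0" for i k using UK by (auto simp: N_def)
    have "cyclic_polygon n (\<lambda>i. U (- i))"
    proof unfold_locales
      show "U (- (i + int n)) = U (- i)" for i using Uper[of "- i - int n"] by simp
      fix k i assume d: "\<not> int n dvd k - i" "\<not> int n dvd k - i - 1"
      \<comment> \<open>The reversed side from \<open>- i\<close> to \<open>- (i + 1)\<close> is the
        original side number \<open>- (i + 1)\<close>, traversed backwards.\<close>
      have "- k - (- (i + 1)) = - (k - i - 1)" "- k - (- (i + 1)) - 1 = - (k - i)" by simp_all
      then have "\<not> int n dvd - k - (- (i + 1))" "\<not> int n dvd - k - (- (i + 1)) - 1" using d by (simp_all only: dvd_minus_iff not_False_eq_True)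
      then have "orient (U (- (i + 1))) (U (- (i + 1) + 1)) (U (- k)) < 0"
        using nz[of "- k" "- (i + 1)"] le[of "- (i + 1)" "- k"] by (simp only: order_less_le) simp
      then have "orient (U (- (i + 1))) (U (- i)) (U (- k)) < 0" by simp
      then show "0 < orient (U (- i)) (U (- (i + 1))) (U (- k))"
        using orient_reverse by (metis neg_0_less_iff_less)
    qed (use n UH in auto)
    moreover have "(\<lambda>i. U (- i)) ` {0..<int n} = U ` {0..<int n}"
    proof -
      have e: "U (- i) = U ((- i) mod int n)" "U i = U (- ((- i) mod int n))" for i
        unfolding U_def by (rule cyc_cong, simp add: mod_simps)+
      have "(- i) mod int n \<in> {0..<int n}" for i using n by simp
      then have "U (- i) \<in> U ` {0..<int n}" "U i \<in> (\<lambda>i. U (- i)) ` {0..<int n}" for i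
        using e[of i] by (metis imageI)+
      then show ?thesis by blast
    qed
    ultimately show ?thesis using that[of "- 1"] hull by (simp add: U_def)
  qed
qed

text \<open>By Pythagoras, moving along the line away from the foot multiplies the cosh of the
  distance by a number at least 1.\<close>

lemma hsetdist_foot:
  assumes H: "p \<in> H2" "a \<in> H2" "b \<in> H2" and q: "q \<in> closed_segment a b"
    and r: "orthogonal_projection (hline a b) p q"
  shows "hsetdist {p} (geodesic_segment a b) = hdist p q"
proof -
  have seg: "geodesic_segment a b = closed_segment a b" by (rule geodesic_segment_eq_closed_segment[OF H(2,3)])
  have sub: "closed_segment a b \<subseteq> hline a b" by (rule closed_segment_subset_hline[OF H(2,3)])
  have lH: "hline a b \<subseteq> H2" by (simp add: hline_def)
  have qH: "q \<in> H2" using q sub lH by blast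
  have le: "hdist p q \<le> hdist p y" if y: "y \<in> closed_segment a b" for y
  proof -
    have yH: "y \<in> H2" using y sub lH by blast
    have "klein_metric q (p - q) (y - q) = 0" using r y sub by (auto simp: orthogonal_projection_def)
    then have "Re (turn q p y) = 0" using pairing_pos[OF qH qH] unfolding klein_metric_turn[OF qH] by simp
    then have "cosh (hdist p y) = cosh (hdist q p) * cosh (hdist q y)" by (rule pythagoras[OF qH H(1) yH])
    also have "\<dots> \<ge> cosh (hdist q p) * 1" using cosh_real_ge_1 by (intro mult_left_mono) auto
    finally have "cosh (hdist p q) \<le> cosh (hdist p y)" by (simp add: hdist_commute)
    then show ?thesis using hdist_nonneg H qH yH by (subst (asm) cosh_real_nonneg_le_iff) auto
  qed
  have "hsetdist {p} (closed_segment a b) = Inf (hdist p ` closed_segment a b)"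
  proof -
    have "(\<lambda>(x, y). hdist x y) ` ({p} \<times> closed_segment a b) = hdist p ` closed_segment a b" by force
    then show ?thesis by (simp add: hsetdist_def)
  qed
  also have "\<dots> = hdist p q" using q le by (intro cInf_eq_minimum) auto
  finally show ?thesis by (simp add: seg)
qed

lemma ordinary_reduced_harea:
  assumes n: "n \<ge> 3" and R: "ordinary_reduced n w R"
  obtains \<eta> :: "int \<Rightarrow> real" where "\<And>i. 0 < \<eta> i" "\<And>i. \<eta> i < pi / 4"
    "(\<Sum>i\<in>{0..<int n}. half_apex (tanh (w / 2)) (\<eta> i)) \<le> pi / 2"
    "harea R = 4 * (\<Sum>i\<in>{0..<int n}. \<eta> i) - 2 * pi"
proof -
  have "odd n" and ng: "hngon n R" using R by (auto simp: ordinary_reduced_def)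
  then obtain m where m: "n = 2 * m + 1" by (auto elim: oddE)
  obtain v where v: "cyclic_vertices n v R" and
    A: "\<And>i. i < n \<Longrightarrow> let a = v ((i + (n - 1) div 2) mod n); b = v ((i + (n + 1) div 2) mod n) in
          hsetdist {v i} (geodesic_segment a b) = w \<and>
          (\<exists>q \<in> geodesic_segment a b - {a, b}. orthogonal_projection (hline a b) (v i) q)"
    using R by (auto simp: ordinary_reduced_def)
  obtain \<sigma> :: int where \<sigma>: "\<sigma> = 1 \<or> \<sigma> = - 1" and cp: "cyclic_polygon n (\<lambda>i. cyc n v (\<sigma> * i))"
    and hull: "R = convex hull ((\<lambda>i. cyc n v (\<sigma> * i)) ` {0..<int n})"
    using cyclic_polygon_of_hngon[OF n ng v] by blast
  interpret C: cyclic_polygon n "\<lambda>i. cyc n v (\<sigma> * i)" by (rule cp)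
  define U where "U = cyc n v"
  have UH: "U i \<in> H2" for i using C.in_H2[of "\<sigma> * i"] \<sigma> by (auto simp: U_def)
  have Uper: "U (i + int n) = U i" for i by (simp add: U_def cyc_periodic)
  \<comment> \<open>Symmetric in \<open>a\<close> and \<open>b\<close>, so that reversing the order
    of the vertices preserves it.\<close>
  define Q where "Q = (\<lambda>p a b q. q \<in> open_segment a b \<and> Re (turn q p a) = 0 \<and> Re (turn q p b) = 0 \<and> hdist p q = w)"
  have QS: "Q p a b q \<longleftrightarrow> Q p b a q" for p a b q by (auto simp: Q_def open_segment_commute)
  have ex0: "\<exists>q. Q (U (int k)) (U (int k + int m)) (U (int k + int m + 1)) q" if k: "k < n" for k
  proof -
    define a b where "a = U (int k + int m)" and "b = U (int k + int m + 1)"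
    have div: "(n - 1) div 2 = m" "(n + 1) div 2 = m + 1" using m by auto
    have "int k + int m = int (k + m)" "int k + int m + 1 = int (k + (m + 1))" by simp_all
    then have ab: "a = v ((k + m) mod n)" "b = v ((k + (m + 1)) mod n)"
      unfolding a_def b_def U_def using n by (simp_all only: cyc_nat)
    have Uk: "U (int k) = v k" using n k cyc_nat[of n v k] by (simp add: U_def)
    have H: "a \<in> H2" "b \<in> H2" "U (int k) \<in> H2" using UH by (auto simp: a_def b_def)
    obtain q where w: "hsetdist {U (int k)} (geodesic_segment a b) = w" and q: "q \<in> geodesic_segment a b - {a, b}"
      and o: "orthogonal_projection (hline a b) (U (int k)) q"
      using A[OF k] unfolding Let_def div ab[symmetric] Uk by blast
    have qs: "q \<in> closed_segment a b" using q geodesic_segment_eq_closed_segment[OF H(1,2)] by auto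
    have qH: "q \<in> H2" using o by (auto simp: orthogonal_projection_def hline_def)
    have "klein_metric q (U (int k) - q) (z - q) = 0" if "z \<in> hline a b" for z
      using o that by (simp add: orthogonal_projection_def)
    then have "Re (turn q (U (int k)) z) = 0" if "z \<in> hline a b" for z
      using that pairing_pos[OF qH qH] unfolding klein_metric_turn[OF qH] by simp
    then have "Re (turn q (U (int k)) a) = 0" "Re (turn q (U (int k)) b) = 0" using hline_mem H by auto
    moreover have "hdist (U (int k)) q = w" using hsetdist_foot[OF H(3,1,2) qs o] w by simp
    moreover have "q \<in> open_segment a b" using q qs by (simp add: open_segment_def)
    ultimately show ?thesis unfolding Q_def a_def b_def by blast
  qed
  \<comment> \<open>The choice depends on \<open>i\<close> only through values of \<open>U\<close>
    and therefore inherits their period.\<close>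
  define \<tau> where "\<tau> i = (SOME q. Q (U i) (U (i + int m)) (U (i + int m + 1)) q)" for i
  have \<tau>: "Q (U i) (U (i + int m)) (U (i + int m + 1)) (\<tau> i)" for i
  proof -
    define k where "k = nat (i mod int n)"
    have k: "int k = i mod int n" "k < n" using n by (simp_all add: k_def nat_less_iff)
    have "(int k + d) mod int n = (i + d) mod int n" for d by (simp add: k mod_simps)
    then have e: "U (int k + d) = U (i + d)" for d unfolding U_def by (rule cyc_cong)
    have "\<exists>q. Q (U i) (U (i + int m)) (U (i + int m + 1)) q"
      using ex0[OF k(2)] e[of 0] e[of "int m"] e[of "int m + 1"] by (simp only: add_0_right add.assoc)
    then show ?thesis unfolding \<tau>_def by (rule someI_ex)
  qed
  have \<tau>per: "\<tau> (i + int n) = \<tau> i" for i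
  proof -
    have "U (i + int n) = U i" "U (i + int n + int m) = U (i + int m)" "U (i + int n + int m + 1) = U (i + int m + 1)"
      using Uper[of i] Uper[of "i + int m"] Uper[of "i + int m + 1"] by (simp_all add: algebra_simps)
    then show ?thesis by (simp add: \<tau>_def)
  qed
  define t where "t i = \<tau> (\<sigma> * i)" for i
  have Qt: "Q (U (\<sigma> * i)) (U (\<sigma> * (i + int m))) (U (\<sigma> * (i + int m + 1))) (t i)" for i
  proof (cases "\<sigma> = 1")
    case True
    then show ?thesis using \<tau>[of i] by (simp add: t_def)
  next
    case False
    then have s: "\<sigma> = - 1" using \<sigma> by simp
    \<comment> \<open>Since n = 2 m + 1, reversal maps the opposite side to the opposite side with
      its ends exchanged.\<close>
    have e: "U (- i + int m) = U (- (i + int m + 1))" "U (- i + int m + 1) = U (- (i + int m))"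
      using Uper[of "- (i + int m + 1)"] Uper[of "- (i + int m)"] by (simp_all add: m algebra_simps)
    show ?thesis using \<tau>[of "- i"] unfolding e QS[of _ "U (- (i + int m + 1))"] by (simp add: s t_def)
  qed
  have tper: "t (i + int n) = t i" for i
    using \<sigma> \<tau>per[of i] \<tau>per[of "- i - int n"] by (auto simp: t_def)
  interpret O: ordinary_polygon n "\<lambda>i. cyc n v (\<sigma> * i)" m t w
    by unfold_locales (use m tper Qt in \<open>auto simp: Q_def U_def\<close>)
  have "R = C.body" unfolding hull C.body_def ..
  then show ?thesis using O.harea_body_half_angles that by metis
qed

text \<open>Here \<open>h\<close> is inradius plus circumradius. Only an upper bound for the minimal
  width is extracted, through the supporting line along one side.\<close>

lemma regular_hngon_harea:
  assumes n: "n \<ge> 3" and R: "regular_hngon n R"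
  obtains h \<eta> :: real where "0 < h" "minimal_width R \<le> h" "0 < \<eta>" "\<eta> < pi / 4"
    "pi / (2 * real n) \<le> half_apex (tanh (h / 2)) \<eta>" "harea R = 4 * (real n * \<eta>) - 2 * pi"
proof -
  have ng: "hngon n R" using R by (simp add: regular_hngon_def)
  obtain v s \<alpha> where v: "cyclic_vertices n v R" and S: "\<And>i. i < n \<Longrightarrow> hdist (v i) (v ((i + 1) mod n)) = s"
    and A: "\<And>i. i < n \<Longrightarrow> hangle (v i) (v ((i + n - 1) mod n)) (v ((i + 1) mod n)) = \<alpha>"
    using R unfolding regular_hngon_def by blast
  obtain \<sigma> :: int where \<sigma>: "\<sigma> = 1 \<or> \<sigma> = - 1" and cp: "cyclic_polygon n (\<lambda>i. cyc n v (\<sigma> * i))"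
    and hull: "R = convex hull ((\<lambda>i. cyc n v (\<sigma> * i)) ` {0..<int n})"
    using cyclic_polygon_of_hngon[OF n ng v] by blast
  interpret C: cyclic_polygon n "\<lambda>i. cyc n v (\<sigma> * i)" by (rule cp)
  define U where "U = cyc n v"
  have all: "hdist (U i) (U (i + 1)) = s \<and> hangle (U i) (U (i + - 1)) (U (i + 1)) = \<alpha>
      \<and> supporting_line R (hline (U i) (U (i + 1)))" for i
  proof -
    have "hdist (cyc n v (i + 0)) (cyc n v (i + 1)) = s \<and> hangle (cyc n v (i + 0)) (cyc n v (i + - 1)) (cyc n v (i + 1)) = \<alpha>
      \<and> supporting_line R (hline (cyc n v (i + 0)) (cyc n v (i + 1)))"
    proof (rule cyc_all[where P = "\<lambda>f. hdist (f 0) (f 1) = s \<and> hangle (f 0) (f (- 1)) (f 1) = \<alpha> \<and> supporting_line R (hline (f 0) (f 1))"])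
      fix k assume k: "k < n"
      have "cyc n v (int k + 0) = v k" using k n cyc_nat[of n v k] by simp
      moreover have "cyc n v (int k + 1) = v ((k + 1) mod n)"
        using n cyc_nat[of n v "k + 1"] by (simp add: add.commute)
      moreover have "cyc n v (int k + - 1) = v ((k + n - 1) mod n)"
      proof -
        have "int k + - 1 + int n = int (k + n - 1)" using n by simp
        then have "cyc n v (int k + - 1) = cyc n v (int (k + n - 1))"
          using cyc_periodic[of n v "int k + - 1"] by (simp only:)
        then show ?thesis using n cyc_nat[of n v "k + n - 1"] by (simp only:)
      qed
      ultimately show "hdist (cyc n v (int k + 0)) (cyc n v (int k + 1)) = s \<and>
         hangle (cyc n v (int k + 0)) (cyc n v (int k + - 1)) (cyc n v (int k + 1)) = \<alpha> \<and>
         supporting_line R (hline (cyc n v (int k + 0)) (cyc n v (int k + 1)))"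
        using S[OF k] A[OF k] v k by (simp add: cyclic_vertices_def)
    qed (use n in simp)
    then show ?thesis by (simp add: U_def)
  qed
  have hc: "hangle p x y = hangle p y x" for p x y
    by (simp add: hangle_def klein_metric_def inner_commute mult.commute)
  have ang\<alpha>: "C.interior_angle i = \<alpha>" for i
  proof -
    let ?u = "\<lambda>i. cyc n v (\<sigma> * i)"
    have "orient (?u i) (?u (i + 1)) (?u (i - 1 + int n)) > 0" using n by (intro C.orient_pos) auto
    then have o: "orient (?u i) (?u (i + 1)) (?u (i - 1)) > 0" using C.periodic[of "i - 1"] by simp
    then have ne: "?u (i + 1) \<noteq> ?u i" "?u (i - 1) \<noteq> ?u i" by auto
    have "C.interior_angle i = hangle (?u i) (?u (i + 1)) (?u (i - 1))"
      unfolding C.interior_angle_def using hangle_eq_ang[OF C.in_H2 C.in_H2 C.in_H2 ne] o by simp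
    also have "\<dots> = \<alpha>"
    proof (cases "\<sigma> = 1")
      case True
      then show ?thesis using all[of i] hc by (simp add: U_def)
    next
      case False
      then have "\<sigma> = - 1" using \<sigma> by simp
      then show ?thesis using all[of "- i"] by (simp add: U_def)
    qed
    finally show ?thesis .
  qed
  have side: "hdist (cyc n v (\<sigma> * i)) (cyc n v (\<sigma> * (i + 1))) = s" for i
    using \<sigma> all[of i] all[of "- i - 1"] by (auto simp: U_def hdist_commute)
  interpret G: regular_polygon n "\<lambda>i. cyc n v (\<sigma> * i)" s \<alpha>
    by unfold_locales (rule side, rule ang\<alpha>)
  have body: "R = C.body" unfolding hull C.body_def ..
  obtain b c \<eta> x where bc: "0 < b" "0 < c" and \<eta>: "0 < \<eta>" "\<eta> < pi / 4"
    "pi / (2 * real n) \<le> half_apex (tanh ((b + c) / 2)) \<eta>" "harea C.body = 4 * (real n * \<eta>) - 2 * pi"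
    and x: "x \<in> closed_segment (cyc n v (\<sigma> * 0)) (cyc n v (\<sigma> * 1))" "\<And>y. y \<in> C.body \<Longrightarrow> hdist x y \<le> b + c"
    by (rule G.regular_half_angle) blast
  have sl: "supporting_line R (hline (cyc n v (\<sigma> * 0)) (cyc n v (\<sigma> * 1)))"
  proof (cases "\<sigma> = 1")
    case True
    then show ?thesis using all[of 0] by (simp add: U_def)
  next
    case False
    then have "\<sigma> = - 1" using \<sigma> by simp
    then show ?thesis using all[of "- 1"] by (simp add: U_def hline_def insert_commute)
  qed
  have "minimal_width R \<le> b + c"
  proof (rule minimal_width_le[OF _ sl])
    show "R \<subseteq> H2" unfolding body by (rule C.body_H2)
    show "x \<in> hline (cyc n v (\<sigma> * 0)) (cyc n v (\<sigma> * 1))"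
      using x(1) closed_segment_subset_hline[OF C.in_H2 C.in_H2] by blast
    show "hdist x y \<le> b + c" if "y \<in> R" for y using x(2) that unfolding body by blast
  qed
  moreover have "0 < b + c" using bc by simp
  ultimately show ?thesis using that \<eta> unfolding body by blast
qed

theorem theorem1p1:
  fixes w :: real and n :: nat and R R' :: "(real ^ 2) set"
  assumes "w > 0" and "n \<ge> 3" and "odd n"
    and "ordinary_reduced n w R"
    and "regular_hngon n R'" and "minimal_width R' = w"
  shows "harea R \<le> harea R'"
proof -
  obtain \<eta> :: "int \<Rightarrow> real" where \<eta>: "\<And>i. 0 < \<eta> i" "\<And>i. \<eta> i < pi / 4"
    "(\<Sum>i\<in>{0..<int n}. half_apex (tanh (w / 2)) (\<eta> i)) \<le> pi / 2"
    "harea R = 4 * (\<Sum>i\<in>{0..<int n}. \<eta> i) - 2 * pi"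
    using ordinary_reduced_harea[OF assms(2,4)] by blast
  obtain h \<zeta> :: real where \<zeta>: "0 < h" "minimal_width R' \<le> h" "0 < \<zeta>" "\<zeta> < pi / 4"
    "pi / (2 * real n) \<le> half_apex (tanh (h / 2)) \<zeta>" "harea R' = 4 * (real n * \<zeta>) - 2 * pi"
    using regular_hngon_harea[OF assms(2,5)] by blast
  define s where "s = tanh (w / 2)"
  define D where "D = half_apex_deriv s (tan \<zeta>)"
  have s: "0 \<le> s" "s < 1" using assms(1) by (simp_all add: s_def tanh_real_lt_1)
  have "half_apex (tanh (h / 2)) \<zeta> \<le> half_apex s \<zeta>"
    using s \<zeta> assms(6) by (intro half_apex_antimono) (simp_all add: s_def tanh_real_lt_1)
  then have "real n * (pi / (2 * real n)) \<le> real n * half_apex s \<zeta>" using \<zeta>(5) by (intro mult_left_mono) auto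
  then have "pi / 2 \<le> real n * half_apex s \<zeta>" using assms(2) by simp
  \<comment> \<open>Each term is bounded below by the tangent at the regular value \<zeta>. Since
    the tangent has positive slope \<open>D\<close>, a mean of the \<eta> values above \<zeta> would
    push the sum of half apex angles beyond \<pi>/2.\<close>
  moreover have "(\<Sum>i\<in>{0..<int n}. half_apex s \<zeta> + D * (\<eta> i - \<zeta>)) \<le> (\<Sum>i\<in>{0..<int n}. half_apex s (\<eta> i))"
    unfolding D_def using s \<eta> \<zeta> by (intro sum_mono half_apex_tangent) auto
  moreover have "(\<Sum>i\<in>{0..<int n}. half_apex s \<zeta> + D * (\<eta> i - \<zeta>))
     = real n * half_apex s \<zeta> + D * ((\<Sum>i\<in>{0..<int n}. \<eta> i) - real n * \<zeta>)"
    by (simp add: sum.distrib sum_subtractf right_diff_distrib flip: sum_distrib_left)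
  ultimately have "D * ((\<Sum>i\<in>{0..<int n}. \<eta> i) - real n * \<zeta>) \<le> 0" using \<eta>(3) by (simp add: s_def)
  moreover have "D > 0" unfolding D_def using s tan_open_octant[OF \<zeta>(3,4)] by (intro half_apex_deriv_pos)
  ultimately have "(\<Sum>i\<in>{0..<int n}. \<eta> i) \<le> real n * \<zeta>" by (simp add: mult_le_0_iff)
  then show ?thesis unfolding \<eta>(4) \<zeta>(6) by simp
qed

end
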